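(* Let $A_1,\dots,A_m,C\in\mathbb{Z}^{n\times n}$ be symmetric and $b\in\mathbb{Z}^m$, with bitsize at most $\tau_0$. Consider the auxiliary SDP $\mathcal{P}_{\mathrm{aux}}$ and its reformulation as a standard SDP over a single block variable $\mathcal{X}\in\mathcal{S}_{\bar n}^+$ with $\bar n:=2n+2m+2$ and with $\bar m:=m+\frac{n(n+1)}{2}+1$ equality constraints. Let $\gamma$ be an isolated solution of the squared-up KKT system associated with this formulation. Then, for every nonzero coordinate $\gamma_k$, it holds that $$2^{-\bar\eta_1}\le|\gamma_k|\le2^{\bar\eta_1},$$ where $$\bar N:=\bar n(\bar n+1)+\bar m,\qquad \bar p:=\bar m+\frac{\bar n(\bar n+1)}2+\bar n^2,\qquad \bar\tau_1:=\tau_0+\bar N+\lg(\bar p),$$ and $$\bar\eta_1=\frac{\bar N^2-\bar N}{2}+2^{\bar N}+\bar N(\bar\tau_1+\bar N+2)\,2^{\bar N-1}=\tau_0\,2^{\widetilde{\mathcal{O}}((n+m)^2)}.$$ In particular, every nonzero entry of the blocks $X,Z,y,s,w$ and $r$ of an isolated KKT solution is bounded in absolute value by $2^{\bar\eta_1}$.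
   Context: $\mathcal{S}_k$ is the space of real symmetric $k\times k$ matrices, $\mathcal{S}_k^+$ its cone of positive semidefinite matrices, $\langle A,B\rangle=\operatorname{tr}(AB)$, $\lg$ is the logarithm in base $2$, and $\widetilde{\mathcal{O}}(\cdot)$ ignores (poly)logarithmic factors. The bitsize bound is $\tau_0=1+\max\{\lg|(A_i)_{j,k}|,\lg|C_{j,k}|,\lg|b_i|\}$ (maximum over nonzero entries). Auxiliary SDP: $\mathcal{P}_{\mathrm{aux}}$ is the problem $\inf w$ subject to $\langle A_i,X\rangle+w\ge b_i$ for $i\in[m]$, $\sum_{i=1}^m y_iA_i-wI_n\preceq C$, $\langle C,X\rangle-b^Ty-w\le 0$, $X\succeq 0$, $y\ge 0$, $w\ge 0$. Reformulation: introduce slack variables $s\in\mathbb{R}^m_+$, $Z\in\mathcal{S}_n^+$, $r\in\mathbb{R}_+$, so that the constraints become $\langle A_i,X\rangle+w-s_i=b_i$ ($i\in[m]$), $\sum_i y_iA_i-wI_n+Z=C$, $\langle C,X\rangle-b^Ty-w+r=0$, with $X,Z\succeq0$ and $y,s,w,r\ge0$. Encode all variables in the block-diagonal matrix $\mathcal{X}=\operatorname{diag}(X,Z,\operatorname{diag}(y),\operatorname{diag}(s),w,r)\in\mathcal{S}_{2n+2m+2}^+$. Then $\mathcal{P}_{\mathrm{aux}}$ takes the standard form $\min\langle\mathcal{C},\mathcal{X}\rangle$ s.t. $\langle\mathcal{A}_j,\mathcal{X}\rangle=\beta_j$ ($j\in[\bar m]$), $\mathcal{X}\succeq0$, where $\mathcal{C}$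 extracts the $w$-component of $\mathcal{X}$ and the symmetric matrices $\mathcal{A}_j$ and numbers $\beta_j$ encode $m+\frac{n(n+1)}2+1$ scalar linear equalities, namely the $m$ equations $\langle A_i,X\rangle+w-s_i=b_i$ ($i\in[m]$), the $\frac{n(n+1)}2$ scalar equations given by the entries of the symmetric matrix identity $\sum_i y_iA_i-wI_n+Z=C$, and the equation $\langle C,X\rangle-b^Ty-w+r=0$. KKT system of the reformulation: in the unknowns $(\mathcal{X},\mathcal{S},\mathbf{y})\in\mathcal{S}_{\bar n}\times\mathcal{S}_{\bar n}\times\mathbb{R}^{\bar m}$, the polynomial system $\langle\mathcal{A}_j,\mathcal{X}\rangle-\beta_j=0$ ($j\in[\bar m]$), $\mathcal{S}-\mathcal{C}+\sum_j\mathbf{y}_j\mathcal{A}_j=0$, $\mathcal{X}\mathcal{S}=0$; it has $\bar N$ scalar variables and $\bar p$ scalar equations, of degree at most $2$. The squared-up KKT system is a square system of $\bar N$ generic integer linear combinations of these $\bar p$ equations, with coefficients of bitsize at most $\bar\tau_1$, chosen so that every irreducible component of its variety is either an irreducible component of the variety of the KKT system or an isolated point (in particular all isolated solutions of the KKT system are isolated solutions of the squared-up system). *)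

theory Defs
  imports "HOL-Analysis.Analysis" "HOL-Library.Poly_Mapping" "HOL-Library.Uprod"
    "HOL-Library.Landau_Symbols"
begin

section \<open>Complex polynomials in finitely many variables and their zero sets\<close>

text \<open>Monomials are exponent vectors \<^typ>\<open>'v \<Rightarrow>\<^sub>0 nat\<close>; the convolution product of
  \<^theory>\<open>HOL-Library.Poly_Mapping\<close> is then the multiplication of polynomials.\<close>

type_synonym 'v cpoly = "('v \<Rightarrow>\<^sub>0 nat) \<Rightarrow>\<^sub>0 complex"

definition const_poly :: "complex \<Rightarrow> 'v cpoly" where
  "const_poly c = Poly_Mapping.single 0 c"

definition var_poly :: "'v \<Rightarrow> 'v cpoly" where
  "var_poly v = Poly_Mapping.single (Poly_Mapping.single v 1) 1"

definition eval_poly :: "'v::finite cpoly \<Rightarrow> complex^'v \<Rightarrow> complex" where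
  "eval_poly f x =
    (\<Sum>t\<in>Poly_Mapping.keys f. Poly_Mapping.lookup f t * (\<Prod>v\<in>UNIV. x $ v ^ Poly_Mapping.lookup t v))"

definition zeros :: "'v::finite cpoly set \<Rightarrow> (complex^'v) set" where
  "zeros F = {x. \<forall>f\<in>F. eval_poly f x = 0}"

definition zariski_closed :: "(complex^'v::finite) set \<Rightarrow> bool" where
  "zariski_closed V \<longleftrightarrow> (\<exists>F. V = zeros F)"

definition irreducible_variety :: "(complex^'v::finite) set \<Rightarrow> bool" where
  "irreducible_variety V \<longleftrightarrow> zariski_closed V \<and> V \<noteq> {} \<and>
    (\<forall>V1 V2. zariski_closed V1 \<and> zariski_closed V2 \<and> V = V1 \<union> V2 \<longrightarrow> V = V1 \<or> V = V2)"

definition irreducible_component :: "(complex^'v::finite) set \<Rightarrow> (complex^'v) set \<Rightarrow> bool" where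
  "irreducible_component W V \<longleftrightarrow> irreducible_variety W \<and> W \<subseteq> V \<and>
    (\<forall>W'. irreducible_variety W' \<and> W \<subseteq> W' \<and> W' \<subseteq> V \<longrightarrow> W' = W)"


section \<open>The reformulated auxiliary SDP\<close>

text \<open>Row and column indices of the block matrix
  \<open>diag(X, Z, diag(y), diag(s), w, r)\<close>, with \<open>n = CARD('n)\<close> and \<open>m = CARD('m)\<close>.\<close>

datatype ('n, 'm) blk = BX 'n | BZ 'n | By 'm | Bs 'm | Bw | Br

text \<open>The scalar equality constraints. The entries of a symmetric matrix identity are indexed by
  unordered pairs of indices (possibly equal), so there are \<open>n(n+1)/2\<close> of them.\<close>

datatype ('n, 'm) aux_con = Primal_con 'm | Dual_con "'n uprod" | Gap_con

instance uprod :: (finite) finite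
  by standard simp

lemma UNIV_blk: "(UNIV :: ('n, 'm) blk set) =
    BX ` UNIV \<union> (BZ ` UNIV \<union> (By ` UNIV \<union> (Bs ` UNIV \<union> {Bw, Br})))"
proof -
  have "x \<in> BX ` UNIV \<union> (BZ ` UNIV \<union> (By ` UNIV \<union> (Bs ` UNIV \<union> {Bw, Br})))"
    for x :: "('n, 'm) blk"
    by (cases x) auto
  then show ?thesis by auto
qed

instance blk :: (finite, finite) finite
  by standard (simp add: UNIV_blk)

lemma UNIV_aux_con: "(UNIV :: ('n, 'm) aux_con set) =
    Primal_con ` UNIV \<union> (Dual_con ` UNIV \<union> {Gap_con})"
proof -
  have "x \<in> Primal_con ` UNIV \<union> (Dual_con ` UNIV \<union> {Gap_con})" for x :: "('n, 'm) aux_con"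
    by (cases x) auto
  then show ?thesis by auto
qed

instance aux_con :: (finite, finite) finite
  by standard (simp add: UNIV_aux_con)

definition block_X :: "'a^('n::finite, 'm::finite) blk^('n, 'm) blk \<Rightarrow> 'a^'n^'n" where
  "block_X M = (\<chi> p q. M $ BX p $ BX q)"

definition block_Z :: "'a^('n::finite, 'm::finite) blk^('n, 'm) blk \<Rightarrow> 'a^'n^'n" where
  "block_Z M = (\<chi> p q. M $ BZ p $ BZ q)"

definition block_y :: "'a^('n::finite, 'm::finite) blk^('n, 'm) blk \<Rightarrow> 'a^'m" where
  "block_y M = (\<chi> i. M $ By i $ By i)"

definition block_s :: "'a^('n::finite, 'm::finite) blk^('n, 'm) blk \<Rightarrow> 'a^'m" where
  "block_s M = (\<chi> i. M $ Bs i $ Bs i)"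

definition block_w :: "'a^('n::finite, 'm::finite) blk^('n, 'm) blk \<Rightarrow> 'a" where
  "block_w M = M $ Bw $ Bw"

definition block_r :: "'a^('n::finite, 'm::finite) blk^('n, 'm) blk \<Rightarrow> 'a" where
  "block_r M = M $ Br $ Br"

definition inner_mat :: "'a::semiring_1^'k^'k \<Rightarrow> 'a^'k^'k \<Rightarrow> 'a" where
  "inner_mat M N = trace (M ** N)"

definition of_int_mat :: "int^'k^'k \<Rightarrow> real^'k^'k" where
  "of_int_mat = map_matrix of_int"

fun aux_equation ::
  "('m::finite \<Rightarrow> int^'n::finite^'n) \<Rightarrow> int^'n^'n \<Rightarrow> int^'m \<Rightarrow>
    real^('n, 'm) blk^('n, 'm) blk \<Rightarrow> ('n, 'm) aux_con \<Rightarrow> bool" where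
  "aux_equation A C b M (Primal_con i) \<longleftrightarrow>
    inner_mat (of_int_mat (A i)) (block_X M) + block_w M - block_s M $ i = of_int (b $ i)"
| "aux_equation A C b M (Dual_con u) \<longleftrightarrow>
    (\<forall>p q. u = Upair p q \<longrightarrow>
      ((\<Sum>i\<in>UNIV. block_y M $ i *\<^sub>R of_int_mat (A i)) - block_w M *\<^sub>R mat 1 + block_Z M) $ p $ q
        = of_int_mat C $ p $ q)"
| "aux_equation A C b M Gap_con \<longleftrightarrow>
    inner_mat (of_int_mat C) (block_X M) - (\<Sum>i\<in>UNIV. of_int (b $ i) * block_y M $ i)
      - block_w M + block_r M = 0"

text \<open>The standard form data \<open>(\<A>\<^sub>j, \<beta>\<^sub>j)\<close> are left free up to the choice of a symmetric
  presentation of the constraints. A single equation determines its symmetric matrix and right-hand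
  side only up to a common nonzero factor; for an off-diagonal entry of the matrix identity this
  leaves room both for the unscaled presentation, which has entries \<open>1/2\<close>, and for the doubled,
  integral one.\<close>

definition encodes_aux ::
  "('m::finite \<Rightarrow> int^'n::finite^'n) \<Rightarrow> int^'n^'n \<Rightarrow> int^'m \<Rightarrow>
    (('n, 'm) aux_con \<Rightarrow> real^('n, 'm) blk^('n, 'm) blk) \<Rightarrow> (('n, 'm) aux_con \<Rightarrow> real) \<Rightarrow> bool" where
  "encodes_aux A C b \<A> \<beta> \<longleftrightarrow>
    (\<forall>j. transpose (\<A> j) = \<A> j \<and>
      (\<forall>M. transpose M = M \<longrightarrow> (inner_mat (\<A> j) M = \<beta> j \<longleftrightarrow> aux_equation A C b M j)))"

definition aux_objective :: "real^('n::finite, 'm::finite) blk^('n, 'm) blk" where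
  "aux_objective = (\<chi> p q. if p = Bw \<and> q = Bw then 1 else 0)"


section \<open>The KKT system of a standard form SDP\<close>

text \<open>A symmetric matrix of unknowns has one scalar variable per unordered pair of indices.\<close>

datatype ('k, 'c) kkt_var = Var_X "'k uprod" | Var_S "'k uprod" | Var_y 'c

datatype ('k, 'c) kkt_eq = Primal_eq 'c | Dual_eq "'k uprod" | Compl_eq 'k 'k

lemma UNIV_kkt_var: "(UNIV :: ('k, 'c) kkt_var set) =
    Var_X ` UNIV \<union> (Var_S ` UNIV \<union> Var_y ` UNIV)"
proof -
  have "x \<in> Var_X ` UNIV \<union> (Var_S ` UNIV \<union> Var_y ` UNIV)" for x :: "('k, 'c) kkt_var"
    by (cases x) auto
  then show ?thesis by auto
qed

instance kkt_var :: (finite, finite) finite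
  by standard (simp add: UNIV_kkt_var)

lemma UNIV_kkt_eq: "(UNIV :: ('k, 'c) kkt_eq set) =
    Primal_eq ` UNIV \<union> (Dual_eq ` UNIV \<union> case_prod Compl_eq ` UNIV)"
proof -
  have "x \<in> Primal_eq ` UNIV \<union> (Dual_eq ` UNIV \<union> case_prod Compl_eq ` UNIV)"
    for x :: "('k, 'c) kkt_eq"
    by (cases x) (auto simp: image_iff)
  then show ?thesis by auto
qed

instance kkt_eq :: (finite, finite) finite
  by standard (simp add: UNIV_kkt_eq)

text \<open>The entry of a symmetric matrix at an unordered pair; the arbitrary choice of an orientation
  is irrelevant for symmetric matrices, and the definition is only used for those.\<close>

definition sym_entry :: "'a^'k^'k \<Rightarrow> 'k uprod \<Rightarrow> 'a" where
  "sym_entry M u = (case (SOME (p, q). u = Upair p q) of (p, q) \<Rightarrow> M $ p $ q)"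

lemma sym_entry_Upair: "sym_entry M (Upair p q) = M $ p $ q" if "transpose M = M"
proof -
  have symM: "M $ r $ s = M $ s $ r" for r s by (metis that transpose_def vec_lambda_beta)
  show ?thesis unfolding sym_entry_def 
    by (rule someI2[of _ "(p,q)"]) (auto simp: symM)
qed

definition poly_X :: "(('k, 'c) kkt_var cpoly)^'k^'k" where
  "poly_X = (\<chi> p q. var_poly (Var_X (Upair p q)))"

definition poly_S :: "(('k, 'c) kkt_var cpoly)^'k^'k" where
  "poly_S = (\<chi> p q. var_poly (Var_S (Upair p q)))"

definition real_poly :: "real \<Rightarrow> 'v cpoly" where
  "real_poly a = const_poly (complex_of_real a)"

fun kkt_poly ::
  "('c::finite \<Rightarrow> real^'k::finite^'k) \<Rightarrow> ('c \<Rightarrow> real) \<Rightarrow> real^'k^'k \<Rightarrow>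
    ('k, 'c) kkt_eq \<Rightarrow> ('k, 'c) kkt_var cpoly" where
  "kkt_poly \<A> \<beta> \<C> (Primal_eq j) = inner_mat (map_matrix real_poly (\<A> j)) poly_X - real_poly (\<beta> j)"
| "kkt_poly \<A> \<beta> \<C> (Dual_eq u) =
    sym_entry poly_S u - real_poly (sym_entry \<C> u)
      + (\<Sum>j\<in>UNIV. var_poly (Var_y j) * real_poly (sym_entry (\<A> j) u))"
| "kkt_poly \<A> \<beta> \<C> (Compl_eq p q) = (poly_X ** poly_S) $ p $ q"

definition X_of :: "complex^('k::finite, 'c::finite) kkt_var \<Rightarrow> complex^'k^'k" where
  "X_of \<gamma> = (\<chi> p q. \<gamma> $ Var_X (Upair p q))"


section \<open>The quantities in the bound\<close>

definition nbar :: "nat \<Rightarrow> nat \<Rightarrow> nat" where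
  "nbar n m = 2 * n + 2 * m + 2"

definition mbar :: "nat \<Rightarrow> nat \<Rightarrow> nat" where
  "mbar n m = m + n * (n + 1) div 2 + 1"

definition Nbar :: "nat \<Rightarrow> nat \<Rightarrow> nat" where
  "Nbar n m = nbar n m * (nbar n m + 1) + mbar n m"

definition pbar :: "nat \<Rightarrow> nat \<Rightarrow> nat" where
  "pbar n m = mbar n m + nbar n m * (nbar n m + 1) div 2 + (nbar n m)\<^sup>2"

definition tau1 :: "nat \<Rightarrow> nat \<Rightarrow> real \<Rightarrow> real" where
  "tau1 n m \<tau>0 = \<tau>0 + real (Nbar n m) + log 2 (real (pbar n m))"

definition eta1 :: "nat \<Rightarrow> nat \<Rightarrow> real \<Rightarrow> real" where
  "eta1 n m \<tau>0 = (let N = Nbar n m in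
    ((real N)\<^sup>2 - real N) / 2 + 2 ^ N
      + real N * (tau1 n m \<tau>0 + real N + 2) * 2 ^ (N - 1))"

lemma card_blk: "CARD(('n::finite, 'm::finite) blk) = nbar CARD('n) CARD('m)"
proof -
  have "card {Bw, Br :: ('n, 'm) blk} = 2" by simp
  then show ?thesis
    unfolding UNIV_blk nbar_def
    by (subst card_Un_disjoint; (force simp: card_image inj_on_def)?)+
qed

lemma card_aux_con: "CARD(('n::finite, 'm::finite) aux_con) = mbar CARD('n) CARD('m)"
  unfolding UNIV_aux_con mbar_def
  by (subst card_Un_disjoint; (force simp: card_image inj_on_def card_UNIV_uprod mult.commute)?)+

lemma card_kkt_var:
  "CARD((('n::finite, 'm::finite) blk, ('n, 'm) aux_con) kkt_var) = Nbar CARD('n) CARD('m)"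
proof -
  have "2 * CARD(('n, 'm) blk uprod) = nbar CARD('n) CARD('m) * (nbar CARD('n) CARD('m) + 1)"
    by (simp add: card_UNIV_uprod card_blk mult.commute)
  then show ?thesis
    unfolding UNIV_kkt_var Nbar_def
    by (subst card_Un_disjoint; (force simp: card_image inj_on_def card_aux_con)?)+
qed

lemma card_kkt_eq:
  "CARD((('n::finite, 'm::finite) blk, ('n, 'm) aux_con) kkt_eq) = pbar CARD('n) CARD('m)"
proof -
  have "card (range (case_prod Compl_eq :: _ \<Rightarrow> (('n, 'm) blk, ('n, 'm) aux_con) kkt_eq))
      = (nbar CARD('n) CARD('m))\<^sup>2"
    by (subst card_image) (auto simp: inj_on_def card_blk power2_eq_square)
  moreover have "CARD(('n, 'm) blk uprod)
      = nbar CARD('n) CARD('m) * (nbar CARD('n) CARD('m) + 1) div 2"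
    by (simp add: card_UNIV_uprod card_blk mult.commute)
  ultimately show ?thesis
    unfolding UNIV_kkt_eq pbar_def
    by (subst card_Un_disjoint; (force simp: card_image inj_on_def card_aux_con)?)+
qed

text \<open>Nonzero integers have nonnegative logarithm, so inserting \<open>0\<close> only matters for data that
  vanish identically.\<close>

definition data_bitsize :: "('m::finite \<Rightarrow> int^'n::finite^'n) \<Rightarrow> int^'n^'n \<Rightarrow> int^'m \<Rightarrow> real" where
  "data_bitsize A C b =
    1 + Max (insert 0 ((\<lambda>a. log 2 \<bar>real_of_int a\<bar>) `
      ((range (\<lambda>(i, p, q). A i $ p $ q) \<union> range (\<lambda>(p, q). C $ p $ q) \<union> range (\<lambda>i. b $ i)) - {0})))"

text \<open>\<open>soft_O F g\<close> is the class of functions that are, along \<open>F\<close>, of order \<open>g\<close> up to a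
  polylogarithmic factor.\<close>

definition soft_O :: "'a filter \<Rightarrow> ('a \<Rightarrow> real) \<Rightarrow> ('a \<Rightarrow> real) set" where
  "soft_O F g = (\<Union>k. O[F](\<lambda>x. g x * ln (g x) ^ k))"

text \<open>\<open>n + m \<rightarrow> \<infinity>\<close>, uniformly in the bitsize \<open>\<tau>\<^sub>0 \<ge> 1\<close>.\<close>

definition size_filter :: "(nat \<times> nat \<times> real) filter" where
  "size_filter = inf (filtercomap (\<lambda>(n, m, \<tau>0). n + m) at_top)
    (principal {(n, m, \<tau>0). 1 \<le> n \<and> 1 \<le> m \<and> 1 \<le> \<tau>0})"


section \<open>Squared-up systems\<close>

text \<open>A square system consists of one polynomial per variable. The bitsize bound \<open>\<tau>\<close> concerns the
  coefficients of the polynomials of the square system, which are required to be integers. Isolated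
  points are those of the complex zero set.\<close>

definition squared_up :: "('e::finite \<Rightarrow> 'v::finite cpoly) \<Rightarrow> real \<Rightarrow> ('v \<Rightarrow> 'v cpoly) \<Rightarrow> bool" where
  "squared_up g \<tau> F \<longleftrightarrow>
    (\<exists>c :: 'v \<Rightarrow> 'e \<Rightarrow> int. \<forall>v. F v = (\<Sum>e\<in>UNIV. of_int (c v e) * g e)) \<and>
    (\<forall>v t. Poly_Mapping.lookup (F v) t \<in> \<int> \<and>
      (Poly_Mapping.lookup (F v) t \<noteq> 0 \<longrightarrow> log 2 (cmod (Poly_Mapping.lookup (F v) t)) \<le> \<tau>)) \<and>
    (\<forall>W. irreducible_component W (zeros (range F)) \<longrightarrow>
      irreducible_component W (zeros (range g)) \<or>
      (\<exists>x. W = {x} \<and> x isolated_in zeros (range F)))"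

end

(* The equations of the KKT system are bilinear in the two groups of unknowns X and (S, y), hence so
   are those of the square system. Fix an unknown, say in the first group, as a constant t. Then
   the N = a + b equations of bidegree (1,1) in a - 1 and b unknowns have a determinantal resultant of
   Sylvester type: the matrix of multiplication by the equations, from forms of bidegree (b,0) to
   forms of bidegree (b+1,1), is square of size N binom(N-1,b) <= N 2^(N-1), and every solution with
   this value t gives a kernel vector. Its determinant may vanish identically in t; after the perturbation
   by eps G_e, G_e = sum_(j+r=e) x_j u_r, it is a nonzero polynomial in eps and t, and its lowest
   nonzero coefficient with respect to eps is a nonzero integer polynomial in t with small coefficients.

   An isolated zero of the square system is a limit of zeros of the perturbed systems, so its
   coordinate is a root of that integer polynomial and Cauchy's bound applies. For this persistence of
   isolated zeros one adds s (x_v^3 - gamma_v^3): the quotient algebra becomes free of rank 3^N with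
   structure constants polynomial in the perturbation, which makes zeros vary continuously. *)

theory Submission
  imports Defs "Jordan_Normal_Form.Char_Poly"
begin

text \<open>Fixing an unknown gives a determinant in one variable, but zeros of positive dimension
  or at infinity can make it vanish identically, and then it carries no information about an
  isolated zero. The perturbation must therefore have a provably nonzero determinant, and it must
  move the isolated zero continuously. Nonvanishing reflects that the equations \<open>G_e\<close>
  have only trivial common zeros. Continuity is the harder half: the bilinear system alone gives no
  control of the quotient algebra, and zeros may run to infinity. Cubes are the lowest powers that
  dominate quadratic equations; with them all zeros stay bounded, and the algebra has the same
  monomial basis for every system. No multiplicities are needed: the argument works with linear
  functionals on that algebra, for which multiplication by a variable is a shift of indices and the
  joint eigenvectors of all shifts are the evaluations at zeros, up to scaling. An isolated zero of
  the KKT system is not known a priori to be isolated in the square system, so its bound takes a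
  further limit along zeros on isolated components.\<close>

hide_const (open) Ring_Hom_Poly.eval_poly
no_notation vec_nth (infixl "$" 90)

section \<open>A Sylvester resultant for bilinear systems\<close>

text \<open>This is injectivity, from the left, of the resultant matrix of the forms
  \<open>G_e\<close> alone: \<open>c e \<mu>\<close> is the weight of the row
  \<open>x^\<mu> * G_e\<close>, and each hypothesis is one column \<open>x^\<nu> u_r\<close>. The
  largest index splits the multisets: those without it are handled by the induction on
  \<open>a\<close>, those with it by the induction on \<open>b\<close>, and only the top value of
  \<open>e\<close> remains.\<close>

lemma toeplitz_kernel_trivial:
  fixes c :: "nat \<Rightarrow> nat multiset \<Rightarrow> 'a::comm_monoid_add"
  assumes "\<And>r \<nu>. r \<le> b \<Longrightarrow> \<nu> \<in> multisets_of_size {..<a} (Suc b) \<Longrightarrow>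
      (\<Sum>j\<in>set_mset \<nu>. c (r + j) (\<nu> - {#j#})) = 0"
    and "e < a + b" and "\<mu> \<in> multisets_of_size {..<a} b"
  shows "c e \<mu> = 0"
  using assms
proof (induction b arbitrary: a c e \<mu>)
  case 0
  then have "{#e#} \<in> multisets_of_size {..<a} (Suc 0)"
    by (auto simp: multisets_of_size_def)
  from "0.prems"(1)[of 0, OF _ this] 0 show ?case
    by (auto simp: multisets_of_size_def)
next
  case (Suc b)
  note IHb = Suc.IH
  from Suc.prems show ?case
  proof (induction a arbitrary: e \<mu>)
    case 0
    then show ?case by (auto simp: multisets_of_size_def)
  next
    case (Suc a)
    note rec = Suc.prems(1)
    have small: "c e \<mu> = 0" if "e < a + Suc b" "\<mu> \<in> multisets_of_size {..<a} (Suc b)" for e \<mu>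
    proof (rule Suc.IH[OF _ that])
      fix r \<nu> assume "r \<le> Suc b" "\<nu> \<in> multisets_of_size {..<a} (Suc (Suc b))"
      then show "(\<Sum>j\<in>set_mset \<nu>. c (r + j) (\<nu> - {#j#})) = 0"
        by (intro rec) (auto simp: multisets_of_size_def)
    qed
    \<comment> \<open>Removing one \<open>a\<close> from every multiset leaves the same recurrence
      for \<open>b\<close>; the extra summand \<open>j = a\<close> that appears when
      \<open>a\<close> is not in \<nu> is one of the terms killed by \<open>small\<close>.\<close>
    have div: "c e (add_mset a \<mu>) = 0"
      if "e < Suc a + b" "\<mu> \<in> multisets_of_size {..<Suc a} b" for e \<mu>
    proof (rule IHb[where c = "\<lambda>e \<mu>. c e (add_mset a \<mu>)", OF _ that])
      fix r \<nu> assume r: "r \<le> b" and \<nu>: "\<nu> \<in> multisets_of_size {..<Suc a} (Suc b)"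
      have "0 = (\<Sum>j\<in>set_mset (add_mset a \<nu>). c (r + j) (add_mset a \<nu> - {#j#}))"
        using r \<nu> by (subst rec) (auto simp: multisets_of_size_def)
      also have "\<dots> = (\<Sum>j\<in>set_mset \<nu>. c (r + j) (add_mset a \<nu> - {#j#}))"
      proof (rule sum.mono_neutral_right)
        show "\<forall>j\<in>set_mset (add_mset a \<nu>) - set_mset \<nu>. c (r + j) (add_mset a \<nu> - {#j#}) = 0"
        proof
          fix j assume "j \<in> set_mset (add_mset a \<nu>) - set_mset \<nu>"
          then have "j = a" "a \<notin># \<nu>" by auto
          moreover from \<open>a \<notin># \<nu>\<close> \<nu> have "\<nu> \<in> multisets_of_size {..<a} (Suc b)"
            by (auto simp: multisets_of_size_def less_Suc_eq subset_iff)
          ultimately show "c (r + j) (add_mset a \<nu> - {#j#}) = 0"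
            using small r by simp
        qed
      qed auto
      also have "\<dots> = (\<Sum>j\<in>set_mset \<nu>. c (r + j) (add_mset a (\<nu> - {#j#})))"
        by (intro sum.cong) auto
      finally show "(\<Sum>j\<in>set_mset \<nu>. c (r + j) (add_mset a (\<nu> - {#j#}))) = 0" by simp
    qed
    have low: "c e \<mu> = 0" if e: "e < a + Suc b" and \<mu>: "\<mu> \<in> multisets_of_size {..<Suc a} (Suc b)"
      for e \<mu>
    proof (cases "a \<in># \<mu>")
      case True
      then obtain \<mu>' where "\<mu> = add_mset a \<mu>'" by (meson mset_add)
      with div[of e \<mu>'] e \<mu> show ?thesis by (auto simp: multisets_of_size_def)
    next
      case False
      with \<mu> have "\<mu> \<in> multisets_of_size {..<a} (Suc b)"
        by (auto simp: multisets_of_size_def less_Suc_eq subset_iff)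
      with small e show ?thesis by blast
    qed
    show ?case
    proof (cases "e < a + Suc b")
      case True
      with low Suc.prems show ?thesis by blast
    next
      case False
      with Suc.prems have e: "e = Suc b + a" by simp
      \<comment> \<open>In the column \<open>r = Suc b\<close>,
        \<open>\<nu> = add_mset a \<mu>\<close>, the summands with \<open>j < a\<close> have index
        below \<open>a + Suc b\<close> and vanish by \<open>low\<close>; so the single summand
        \<open>j = a\<close> is zero too.\<close>
      have "0 = (\<Sum>j\<in>set_mset (add_mset a \<mu>). c (Suc b + j) (add_mset a \<mu> - {#j#}))"
        using Suc.prems by (subst rec) (auto simp: multisets_of_size_def)
      also have "\<dots> = (\<Sum>j\<in>{a}. c (Suc b + j) (add_mset a \<mu> - {#j#}))"
      proof (rule sum.mono_neutral_right)
        show "\<forall>j\<in>set_mset (add_mset a \<mu>) - {a}. c (Suc b + j) (add_mset a \<mu> - {#j#}) = 0"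
        proof
          fix j assume j: "j \<in> set_mset (add_mset a \<mu>) - {a}"
          with Suc.prems(3) have "j \<in># \<mu>" "j < a" by (auto simp: multisets_of_size_def subset_iff less_Suc_eq)
          moreover from this Suc.prems(3)
          have "add_mset a (\<mu> - {#j#}) \<in> multisets_of_size {..<Suc a} (Suc b)"
            by (auto simp: multisets_of_size_def size_Diff_singleton dest: in_diffD)
          ultimately show "c (Suc b + j) (add_mset a \<mu> - {#j#}) = 0"
            using low[of "Suc b + j" "add_mset a (\<mu> - {#j#})"] by simp
        qed
      qed auto
      finally show ?thesis using e by simp
    qed
  qed
qed

section \<open>Coefficient seminorms and a determinant bound\<close>

definition poly_norm :: "('a::zero \<Rightarrow> real) \<Rightarrow> 'a poly \<Rightarrow> real" where
  "poly_norm N p = (\<Sum>i\<le>degree p. N (coeff p i))"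

text \<open>Abstracting the axioms lets \<open>poly_norm\<close> be iterated: from the absolute
  value on \<open>int\<close> to \<open>int poly\<close> and on to \<open>int poly poly\<close>,
  where the determinant lives. Summing coefficients, rather than taking their maximum, is what makes
  it submultiplicative.\<close>

locale ring_seminorm =
  fixes N :: "'a::comm_ring_1 \<Rightarrow> real"
  assumes zero [simp]: "N 0 = 0" and one: "N 1 \<le> 1"
    and add: "N (x + y) \<le> N x + N y" and mult: "N (x * y) \<le> N x * N y"
    and minus [simp]: "N (- x) = N x"
begin

lemma nonneg: "0 \<le> N x"
  using add[of x "- x"] by simp

lemma sum_le: "N (sum f A) \<le> (\<Sum>x\<in>A. N (f x))"
proof (induction A rule: infinite_finite_induct)
  case (insert x A)
  then show ?case using add[of "f x" "sum f A"] by simp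
qed auto

lemma prod_le: "N (prod f A) \<le> (\<Prod>x\<in>A. N (f x))"
proof (induction A rule: infinite_finite_induct)
  case (insert x A)
  then show ?case 
    using mult[of "f x" "prod f A"] mult_left_mono[OF insert.IH nonneg[of "f x"]] by simp
qed (use one in auto)

lemma poly_norm_eq: "degree p \<le> n \<Longrightarrow> poly_norm N p = (\<Sum>i\<le>n. N (coeff p i))"
  unfolding poly_norm_def by (intro sum.mono_neutral_left) (auto simp: coeff_eq_0)

lemma coeff_le_poly_norm: "N (coeff p i) \<le> poly_norm N p"
proof -
  have "N (coeff p i) \<le> (\<Sum>i\<le>max i (degree p). N (coeff p i))"
    by (rule member_le_sum) (auto simp: nonneg)
  then show ?thesis by (simp add: poly_norm_eq[of p "max i (degree p)"])
qed

lemma poly_norm_const [simp]: "poly_norm N [:c:] = N c"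
  by (simp add: poly_norm_def)

lemma poly_norm_X: "poly_norm N [:0, 1:] \<le> 1"
  using one by (simp add: poly_norm_def)

lemma ring_seminorm_poly_norm: "ring_seminorm (poly_norm N)"
proof
  fix p q :: "'a poly"
  show "poly_norm N 0 = 0" by (simp add: poly_norm_def)
  show "poly_norm N 1 \<le> 1" using one by (simp add: poly_norm_def)
  show "poly_norm N (- p) = poly_norm N p" by (simp add: poly_norm_def)
  let ?n = "max (degree p) (degree q)"
  have "poly_norm N (p + q) = (\<Sum>i\<le>?n. N (coeff (p + q) i))"
    by (intro poly_norm_eq) (rule degree_add_le_max)
  also have "\<dots> \<le> (\<Sum>i\<le>?n. N (coeff p i) + N (coeff q i))"
    by (intro sum_mono) (simp add: add)
  also have "\<dots> = poly_norm N p + poly_norm N q"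
    by (simp add: sum.distrib poly_norm_eq[of p ?n] poly_norm_eq[of q ?n])
  finally show "poly_norm N (p + q) \<le> poly_norm N p + poly_norm N q" .
  let ?d = "degree p + degree q"
  have "poly_norm N (p * q) = (\<Sum>k\<le>?d. N (\<Sum>i\<le>k. coeff p i * coeff q (k - i)))"
    by (subst poly_norm_eq[OF degree_mult_le]) (simp add: coeff_mult)
  also have "\<dots> \<le> (\<Sum>k\<le>?d. \<Sum>i\<le>k. N (coeff p i) * N (coeff q (k - i)))"
    by (intro sum_mono order_trans[OF sum_le] mult)
  also have "\<dots> = (\<Sum>(k, i)\<in>(SIGMA k:{..?d}. {..k}). N (coeff p i) * N (coeff q (k - i)))"
    by (subst sum.Sigma) auto
  also have "\<dots> = (\<Sum>(i, j)\<in>{(i, j). i + j \<le> ?d}. N (coeff p i) * N (coeff q j))"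
    by (rule sum.reindex_bij_witness[of _ "\<lambda>(i, j). (i + j, i)" "\<lambda>(k, i). (i, k - i)"]) auto
  also have "\<dots> = (\<Sum>(i, j)\<in>{..degree p} \<times> {..degree q}. N (coeff p i) * N (coeff q j))"
  proof (rule sum.mono_neutral_right)
    have "{(i, j). i + j \<le> ?d} \<subseteq> {..?d} \<times> {..?d}" by auto
    then show "finite {(i, j). i + j \<le> ?d}" by (rule finite_subset) auto
  next
    show "\<forall>x\<in>{(i, j). i + j \<le> ?d} - {..degree p} \<times> {..degree q}.
        (case x of (i, j) \<Rightarrow> N (coeff p i) * N (coeff q j)) = 0"
    proof
      fix x assume "x \<in> {(i, j). i + j \<le> ?d} - {..degree p} \<times> {..degree q}"
      then obtain i j where "x = (i, j)" "degree p < i \<or> degree q < j" by (cases x) auto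
      then show "(case x of (i, j) \<Rightarrow> N (coeff p i) * N (coeff q j)) = 0"
        by (auto simp: coeff_eq_0)
    qed
  qed auto
  also have "\<dots> = poly_norm N p * poly_norm N q"
    by (simp add: poly_norm_def sum_product sum.cartesian_product)
  finally show "poly_norm N (p * q) \<le> poly_norm N p * poly_norm N q" .
qed

text \<open>Expanding the product of the row sums gives one product per self-map of
  \<open>{..<n}\<close>; the Leibniz formula uses only the permutations among them, and signs do not
  change \<open>N\<close>.\<close>

lemma det_le:
  assumes "A \<in> carrier_mat n n"
  shows "N (Determinant.det A) \<le> (\<Prod>i<n. \<Sum>j<n. N (A $$ (i, j)))"
proof -
  let ?P = "{p. p permutes {0..<n}}"
  have "N (Determinant.det A) \<le> (\<Sum>p\<in>?P. \<Prod>i<n. N (A $$ (i, p i)))"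
    unfolding det_def'[OF assms]
  proof (intro order_trans[OF sum_le] sum_mono)
    fix p :: "nat \<Rightarrow> nat"
    have "N (of_int (sign p) * x) = N x" for x
      by (cases p rule: sign_cases) auto
    then show "N (of_int (sign p) * (\<Prod>i = 0..<n. A $$ (i, p i))) \<le> (\<Prod>i<n. N (A $$ (i, p i)))"
      using prod_le[of "\<lambda>i. A $$ (i, p i)" "{0..<n}"] by (simp add: atLeast0LessThan)
  qed
  \<comment> \<open>Permutations are the identity outside \<open>{0..<n}\<close>; restriction moves
    them into the extensional function space over which \<open>prod_sum_PiE\<close> expands.\<close>
  also have "\<dots> = (\<Sum>f\<in>(\<lambda>p. restrict p {..<n}) ` ?P. \<Prod>i<n. N (A $$ (i, f i)))"
  proof (subst sum.reindex)
    show "inj_on (\<lambda>p. restrict p {..<n}) ?P"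
    proof (rule inj_onI, rule ext)
      fix p q x assume "p \<in> ?P" "q \<in> ?P" "restrict p {..<n} = restrict q {..<n}"
      then show "p x = q x"
        by (cases "x < n") (auto simp: permutes_def fun_eq_iff restrict_def split: if_splits)
    qed
  qed auto
  also have "\<dots> \<le> (\<Sum>f\<in>{..<n} \<rightarrow>\<^sub>E {..<n}. \<Prod>i<n. N (A $$ (i, f i)))"
  proof (rule sum_mono2)
    show "(\<lambda>p. restrict p {..<n}) ` ?P \<subseteq> {..<n} \<rightarrow>\<^sub>E {..<n}"
    proof (intro image_subsetI)
      fix p assume "p \<in> ?P"
      then have "p i < n" if "i < n" for i
        using that permutes_in_image[of p "{0..<n}" i] by simp
      then show "restrict p {..<n} \<in> {..<n} \<rightarrow>\<^sub>E {..<n}" by simp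
    qed
  qed (auto intro!: prod_nonneg nonneg finite_PiE)
  also have "\<dots> = (\<Prod>i<n. \<Sum>j<n. N (A $$ (i, j)))"
    by (rule prod_sum_PiE[symmetric]) auto
  finally show ?thesis .
qed

end


section \<open>The resultant matrix of a bilinear system\<close>

definition sylvester_rows :: "nat \<Rightarrow> nat \<Rightarrow> (nat \<times> nat multiset) set" where
  "sylvester_rows a b = {..<a + b} \<times> multisets_of_size {..<a} b"

definition sylvester_cols :: "nat \<Rightarrow> nat \<Rightarrow> (nat multiset \<times> nat) set" where
  "sylvester_cols a b = multisets_of_size {..<a} (Suc b) \<times> {..b}"

definition sylvester_size :: "nat \<Rightarrow> nat \<Rightarrow> nat" where
  "sylvester_size a b = (a + b) * ((a + b - 1) choose b)"

text \<open>Row \<open>(e, \<mu>)\<close> stands for \<open>x^\<mu> * F_e\<close>, where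
  \<open>F_e\<close> has the coefficient \<open>d e j r\<close> at \<open>x_j u_r\<close>; column
  \<open>(\<nu>, r)\<close> stands for the monomial \<open>x^\<nu> u_r\<close>. At most one
  \<open>j\<close> contributes, and the sum avoids naming it.\<close>

definition sylvester_entry ::
  "nat \<Rightarrow> (nat \<Rightarrow> nat \<Rightarrow> nat \<Rightarrow> 'a::comm_monoid_add) \<Rightarrow> nat \<times> nat multiset \<Rightarrow> nat multiset \<times> nat \<Rightarrow> 'a" where
  "sylvester_entry a d = (\<lambda>(e, \<mu>) (\<nu>, r). \<Sum>j<a. if add_mset j \<mu> = \<nu> then d e j r else 0)"

lemma finite_sylvester_rows [simp]: "finite (sylvester_rows a b)"
  and finite_sylvester_cols [simp]: "finite (sylvester_cols a b)"
  by (auto simp: sylvester_rows_def sylvester_cols_def)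

lemma card_sylvester_rows: "card (sylvester_rows a b) = sylvester_size a b"
  by (simp add: sylvester_rows_def sylvester_size_def card_multisets_of_size card_cartesian_product)

text \<open>That the matrix is square is the absorption identity for binomial coefficients.\<close>

lemma card_sylvester_cols: "card (sylvester_cols a b) = sylvester_size a b"
proof -
  have "card (sylvester_cols a b) = Suc b * ((a + b) choose Suc b)"
    by (simp add: sylvester_cols_def card_multisets_of_size card_cartesian_product)
  also have "\<dots> = sylvester_size a b"
    using Suc_times_binomial_eq[of "a + b - 1" b] by (cases "a + b") (auto simp: sylvester_size_def)
  finally show ?thesis .
qed

lemma sylvester_size_le: "sylvester_size a b \<le> (a + b) * 2 ^ (a + b - 1)"
  unfolding sylvester_size_def by (intro mult_left_mono binomial_le_pow2) auto

lemma sum_sylvester_entry_col: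
  fixes d :: "nat \<Rightarrow> nat \<Rightarrow> nat \<Rightarrow> 'a::comm_ring_1"
  assumes "(\<nu>, r) \<in> sylvester_cols a b"
  shows "(\<Sum>(e, \<mu>)\<in>sylvester_rows a b. w e \<mu> * sylvester_entry a d (e, \<mu>) (\<nu>, r))
    = (\<Sum>e<a + b. \<Sum>j\<in>set_mset \<nu>. w e (\<nu> - {#j#}) * d e j r)"
proof -
  have "(\<Sum>(e, \<mu>)\<in>sylvester_rows a b. w e \<mu> * sylvester_entry a d (e, \<mu>) (\<nu>, r))
      = (\<Sum>e<a + b. \<Sum>\<mu>\<in>multisets_of_size {..<a} b. \<Sum>j<a.
          if add_mset j \<mu> = \<nu> then w e \<mu> * d e j r else 0)"
    by (simp add: sylvester_rows_def sum.cartesian_product[symmetric] sylvester_entry_def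
        sum_distrib_left if_distrib[of "\<lambda>x. _ * x"] cong: if_cong)
  also have "\<dots> = (\<Sum>e<a + b. \<Sum>j<a. \<Sum>\<mu>\<in>multisets_of_size {..<a} b.
          if add_mset j \<mu> = \<nu> then w e \<mu> * d e j r else 0)"
    by (intro sum.cong refl sum.swap)
  also have "\<dots> = (\<Sum>e<a + b. \<Sum>j\<in>set_mset \<nu>. w e (\<nu> - {#j#}) * d e j r)"
  proof (rule sum.cong[OF refl], rule sum.mono_neutral_cong_right)
    show "set_mset \<nu> \<subseteq> {..<a}"
      using assms by (auto simp: sylvester_cols_def multisets_of_size_def)
  next
    fix e
    show "\<forall>j\<in>{..<a} - set_mset \<nu>.
        (\<Sum>\<mu>\<in>multisets_of_size {..<a} b. if add_mset j \<mu> = \<nu> then w e \<mu> * d e j r else 0) = 0"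
      by (intro ballI sum.neutral) auto
    fix j assume "j \<in># \<nu>"
    then obtain \<mu> where \<mu>: "\<nu> = add_mset j \<mu>" by (meson mset_add)
    with assms have "\<mu> \<in> multisets_of_size {..<a} b"
      by (auto simp: sylvester_cols_def multisets_of_size_def)
    with \<mu> show "(\<Sum>\<mu>\<in>multisets_of_size {..<a} b. if add_mset j \<mu> = \<nu> then w e \<mu> * d e j r else 0)
        = w e (\<nu> - {#j#}) * d e j r"
      by (simp add: sum.delta finite_multisets_of_size)
  qed simp
  finally show ?thesis .
qed

lemma sum_sylvester_entry_row:
  fixes d :: "nat \<Rightarrow> nat \<Rightarrow> nat \<Rightarrow> 'a::comm_ring_1"
  assumes "(e, \<mu>) \<in> sylvester_rows a b"
  shows "(\<Sum>(\<nu>, r)\<in>sylvester_cols a b. sylvester_entry a d (e, \<mu>) (\<nu>, r) * v \<nu> r)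
    = (\<Sum>j<a. \<Sum>r\<le>b. d e j r * v (add_mset j \<mu>) r)"
proof -
  have "(\<Sum>(\<nu>, r)\<in>sylvester_cols a b. sylvester_entry a d (e, \<mu>) (\<nu>, r) * v \<nu> r)
      = (\<Sum>\<nu>\<in>multisets_of_size {..<a} (Suc b). \<Sum>r\<le>b. \<Sum>j<a.
          if add_mset j \<mu> = \<nu> then d e j r * v \<nu> r else 0)"
    by (simp add: sylvester_cols_def sum.cartesian_product[symmetric] sylvester_entry_def
        sum_distrib_right if_distrib[of "\<lambda>x. x * _"] cong: if_cong)
  also have "\<dots> = (\<Sum>\<nu>\<in>multisets_of_size {..<a} (Suc b). \<Sum>j<a. \<Sum>r\<le>b.
          if add_mset j \<mu> = \<nu> then d e j r * v \<nu> r else 0)"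
    by (intro sum.cong refl sum.swap)
  also have "\<dots> = (\<Sum>j<a. \<Sum>\<nu>\<in>multisets_of_size {..<a} (Suc b). \<Sum>r\<le>b.
          if add_mset j \<mu> = \<nu> then d e j r * v \<nu> r else 0)"
    by (rule sum.swap)
  also have "\<dots> = (\<Sum>j<a. \<Sum>\<nu>\<in>multisets_of_size {..<a} (Suc b).
          if add_mset j \<mu> = \<nu> then (\<Sum>r\<le>b. d e j r * v \<nu> r) else 0)"
    by (intro sum.cong) auto
  also have "\<dots> = (\<Sum>j<a. \<Sum>r\<le>b. d e j r * v (add_mset j \<mu>) r)"
  proof (intro sum.cong refl)
    fix j assume "j \<in> {..<a}"
    with assms have "add_mset j \<mu> \<in> multisets_of_size {..<a} (Suc b)"
      by (auto simp: sylvester_rows_def multisets_of_size_def)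
    then show "(\<Sum>\<nu>\<in>multisets_of_size {..<a} (Suc b).
          if add_mset j \<mu> = \<nu> then (\<Sum>r\<le>b. d e j r * v \<nu> r) else 0)
        = (\<Sum>r\<le>b. d e j r * v (add_mset j \<mu>) r)"
      by (simp add: sum.delta finite_multisets_of_size)
  qed
  finally show ?thesis .
qed

text \<open>A row distributes the coefficients of its equation over the columns, so its sum does not
  depend on \<mu>. Formally, the row formula is applied to the matrix of norms and the all-one
  vector.\<close>

lemma (in ring_seminorm) sum_norm_sylvester_entry:
  assumes "(e, \<mu>) \<in> sylvester_rows a b"
  shows "(\<Sum>p\<in>sylvester_cols a b. N (sylvester_entry a d (e, \<mu>) p))
    \<le> (\<Sum>j<a. \<Sum>r\<le>b. N (d e j r))"
proof -
  have "(\<Sum>p\<in>sylvester_cols a b. N (sylvester_entry a d (e, \<mu>) p))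
    \<le> (\<Sum>(\<nu>, r)\<in>sylvester_cols a b. sylvester_entry a (\<lambda>e j r. N (d e j r)) (e, \<mu>) (\<nu>, r) * 1)"
    by (auto simp: sylvester_entry_def intro!: sum_mono order_trans[OF sum_le])
  also have "\<dots> = (\<Sum>j<a. \<Sum>r\<le>b. N (d e j r))"
    by (subst sum_sylvester_entry_row[OF assms]) simp
  finally show ?thesis .
qed

lemma ring_seminorm_abs_int: "ring_seminorm (\<lambda>x::int. \<bar>real_of_int x\<bar>)"
  by standard (auto simp: abs_mult)

text \<open>The outer variable is the perturbation parameter \<epsilon>, the inner one the value t
  of the fixed unknown; \<open>coeff R i\<close> is thus the integer polynomial in t that multiplies
  \<open>\<epsilon>^i\<close>.\<close>

definition eval_bipoly :: "int poly poly \<Rightarrow> complex \<Rightarrow> complex \<Rightarrow> complex" where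
  "eval_bipoly R \<epsilon> t = poly (map_poly (\<lambda>p. poly (map_poly of_int p) t) R) \<epsilon>"

lemma comm_ring_hom_eval_int_poly: "comm_ring_hom (\<lambda>p. poly (map_poly of_int p) (t::complex))"
proof -
  interpret h: map_poly_comm_ring_hom "of_int :: int \<Rightarrow> complex" ..
  show ?thesis by standard (auto simp: hom_distribs)
qed

lemma comm_ring_hom_eval_bipoly: "comm_ring_hom (\<lambda>R. eval_bipoly R \<epsilon> t)"
proof -
  interpret g: comm_ring_hom "\<lambda>p. poly (map_poly of_int p) t"
    by (rule comm_ring_hom_eval_int_poly)
  interpret h: map_poly_comm_ring_hom "\<lambda>p. poly (map_poly of_int p) t" ..
  show ?thesis by standard (auto simp: eval_bipoly_def hom_distribs)
qed

lemma eval_bipoly_const: "eval_bipoly [:c:] \<epsilon> t = poly (map_poly of_int c) t"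
  and eval_bipoly_X: "eval_bipoly [:0, 1:] \<epsilon> t = \<epsilon>"
proof -
  interpret g: comm_ring_hom "\<lambda>p. poly (map_poly of_int p) t"
    by (rule comm_ring_hom_eval_int_poly)
  show "eval_bipoly [:c:] \<epsilon> t = poly (map_poly of_int c) t" "eval_bipoly [:0, 1:] \<epsilon> t = \<epsilon>"
    by (simp_all add: eval_bipoly_def g.map_poly_pCons_hom)
qed

text \<open>The equations \<open>G\<^sub>e = (\<Sum>j + r = e. x\<^sub>j u\<^sub>r)\<close> express the vanishing of the product of the two
  univariate polynomials with coefficients \<open>x\<close> and \<open>u\<close>; this makes the Sylvester matrix of the
  perturbation nonsingular.\<close>

definition perturbed :: "(nat \<Rightarrow> nat \<Rightarrow> nat \<Rightarrow> 'a::idom) \<Rightarrow> nat \<Rightarrow> nat \<Rightarrow> nat \<Rightarrow> 'a poly" where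
  "perturbed C e j r = [:C e j r:] + (if j + r = e then [:0, 1:] else 0)"

text \<open>At degree \<open>Suc D\<close> the constant \<open>C e j r\<close> can no longer
  contribute, so only the shift by \<epsilon> is seen.\<close>

lemma coeff_mult_perturbed:
  assumes "degree p \<le> D"
  shows "coeff (p * perturbed C e j r) (Suc D) = (if j + r = e then coeff p D else 0)"
proof -
  have "coeff p (Suc D) = 0" using assms by (intro coeff_eq_0) simp
  moreover have "p * perturbed C e j r = Polynomial.smult (C e j r) p + (if j + r = e then pCons 0 p else 0)"
    by (simp add: perturbed_def distrib_left)
  ultimately show ?thesis by simp
qed

definition sylvester_mat ::
  "nat \<Rightarrow> nat \<Rightarrow> (nat \<Rightarrow> nat \<times> nat multiset) \<Rightarrow> (nat \<Rightarrow> nat multiset \<times> nat) \<Rightarrow>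
    (nat \<Rightarrow> nat \<Rightarrow> nat \<Rightarrow> 'a::comm_monoid_add) \<Rightarrow> 'a mat" where
  "sylvester_mat a b f g d = mat (sylvester_size a b) (sylvester_size a b)
    (\<lambda>(i, k). sylvester_entry a d (f i) (g k))"

text \<open>Let a left kernel vector have entries of degree at most \<open>D\<close> in \<epsilon>.
  The coefficients of \<open>\<epsilon>^D\<close> then form a left kernel vector for the pure
  perturbation, which is zero by \<open>toeplitz_kernel_trivial\<close>; with \<open>D\<close>
  maximal this is a contradiction.\<close>

lemma det_perturbed_sylvester_nonzero:
  fixes C :: "nat \<Rightarrow> nat \<Rightarrow> nat \<Rightarrow> 'a::idom"
  assumes f: "bij_betw f {0..<sylvester_size a b} (sylvester_rows a b)"
    and g: "bij_betw g {0..<sylvester_size a b} (sylvester_cols a b)"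
  shows "Determinant.det (sylvester_mat a b f g (perturbed C)) \<noteq> 0"
proof
  define S where "S = sylvester_size a b"
  define M where "M = sylvester_mat a b f g (perturbed C)"
  have M: "M \<in> carrier_mat S S" by (simp add: M_def S_def sylvester_mat_def)
  assume "Determinant.det (sylvester_mat a b f g (perturbed C)) = 0"
  then have "Determinant.det (transpose_mat M) = 0"
    using det_transpose[OF M] by (simp add: M_def)
  moreover have MT: "transpose_mat M \<in> carrier_mat S S" using M by simp
  ultimately obtain v where v: "v \<in> carrier_vec S" "v \<noteq> 0\<^sub>v S"
      "transpose_mat M *\<^sub>v v = 0\<^sub>v S"
    using det_0_iff_vec_prod_zero[OF MT] by blast
  define w where "w e \<mu> = v $ (inv_into {0..<S} f (e, \<mu>))" for e \<mu>
  have wf: "(case f i of (e, \<mu>) \<Rightarrow> w e \<mu>) = v $ i" if "i < S" for i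
  proof -
    have "inv_into {0..<S} f (f i) = i"
      using f that by (intro inv_into_f_f) (auto simp: S_def bij_betw_def)
    then show ?thesis by (cases "f i") (simp add: w_def)
  qed
  have eq: "(\<Sum>e<a + b. \<Sum>j\<in>set_mset \<nu>. w e (\<nu> - {#j#}) * perturbed C e j r) = 0"
    if "(\<nu>, r) \<in> sylvester_cols a b" for \<nu> r
  proof -
    have "(\<nu>, r) \<in> g ` {0..<S}" using bij_betw_imp_surj_on[OF g] that by (simp add: S_def)
    then obtain k where k: "k < S" "g k = (\<nu>, r)" by auto
    have "0 = (transpose_mat M *\<^sub>v v) $ k" unfolding v(3) using k by simp
    also have "\<dots> = (\<Sum>i\<in>{0..<S}. M $$ (i, k) * v $ i)"
      using k v(1) M by (simp add: scalar_prod_def)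
    also have "\<dots> = (\<Sum>i\<in>{0..<S}. case f i of (e, \<mu>) \<Rightarrow> w e \<mu> * sylvester_entry a (perturbed C) (e, \<mu>) (\<nu>, r))"
    proof (intro sum.cong refl)
      fix i assume "i \<in> {0..<S}"
      with wf[of i] k show "M $$ (i, k) * v $ i
          = (case f i of (e, \<mu>) \<Rightarrow> w e \<mu> * sylvester_entry a (perturbed C) (e, \<mu>) (\<nu>, r))"
        by (auto simp: M_def sylvester_mat_def S_def split: prod.split)
    qed
    also have "\<dots> = (\<Sum>(e, \<mu>)\<in>sylvester_rows a b. w e \<mu> * sylvester_entry a (perturbed C) (e, \<mu>) (\<nu>, r))"
      using f unfolding S_def by (rule sum.reindex_bij_betw)
    finally show ?thesis by (simp add: sum_sylvester_entry_col[OF that])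
  qed
  define D where "D = Max ((\<lambda>i. degree (v $ i)) ` {0..<S})"
  obtain i0 where i0: "i0 < S" "v $ i0 \<noteq> 0"
    using v by (metis carrier_vecD eq_vecI index_zero_vec)
  have degv: "degree (v $ i) \<le> D" if "i < S" for i
    unfolding D_def using that by (intro Max_ge) auto
  have degw: "degree (w e \<mu>) \<le> D" if "(e, \<mu>) \<in> sylvester_rows a b" for e \<mu>
  proof -
    have "inv_into {0..<S} f (e, \<mu>) \<in> {0..<S}"
      by (rule inv_into_into) (use bij_betw_imp_surj_on[OF f] that in \<open>simp add: S_def\<close>)
    then show ?thesis unfolding w_def by (intro degv) simp
  qed
  have wz: "coeff (w e \<mu>) D = 0" if e: "(e, \<mu>) \<in> sylvester_rows a b" for e \<mu>
  proof (rule toeplitz_kernel_trivial[where c = "\<lambda>e \<mu>. coeff (w e \<mu>) D" and a = a and b = b])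
    show "e < a + b" "\<mu> \<in> multisets_of_size {..<a} b" using e by (auto simp: sylvester_rows_def)
    fix r \<nu> assume r: "r \<le> b" and \<nu>: "\<nu> \<in> multisets_of_size {..<a} (Suc b)"
    have deg\<nu>: "degree (w e (\<nu> - {#j#})) \<le> D" if "e < a + b" "j \<in># \<nu>" for e j
      using \<nu> that by (intro degw)
        (auto simp: sylvester_rows_def multisets_of_size_def size_Diff_singleton dest: in_diffD)
    have "0 = coeff (\<Sum>e<a + b. \<Sum>j\<in>set_mset \<nu>. w e (\<nu> - {#j#}) * perturbed C e j r) (Suc D)"
      by (subst eq) (use r \<nu> in \<open>auto simp: sylvester_cols_def\<close>)
    also have "\<dots> = (\<Sum>e<a + b. \<Sum>j\<in>set_mset \<nu>. if j + r = e then coeff (w e (\<nu> - {#j#})) D else 0)"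
      unfolding coeff_sum
      by (intro sum.cong refl coeff_mult_perturbed deg\<nu>) auto
    also have "\<dots> = (\<Sum>j\<in>set_mset \<nu>. \<Sum>e<a + b. if j + r = e then coeff (w e (\<nu> - {#j#})) D else 0)"
      by (rule sum.swap)
    also have "\<dots> = (\<Sum>j\<in>set_mset \<nu>. coeff (w (r + j) (\<nu> - {#j#})) D)"
    proof (intro sum.cong refl)
      fix j assume "j \<in># \<nu>"
      with \<nu> r have "j + r < a + b" by (auto simp: multisets_of_size_def subset_iff add_less_le_mono)
      then show "(\<Sum>e<a + b. if j + r = e then coeff (w e (\<nu> - {#j#})) D else 0)
          = coeff (w (r + j) (\<nu> - {#j#})) D"
        by (simp add: add.commute)
    qed
    finally show "(\<Sum>j\<in>set_mset \<nu>. coeff (w (r + j) (\<nu> - {#j#})) D) = 0" by simp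
  qed
  have zero: "coeff (v $ i) D = 0" if "i < S" for i
  proof -
    obtain e \<mu> where "f i = (e, \<mu>)" by (cases "f i")
    moreover have "f i \<in> sylvester_rows a b" using bij_betw_apply[OF f] that by (simp add: S_def)
    ultimately show ?thesis using wf[OF that] wz[of e \<mu>] by simp
  qed
  have "D \<in> (\<lambda>i. degree (v $ i)) ` {0..<S}"
    unfolding D_def using i0 by (intro Max_in) auto
  then obtain i1 where i1: "i1 < S" "D = degree (v $ i1)" by auto
  \<comment> \<open>An entry of degree \<open>D\<close> whose coefficient at \<open>D\<close>
    vanishes is zero, so \<open>D = 0\<close>; then all entries are constants with vanishing
    constant term.\<close>
  with zero[of i1] have "v $ i1 = 0" by simp
  then have "D = 0" using i1 by simp
  with zero[OF i0(1)] degv[OF i0(1)] i0(2) show False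
    by (metis le_zero_eq leading_coeff_0_iff)
qed

text \<open>Since \<Lambda> bounds the coefficient sum of each row, \<open>det_le\<close> gives its
  power with the matrix size as exponent. Homogeneous variables that are not all zero suffice,
  because \<open>x_j^(b+1) u_r\<close> is then a nonzero entry of the kernel vector for suitable
  \<open>j\<close> and \<open>r\<close>.\<close>

lemma hidden_variable_resultant:
  fixes C :: "nat \<Rightarrow> nat \<Rightarrow> nat \<Rightarrow> int poly" and \<Lambda> :: real
  defines "nrm \<equiv> poly_norm (\<lambda>x::int. \<bar>real_of_int x\<bar>)"
  assumes bound: "\<And>e. e < a + b \<Longrightarrow>
      (\<Sum>j<a. \<Sum>r\<le>b. nrm (C e j r) + (if j + r = e then 1 else 0)) \<le> \<Lambda>"
  obtains R :: "int poly poly" where "R \<noteq> 0"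
    and "\<And>i k. \<bar>real_of_int (coeff (coeff R i) k)\<bar> \<le> \<Lambda> ^ sylvester_size a b"
    and "\<forall>\<epsilon> t x u. (\<exists>j<a. x j \<noteq> 0) \<longrightarrow> (\<exists>r\<le>b. u r \<noteq> 0) \<longrightarrow>
      (\<forall>e<a + b. (\<Sum>j<a. \<Sum>r\<le>b.
          (poly (map_poly of_int (C e j r)) t + (if j + r = e then \<epsilon> else 0)) * (x j * u r)) = 0) \<longrightarrow>
      eval_bipoly R \<epsilon> t = 0"
proof -
  define S where "S = sylvester_size a b"
  obtain f where f: "bij_betw f {0..<S} (sylvester_rows a b)"
    using ex_bij_betw_nat_finite[of "sylvester_rows a b"] by (auto simp: S_def card_sylvester_rows)
  obtain g where g: "bij_betw g {0..<S} (sylvester_cols a b)"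
    using ex_bij_betw_nat_finite[of "sylvester_cols a b"] by (auto simp: S_def card_sylvester_cols)
  define M where "M = sylvester_mat a b f g (perturbed C)"
  have M: "M \<in> carrier_mat S S" by (simp add: M_def S_def sylvester_mat_def)
  interpret N0: ring_seminorm "\<lambda>x::int. \<bar>real_of_int x\<bar>" by (rule ring_seminorm_abs_int)
  interpret N1: ring_seminorm nrm unfolding nrm_def by (rule N0.ring_seminorm_poly_norm)
  interpret N2: ring_seminorm "poly_norm nrm" by (rule N1.ring_seminorm_poly_norm)
  show ?thesis
  proof
    show "Determinant.det M \<noteq> 0"
      unfolding M_def using f g unfolding S_def by (rule det_perturbed_sylvester_nonzero)
  next
    fix i k
    have "\<bar>real_of_int (coeff (coeff (Determinant.det M) i) k)\<bar> \<le> nrm (coeff (Determinant.det M) i)"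
      unfolding nrm_def by (rule N0.coeff_le_poly_norm)
    also have "\<dots> \<le> poly_norm nrm (Determinant.det M)" by (rule N1.coeff_le_poly_norm)
    also have "\<dots> \<le> (\<Prod>i<S. \<Sum>k<S. poly_norm nrm (M $$ (i, k)))" by (rule N2.det_le[OF M])
    also have "\<dots> \<le> (\<Prod>i<S. \<Lambda>)"
    proof (intro prod_mono conjI sum_nonneg N2.nonneg)
      fix i assume i: "i \<in> {..<S}"
      obtain e \<mu> where fi: "f i = (e, \<mu>)" by (cases "f i")
      have row: "(e, \<mu>) \<in> sylvester_rows a b" using bij_betw_apply[OF f, of i] i fi by simp
      have "(\<Sum>k<S. poly_norm nrm (M $$ (i, k)))
          = (\<Sum>k\<in>{0..<S}. poly_norm nrm (sylvester_entry a (perturbed C) (e, \<mu>) (g k)))"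
        using i fi by (intro sum.cong) (auto simp: M_def sylvester_mat_def S_def)
      also have "\<dots> = (\<Sum>p\<in>sylvester_cols a b. poly_norm nrm (sylvester_entry a (perturbed C) (e, \<mu>) p))"
        using g by (rule sum.reindex_bij_betw)
      also have "\<dots> \<le> (\<Sum>j<a. \<Sum>r\<le>b. poly_norm nrm (perturbed C e j r))"
        by (rule N2.sum_norm_sylvester_entry[OF row])
      also have "\<dots> \<le> (\<Sum>j<a. \<Sum>r\<le>b. nrm (C e j r) + (if j + r = e then 1 else 0))"
      proof (intro sum_mono)
        fix j r
        have "poly_norm nrm (perturbed C e j r)
            \<le> poly_norm nrm [:C e j r:] + poly_norm nrm (if j + r = e then [:0, 1:] else 0)"
          unfolding perturbed_def by (rule N2.add)
        then show "poly_norm nrm (perturbed C e j r) \<le> nrm (C e j r) + (if j + r = e then 1 else 0)"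
          using N1.poly_norm_X by (auto split: if_splits)
      qed
      also have "\<dots> \<le> \<Lambda>" using row by (intro bound) (auto simp: sylvester_rows_def)
      finally show "(\<Sum>k<S. poly_norm nrm (M $$ (i, k))) \<le> \<Lambda>" .
    qed
    finally show "\<bar>real_of_int (coeff (coeff (Determinant.det M) i) k)\<bar> \<le> \<Lambda> ^ sylvester_size a b"
      by (simp add: S_def)
  next
    show "\<forall>\<epsilon> t x u. (\<exists>j<a. x j \<noteq> 0) \<longrightarrow> (\<exists>r\<le>b. u r \<noteq> 0) \<longrightarrow>
      (\<forall>e<a + b. (\<Sum>j<a. \<Sum>r\<le>b.
          (poly (map_poly of_int (C e j r)) t + (if j + r = e then \<epsilon> else 0)) * (x j * u r)) = 0) \<longrightarrow>
      eval_bipoly (Determinant.det M) \<epsilon> t = 0"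
    proof (intro allI impI)
      fix \<epsilon> t :: complex and x u :: "nat \<Rightarrow> complex"
      assume x: "\<exists>j<a. x j \<noteq> 0" and u: "\<exists>r\<le>b. u r \<noteq> 0"
        and zero: "\<forall>e<a + b. (\<Sum>j<a. \<Sum>r\<le>b.
            (poly (map_poly of_int (C e j r)) t + (if j + r = e then \<epsilon> else 0)) * (x j * u r)) = 0"
      interpret h: comm_ring_hom "\<lambda>R. eval_bipoly R \<epsilon> t" by (rule comm_ring_hom_eval_bipoly)
      define h where "h R = eval_bipoly R \<epsilon> t" for R
      define v where "v = (\<lambda>(\<nu>, r). prod_mset (image_mset x \<nu>) * u r)"
      define V where "V = vec S (\<lambda>k. v (g k))"
      have hM: "map_mat h M \<in> carrier_mat S S" using M by simp
      have hp: "h (perturbed C e j r) = poly (map_poly of_int (C e j r)) t + (if j + r = e then \<epsilon> else 0)"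
        for e j r
        unfolding h_def perturbed_def h.hom_add by (auto simp: eval_bipoly_const eval_bipoly_X)
      have hs: "h (sylvester_entry a (perturbed C) p q) = sylvester_entry a (\<lambda>e j r. h (perturbed C e j r)) p q"
        for p q
        unfolding h_def by (cases p; cases q) (auto simp: sylvester_entry_def h.hom_sum intro!: sum.cong)
      have "map_mat h M *\<^sub>v V = 0\<^sub>v S"
      proof (rule eq_vecI)
        fix i assume "i < dim_vec (0\<^sub>v S)"
        then have i: "i < S" by simp
        obtain e \<mu> where fi: "f i = (e, \<mu>)" by (cases "f i")
        have row: "(e, \<mu>) \<in> sylvester_rows a b" using bij_betw_apply[OF f, of i] i fi by simp
        have "(map_mat h M *\<^sub>v V) $ i = (\<Sum>k\<in>{0..<S}. h (M $$ (i, k)) * v (g k))"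
          using i M by (simp add: scalar_prod_def V_def)
        also have "\<dots> = (\<Sum>k\<in>{0..<S}.
            (case g k of (\<nu>, r) \<Rightarrow> sylvester_entry a (\<lambda>e j r. h (perturbed C e j r)) (e, \<mu>) (\<nu>, r) * v (\<nu>, r)))"
          using i fi by (intro sum.cong) (auto simp: M_def sylvester_mat_def S_def hs split: prod.split)
        also have "\<dots> = (\<Sum>(\<nu>, r)\<in>sylvester_cols a b.
            sylvester_entry a (\<lambda>e j r. h (perturbed C e j r)) (e, \<mu>) (\<nu>, r) * v (\<nu>, r))"
          using g by (rule sum.reindex_bij_betw)
        also have "\<dots> = (\<Sum>j<a. \<Sum>r\<le>b. h (perturbed C e j r) * v (add_mset j \<mu>, r))"
          by (rule sum_sylvester_entry_row[OF row])
        also have "\<dots> = prod_mset (image_mset x \<mu>) * (\<Sum>j<a. \<Sum>r\<le>b. h (perturbed C e j r) * (x j * u r))"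
          by (simp add: v_def sum_distrib_left mult_ac)
        also have "\<dots> = 0"
          using zero[rule_format, of e] row by (simp add: hp sylvester_rows_def)
        finally show "(map_mat h M *\<^sub>v V) $ i = 0\<^sub>v S $ i" using i by simp
      qed (use M in simp)
      moreover have "V \<noteq> 0\<^sub>v S"
      proof -
        obtain j r where jr: "j < a" "x j \<noteq> 0" "r \<le> b" "u r \<noteq> 0" using x u by blast
        then have "(replicate_mset (Suc b) j, r) \<in> sylvester_cols a b"
          by (auto simp: sylvester_cols_def multisets_of_size_def)
        then have "(replicate_mset (Suc b) j, r) \<in> g ` {0..<S}"
          using bij_betw_imp_surj_on[OF g] by simp
        then obtain k where k: "k < S" "g k = (replicate_mset (Suc b) j, r)" by auto
        then have "V $ k \<noteq> 0" using jr by (simp add: V_def v_def)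
        with k show ?thesis by (metis index_zero_vec(1))
      qed
      moreover have "V \<in> carrier_vec S" by (simp add: V_def)
      ultimately have "Determinant.det (map_mat h M) = 0"
        using det_0_iff_vec_prod_zero[OF hM] by blast
      then show "eval_bipoly (Determinant.det M) \<epsilon> t = 0"
        using h.hom_det[of M] by (simp add: h_def[abs_def])
    qed
  qed
qed

section \<open>Persistence of isolated zeros\<close>

no_notation vec_index (infixl "$" 100)
notation vec_nth (infixl "$" 90)

definition mdeg :: "('v::finite \<Rightarrow> nat) \<Rightarrow> nat" where
  "mdeg \<alpha> = (\<Sum>v\<in>UNIV. \<alpha> v)"

definition mindices2 :: "('v::finite \<Rightarrow> nat) set" where
  "mindices2 = {\<beta>. mdeg \<beta> \<le> 2}"

text \<open>The exponents of monomials that no \<open>x_v^3\<close> divides; for a system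
  \<open>x_v^3 = p_v(x)\<close> with \<open>p_v\<close> of degree at most 2 they give a basis of the
  quotient algebra.\<close>

definition box3 :: "('v::finite \<Rightarrow> nat) set" where
  "box3 = {\<alpha>. \<forall>v. \<alpha> v < 3}"

definition mmon :: "complex^'v::finite \<Rightarrow> ('v \<Rightarrow> nat) \<Rightarrow> complex" where
  "mmon x \<alpha> = (\<Prod>v\<in>UNIV. x $ v ^ \<alpha> v)"

definition quad_eval :: "('v::finite \<Rightarrow> ('v \<Rightarrow> nat) \<Rightarrow> complex) \<Rightarrow> 'v \<Rightarrow> complex^'v \<Rightarrow> complex" where
  "quad_eval p v x = (\<Sum>\<beta>\<in>mindices2. p v \<beta> * mmon x \<beta>)"

definition cubic_zero :: "('v::finite \<Rightarrow> ('v \<Rightarrow> nat) \<Rightarrow> complex) \<Rightarrow> complex^'v \<Rightarrow> bool" where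
  "cubic_zero p x \<longleftrightarrow> (\<forall>v. x $ v ^ 3 = quad_eval p v x)"

lemma mdeg_add: "mdeg (\<lambda>u. \<alpha> u + \<beta> u) = mdeg \<alpha> + mdeg \<beta>"
  by (simp add: mdeg_def sum.distrib)

lemma mdeg_upd_add: "mdeg (\<alpha>(v := \<alpha> v + k)) = mdeg \<alpha> + k"
proof -
  have "\<alpha>(v := \<alpha> v + k) = (\<lambda>u. \<alpha> u + (if u = v then k else 0))" by auto
  then show ?thesis by (simp only: mdeg_add) (simp add: mdeg_def)
qed

lemma le_mdeg: "\<alpha> v \<le> mdeg \<alpha>"
  unfolding mdeg_def by (rule member_le_sum) auto

lemma finite_box3 [simp]: "finite (box3 :: ('v::finite \<Rightarrow> nat) set)"
proof -
  have "(box3 :: ('v \<Rightarrow> nat) set) = UNIV \<rightarrow>\<^sub>E {..<3}" by (auto simp: box3_def)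
  then show ?thesis by (metis finite_PiE finite finite_lessThan)
qed

lemma finite_mindices2 [simp]: "finite (mindices2 :: ('v::finite \<Rightarrow> nat) set)"
proof (rule finite_subset[OF _ finite_box3], rule subsetI)
  fix \<beta> :: "'v \<Rightarrow> nat" assume "\<beta> \<in> mindices2"
  then have "\<beta> v < 3" for v using le_mdeg[of \<beta> v] by (simp add: mindices2_def)
  then show "\<beta> \<in> box3" by (simp add: box3_def)
qed

lemma mmon_upd_add: "mmon x (\<alpha>(v := \<alpha> v + k)) = x $ v ^ k * mmon x \<alpha>"
proof -
  have "mmon x (\<alpha>(v := \<alpha> v + k)) = (\<Prod>u\<in>UNIV. (if u = v then x $ v ^ k else 1) * x $ u ^ \<alpha> u)"
    unfolding mmon_def by (intro prod.cong) (auto simp: power_add)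
  then show ?thesis by (simp add: prod.distrib mmon_def)
qed

lemma mmon_add: "mmon x (\<lambda>u. \<alpha> u + \<beta> u) = mmon x \<alpha> * mmon x \<beta>"
  by (simp add: mmon_def power_add prod.distrib)

lemma mmon_zero [simp]: "mmon x (\<lambda>_. 0) = 1"
  by (simp add: mmon_def)

text \<open>A functional on polynomials vanishes on the ideal of the equations \<open>x\<^sub>v\<^sup>3 = p\<^sub>v(x)\<close> iff its values
  on monomials satisfy this recurrence. In this dual picture multiplication by variables is a shift of
  indices, so that commutation is evident.\<close>

definition recurrent :: "('v::finite \<Rightarrow> ('v \<Rightarrow> nat) \<Rightarrow> complex) \<Rightarrow> (('v \<Rightarrow> nat) \<Rightarrow> complex) \<Rightarrow> bool" where
  "recurrent p \<phi> \<longleftrightarrow>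
    (\<forall>v \<alpha>. \<phi> (\<alpha>(v := \<alpha> v + 3)) = (\<Sum>\<beta>\<in>mindices2. p v \<beta> * \<phi> (\<lambda>u. \<alpha> u + \<beta> u)))"

lemma mdeg_reduce:
  assumes "3 \<le> \<alpha> v" "\<beta> \<in> mindices2"
  shows "mdeg (\<lambda>u. (\<alpha>(v := \<alpha> v - 3)) u + \<beta> u) < mdeg \<alpha>"
proof -
  have "mdeg (\<lambda>u. (\<alpha>(v := \<alpha> v - 3)) u + \<beta> u) = mdeg (\<alpha>(v := \<alpha> v - 3)) + mdeg \<beta>"
    by (rule mdeg_add)
  then show ?thesis
    using mdeg_upd_add[of "\<alpha>(v := \<alpha> v - 3)" v 3] assms by (simp add: mindices2_def)
qed

text \<open>Arbitrary values on \<open>box3\<close> are propagated by rewriting with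
  \<open>x_v^3 = p_v(x)\<close>; as \<open>p_v\<close> has degree at most 2, the total degree drops.
  That the choice of \<open>v\<close> does not matter follows only later, once all recurrences are
  known to hold.\<close>

function extend :: "('v::finite \<Rightarrow> ('v \<Rightarrow> nat) \<Rightarrow> complex) \<Rightarrow> (('v \<Rightarrow> nat) \<Rightarrow> complex) \<Rightarrow>
    ('v \<Rightarrow> nat) \<Rightarrow> complex" where
  "extend p b \<alpha> = (if \<alpha> \<in> box3 then b \<alpha> else
    \<Sum>\<beta>\<in>mindices2. p (SOME v. 3 \<le> \<alpha> v) \<beta> *
      extend p b (\<lambda>u. (\<alpha>((SOME v. 3 \<le> \<alpha> v) := \<alpha> (SOME v. 3 \<le> \<alpha> v) - 3)) u + \<beta> u))"
  by pat_completeness auto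
termination
proof (relation "Wellfounded.measure (\<lambda>(p, b, \<alpha>). mdeg \<alpha>)")
  fix p :: "'v::finite \<Rightarrow> ('v \<Rightarrow> nat) \<Rightarrow> complex" and b and \<alpha> \<beta> :: "'v \<Rightarrow> nat"
  assume "\<alpha> \<notin> box3" and \<beta>: "\<beta> \<in> mindices2"
  then have "\<exists>v. 3 \<le> \<alpha> v" by (auto simp: box3_def not_less)
  then have "3 \<le> \<alpha> (SOME v. 3 \<le> \<alpha> v)" by (rule someI_ex)
  from mdeg_reduce[of \<alpha> _ \<beta>, OF this \<beta>]
  show "((p, b, \<lambda>u. (\<alpha>((SOME v. 3 \<le> \<alpha> v) := \<alpha> (SOME v. 3 \<le> \<alpha> v) - 3)) u + \<beta> u), (p, b, \<alpha>))
      \<in> Wellfounded.measure (\<lambda>(p, b, \<alpha>). mdeg \<alpha>)" by simp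
qed simp

declare extend.simps [simp del]

lemma extend_box3: "\<alpha> \<in> box3 \<Longrightarrow> extend p b \<alpha> = b \<alpha>"
  by (simp add: extend.simps)

text \<open>The variable \<open>v\<close> is fixed before \<open>p\<close> and \<open>b\<close>, so
  that one reduction serves a whole sequence of systems in a limit.\<close>

lemma extend_reduce:
  assumes "\<alpha> \<notin> box3"
  obtains v where "3 \<le> \<alpha> v"
    and "\<And>p b. extend p b \<alpha> = (\<Sum>\<beta>\<in>mindices2. p v \<beta> * extend p b (\<lambda>u. (\<alpha>(v := \<alpha> v - 3)) u + \<beta> u))"
proof
  have "\<exists>v. 3 \<le> \<alpha> v" using assms by (auto simp: box3_def not_less)
  then show "3 \<le> \<alpha> (SOME v. 3 \<le> \<alpha> v)" by (rule someI_ex)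
qed (subst extend.simps, simp only: assms if_False)

text \<open>Consistency of the recurrences: the leading monomials \<open>x\<^sub>v\<^sup>3\<close> are pairwise coprime, so two
  different reductions of the same monomial can be carried out one after the other in either order.\<close>

lemma recurrent_extend: "recurrent p (extend p b)"
proof -
  have "extend p b (\<alpha>(v := \<alpha> v + 3)) = (\<Sum>\<beta>\<in>mindices2. p v \<beta> * extend p b (\<lambda>u. \<alpha> u + \<beta> u))"
    for v \<alpha>
  proof (induction "mdeg \<alpha>" arbitrary: \<alpha> v rule: less_induct)
    case less
    let ?A = "\<alpha>(v := \<alpha> v + 3)"
    have "\<not> ?A v < 3" by simp
    then have "?A \<notin> box3" unfolding box3_def by blast
    then obtain w where w: "3 \<le> ?A w"
      and red: "extend p b ?A = (\<Sum>\<beta>\<in>mindices2. p w \<beta> * extend p b (\<lambda>u. (?A(w := ?A w - 3)) u + \<beta> u))"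
      by (rule extend_reduce) blast
    show ?case
    proof (cases "w = v")
      case True
      then have "?A(w := ?A w - 3) = \<alpha>" by simp
      with red True show ?thesis by simp
    next
      case False
      define \<gamma> where "\<gamma> = \<alpha>(w := \<alpha> w - 3)"
      have \<alpha>w: "3 \<le> \<alpha> w" using w False by simp
      have \<alpha>: "\<alpha> = \<gamma>(w := \<gamma> w + 3)" using \<alpha>w by (auto simp: \<gamma>_def)
      have deg: "mdeg (\<lambda>u. \<gamma> u + \<beta> u) < mdeg \<alpha>" if "\<beta> \<in> mindices2" for \<beta>
        using mdeg_reduce[of \<alpha> w \<beta>, OF \<alpha>w that] by (simp add: \<gamma>_def)
      have "extend p b ?A = (\<Sum>\<beta>\<in>mindices2. p w \<beta> *
          (\<Sum>\<beta>'\<in>mindices2. p v \<beta>' * extend p b (\<lambda>u. \<gamma> u + \<beta> u + \<beta>' u)))"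
        unfolding red
      proof (intro sum.cong refl arg_cong2[of _ _ _ _ "(*)"])
        fix \<beta> :: "'a \<Rightarrow> nat" assume \<beta>: "\<beta> \<in> mindices2"
        have "(\<lambda>u. (?A(w := ?A w - 3)) u + \<beta> u) = (\<lambda>u. \<gamma> u + \<beta> u)(v := (\<gamma> v + \<beta> v) + 3)"
          using False by (auto simp: \<gamma>_def)
        then show "extend p b (\<lambda>u. (?A(w := ?A w - 3)) u + \<beta> u)
            = (\<Sum>\<beta>'\<in>mindices2. p v \<beta>' * extend p b (\<lambda>u. \<gamma> u + \<beta> u + \<beta>' u))"
          using less[OF deg[OF \<beta>], of v] by simp
      qed
      also have "\<dots> = (\<Sum>\<beta>'\<in>mindices2. p v \<beta>' *
          (\<Sum>\<beta>\<in>mindices2. p w \<beta> * extend p b (\<lambda>u. \<gamma> u + \<beta>' u + \<beta> u)))"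
        unfolding sum_distrib_left by (subst sum.swap) (simp add: mult_ac add_ac)
      also have "\<dots> = (\<Sum>\<beta>'\<in>mindices2. p v \<beta>' * extend p b (\<lambda>u. \<alpha> u + \<beta>' u))"
      proof (intro sum.cong refl arg_cong2[of _ _ _ _ "(*)"])
        fix \<beta> :: "'a \<Rightarrow> nat" assume \<beta>: "\<beta> \<in> mindices2"
        have "(\<lambda>u. \<alpha> u + \<beta> u) = (\<lambda>u. \<gamma> u + \<beta> u)(w := (\<gamma> w + \<beta> w) + 3)"
          by (subst \<alpha>) auto
        then show "(\<Sum>\<beta>'\<in>mindices2. p w \<beta>' * extend p b (\<lambda>u. \<gamma> u + \<beta> u + \<beta>' u))
            = extend p b (\<lambda>u. \<alpha> u + \<beta> u)"
          using less[OF deg[OF \<beta>], of w] by simp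
      qed
      finally show ?thesis .
    qed
  qed
  then show ?thesis by (simp add: recurrent_def)
qed

lemma recurrent_unique:
  assumes "recurrent p \<phi>" "recurrent p \<psi>" and "\<And>\<alpha>. \<alpha> \<in> box3 \<Longrightarrow> \<phi> \<alpha> = \<psi> \<alpha>"
  shows "\<phi> = \<psi>"
proof
  show "\<phi> \<alpha> = \<psi> \<alpha>" for \<alpha>
  proof (induction "mdeg \<alpha>" arbitrary: \<alpha> rule: less_induct)
    case less
    show ?case
    proof (cases "\<alpha> \<in> box3")
      case False
      then obtain v where v: "3 \<le> \<alpha> v" by (auto simp: box3_def not_less)
      define \<gamma> where "\<gamma> = \<alpha>(v := \<alpha> v - 3)"
      have \<alpha>: "\<alpha> = \<gamma>(v := \<gamma> v + 3)" using v by (auto simp: \<gamma>_def)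
      have "\<phi> (\<lambda>u. \<gamma> u + \<beta> u) = \<psi> (\<lambda>u. \<gamma> u + \<beta> u)" if "\<beta> \<in> mindices2" for \<beta>
        using less mdeg_reduce[of \<alpha> v \<beta>, OF v that] by (simp add: \<gamma>_def)
      then have "\<phi> (\<gamma>(v := \<gamma> v + 3)) = \<psi> (\<gamma>(v := \<gamma> v + 3))"
        using assms(1,2) by (simp add: recurrent_def)
      then show ?thesis using \<alpha> by simp
    qed (rule assms(3))
  qed
qed

lemma recurrent_sum:
  assumes "\<And>i. i \<in> I \<Longrightarrow> recurrent p (\<Phi> i)"
  shows "recurrent p (\<lambda>\<alpha>. \<Sum>i\<in>I. c i * \<Phi> i \<alpha>)"
  unfolding recurrent_def
proof (intro allI)
  fix v \<alpha>
  have "(\<Sum>i\<in>I. c i * \<Phi> i (\<alpha>(v := \<alpha> v + 3)))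
      = (\<Sum>i\<in>I. c i * (\<Sum>\<beta>\<in>mindices2. p v \<beta> * \<Phi> i (\<lambda>u. \<alpha> u + \<beta> u)))"
    using assms by (intro sum.cong) (auto simp: recurrent_def)
  also have "\<dots> = (\<Sum>\<beta>\<in>mindices2. p v \<beta> * (\<Sum>i\<in>I. c i * \<Phi> i (\<lambda>u. \<alpha> u + \<beta> u)))"
    unfolding sum_distrib_left by (subst sum.swap) (simp add: mult_ac)
  finally show "(\<Sum>i\<in>I. c i * \<Phi> i (\<alpha>(v := \<alpha> v + 3)))
      = (\<Sum>\<beta>\<in>mindices2. p v \<beta> * (\<Sum>i\<in>I. c i * \<Phi> i (\<lambda>u. \<alpha> u + \<beta> u)))" .
qed

section \<open>Multiplication operators in the dual picture\<close>

definition shift :: "'v \<Rightarrow> (('v \<Rightarrow> nat) \<Rightarrow> complex) \<Rightarrow> ('v \<Rightarrow> nat) \<Rightarrow> complex" where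
  "shift v \<phi> = (\<lambda>\<alpha>. \<phi> (\<alpha>(v := \<alpha> v + 1)))"

lemma shift_commute: "shift v (shift w \<phi>) = shift w (shift v \<phi>)"
  by (cases "v = w") (auto simp: shift_def fun_upd_twist)

lemma recurrent_shift: "recurrent p \<phi> \<Longrightarrow> recurrent p (shift v \<phi>)"
  unfolding recurrent_def
proof (intro allI)
  fix w and \<alpha> :: "'a \<Rightarrow> nat"
  assume rec: "\<forall>v \<alpha>. \<phi> (\<alpha>(v := \<alpha> v + 3)) = (\<Sum>\<beta>\<in>mindices2. p v \<beta> * \<phi> (\<lambda>u. \<alpha> u + \<beta> u))"
  let ?A = "\<alpha>(v := \<alpha> v + 1)"
  have "(\<alpha>(w := \<alpha> w + 3))(v := (\<alpha>(w := \<alpha> w + 3)) v + 1) = ?A(w := ?A w + 3)" by auto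
  moreover have "(\<lambda>u. \<alpha> u + \<beta> u)(v := \<alpha> v + \<beta> v + 1) = (\<lambda>u. ?A u + \<beta> u)" for \<beta> by auto
  ultimately show "shift v \<phi> (\<alpha>(w := \<alpha> w + 3)) = (\<Sum>\<beta>\<in>mindices2. p w \<beta> * shift v \<phi> (\<lambda>u. \<alpha> u + \<beta> u))"
    using rec[rule_format, of ?A w] by (simp add: shift_def)
qed

text \<open>The triple \<open>(v, c, k)\<close> stands for the polynomial \<open>k (x\<^sub>v - c)\<close>, a list of triples for the product.\<close>

fun factor_op :: "('v \<times> complex \<times> complex) list \<Rightarrow> (('v \<Rightarrow> nat) \<Rightarrow> complex) \<Rightarrow> ('v \<Rightarrow> nat) \<Rightarrow> complex" where
  "factor_op [] \<phi> = \<phi>"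
| "factor_op ((v, c, k) # L) \<phi> = (\<lambda>\<alpha>. k * (shift v (factor_op L \<phi>) \<alpha> - c * factor_op L \<phi> \<alpha>))"

fun factor_val :: "('v \<times> complex \<times> complex) list \<Rightarrow> complex^'v::finite \<Rightarrow> complex" where
  "factor_val [] x = 1"
| "factor_val ((v, c, k) # L) x = k * (x $ v - c) * factor_val L x"

lemma recurrent_lincomb:
  assumes "recurrent p \<phi>" "recurrent p \<psi>"
  shows "recurrent p (\<lambda>\<alpha>. k * (\<phi> \<alpha> - c * \<psi> \<alpha>))"
  using assms by (simp add: recurrent_def sum_distrib_left sum_subtractf algebra_simps)

lemma recurrent_factor_op: "recurrent p \<phi> \<Longrightarrow> recurrent p (factor_op L \<phi>)"
  by (induction L \<phi> rule: factor_op.induct) (auto intro!: recurrent_lincomb recurrent_shift)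

lemma shift_sum: "shift v (\<lambda>\<alpha>. \<Sum>i\<in>I. c i * \<Phi> i \<alpha>) = (\<lambda>\<alpha>. \<Sum>i\<in>I. c i * shift v (\<Phi> i) \<alpha>)"
  by (simp add: shift_def)

lemma factor_op_sum:
  "factor_op L (\<lambda>\<alpha>. \<Sum>i\<in>I. c i * \<Phi> i \<alpha>) = (\<lambda>\<alpha>. \<Sum>i\<in>I. c i * factor_op L (\<Phi> i) \<alpha>)"
proof (induction L)
  case (Cons t L)
  obtain w d k where t: "t = (w, d, k)" by (cases t)
  show ?case
    by (simp add: t Cons shift_sum sum_distrib_left sum_subtractf right_diff_distrib mult_ac)
qed simp

lemma shift_factor_op: "shift v (factor_op L \<phi>) = factor_op L (shift v \<phi>)"
proof (induction L)
  case (Cons t L)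
  obtain w c k where t: "t = (w, c, k)" by (cases t)
  have "shift v (factor_op (t # L) \<phi>) = 
      (\<lambda>\<alpha>. k * (shift v (shift w (factor_op L \<phi>)) \<alpha> - c * shift v (factor_op L \<phi>) \<alpha>))"
    by (simp add: t shift_def)
  then show ?case unfolding shift_commute[of v w] Cons by (simp add: t)
qed simp

lemma shift_mmon: "shift v (\<lambda>\<alpha>. c * mmon x \<alpha>) = (\<lambda>\<alpha>. x $ v * (c * mmon x \<alpha>))"
  using mmon_upd_add[of x _ v 1] by (simp add: shift_def mult_ac)

lemma factor_op_mmon: "factor_op L (\<lambda>\<alpha>. c * mmon x \<alpha>) = (\<lambda>\<alpha>. factor_val L x * (c * mmon x \<alpha>))"
proof (induction L)
  case (Cons t L)
  obtain w d k where t: "t = (w, d, k)" by (cases t)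
  show ?case
    by (simp add: t Cons mult.assoc[symmetric] shift_mmon) (simp add: algebra_simps)
qed simp

text \<open>Evaluation at \<open>x\<close> kills the ideal exactly when \<open>x\<close> is a zero.
  The factor \<open>c\<close> is present because joint eigenvectors are determined only up to
  scaling.\<close>

lemma recurrent_mmon_iff:
  assumes "c \<noteq> 0"
  shows "recurrent p (\<lambda>\<alpha>. c * mmon x \<alpha>) \<longleftrightarrow> cubic_zero p x"
proof
  assume "recurrent p (\<lambda>\<alpha>. c * mmon x \<alpha>)"
  then have "c * (x $ v ^ 3 * mmon x \<alpha>) = (\<Sum>\<beta>\<in>mindices2. p v \<beta> * (c * mmon x (\<lambda>u. \<alpha> u + \<beta> u)))"
    for v \<alpha>
    unfolding mmon_upd_add[symmetric] by (simp only: recurrent_def)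
  from this[where \<alpha> = "\<lambda>_. 0"] have "c * x $ v ^ 3 = c * quad_eval p v x" for v
    by (simp add: quad_eval_def sum_distrib_left mult_ac)
  with assms show "cubic_zero p x" by (simp add: cubic_zero_def)
next
  assume "cubic_zero p x"
  then show "recurrent p (\<lambda>\<alpha>. c * mmon x \<alpha>)"
    unfolding recurrent_def mmon_upd_add mmon_add
    by (simp add: cubic_zero_def quad_eval_def sum_distrib_left sum_distrib_right mult_ac)
qed

definition box3_enum :: "nat \<Rightarrow> ('v::finite \<Rightarrow> nat)" where
  "box3_enum = (SOME h. bij_betw h {0..<card (box3 :: ('v \<Rightarrow> nat) set)} box3)"

lemma bij_betw_box3_enum:
  "bij_betw (box3_enum :: nat \<Rightarrow> 'v::finite \<Rightarrow> nat) {0..<card (box3 :: ('v \<Rightarrow> nat) set)} box3"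
  unfolding box3_enum_def by (rule someI_ex[OF ex_bij_betw_nat_finite[OF finite_box3]])

text \<open>The transpose of the matrix of multiplication by the product \<open>L\<close> on the
  quotient algebra: column \<open>j\<close> is the image of the functional dual to the j-th monomial
  of \<open>box3\<close>.\<close>

definition factor_mat ::
  "('v::finite \<Rightarrow> ('v \<Rightarrow> nat) \<Rightarrow> complex) \<Rightarrow> ('v \<times> complex \<times> complex) list \<Rightarrow> complex mat" where
  "factor_mat p L = mat (card (box3 :: ('v \<Rightarrow> nat) set)) (card (box3 :: ('v \<Rightarrow> nat) set))
    (\<lambda>(i, j). factor_op L (extend p (\<lambda>\<alpha>. if \<alpha> = box3_enum j then 1 else 0)) (box3_enum i))"

lemma factor_mat_carrier [simp]:
  "factor_mat (p :: 'v::finite \<Rightarrow> _) L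
    \<in> carrier_mat (card (box3 :: ('v \<Rightarrow> nat) set)) (card (box3 :: ('v \<Rightarrow> nat) set))"
  by (simp add: factor_mat_def)

definition restrict_vec :: "(('v::finite \<Rightarrow> nat) \<Rightarrow> complex) \<Rightarrow> complex Matrix.vec" where
  "restrict_vec \<phi> = Matrix.vec (card (box3 :: ('v \<Rightarrow> nat) set)) (\<lambda>i. \<phi> (box3_enum i))"

lemma restrict_vec_carrier [simp]:
  "restrict_vec (\<phi> :: ('v::finite \<Rightarrow> nat) \<Rightarrow> _) \<in> carrier_vec (card (box3 :: ('v \<Rightarrow> nat) set))"
  by (simp add: restrict_vec_def)

lemma restrict_vec_eq_iff:
  fixes \<phi> \<psi> :: "('v::finite \<Rightarrow> nat) \<Rightarrow> complex"
  assumes "recurrent p \<phi>" "recurrent p \<psi>"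
  shows "restrict_vec \<phi> = restrict_vec \<psi> \<longleftrightarrow> \<phi> = \<psi>"
proof
  assume eq: "restrict_vec \<phi> = restrict_vec \<psi>"
  show "\<phi> = \<psi>"
  proof (rule recurrent_unique[OF assms])
    fix \<alpha> :: "'v \<Rightarrow> nat" assume "\<alpha> \<in> box3"
    then have "\<alpha> \<in> box3_enum ` {0..<card (box3 :: ('v \<Rightarrow> nat) set)}"
      unfolding bij_betw_imp_surj_on[OF bij_betw_box3_enum] .
    then obtain i where "i < card (box3 :: ('v \<Rightarrow> nat) set)" "\<alpha> = box3_enum i" by auto
    then show "\<phi> \<alpha> = \<psi> \<alpha>"
      using arg_cong[OF eq, of "\<lambda>v. vec_index v i"] by (simp add: restrict_vec_def)
  qed
qed simp

lemma recurrent_zero: "recurrent p (\<lambda>_. 0)"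
  by (simp add: recurrent_def)

lemma restrict_vec_zero:
  "restrict_vec (\<lambda>_ :: 'v::finite \<Rightarrow> nat. 0) = 0\<^sub>v (card (box3 :: ('v \<Rightarrow> nat) set))"
  by (rule eq_vecI) (auto simp: restrict_vec_def)

lemma recurrent_expand:
  fixes \<phi> :: "('v::finite \<Rightarrow> nat) \<Rightarrow> complex"
  assumes "recurrent p \<phi>"
  shows "\<phi> = (\<lambda>\<alpha>. \<Sum>j\<in>{0..<card (box3 :: ('v \<Rightarrow> nat) set)}. \<phi> (box3_enum j) *
    extend p (\<lambda>\<alpha>. if \<alpha> = box3_enum j then 1 else 0) \<alpha>)" (is "_ = ?\<psi>")
proof (rule recurrent_unique[OF assms])
  show "recurrent p ?\<psi>" by (intro recurrent_sum recurrent_extend)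
  fix \<alpha> :: "'v \<Rightarrow> nat" assume \<alpha>: "\<alpha> \<in> box3"
  have "?\<psi> \<alpha> = (\<Sum>j\<in>{0..<card (box3 :: ('v \<Rightarrow> nat) set)}.
      (\<lambda>\<beta>. if \<alpha> = \<beta> then \<phi> \<beta> else 0) (box3_enum j))"
    by (simp add: extend_box3[OF \<alpha>] if_distrib[of "\<lambda>x. _ * x"] cong: if_cong)
  also have "\<dots> = (\<Sum>\<beta>\<in>box3. if \<alpha> = \<beta> then \<phi> \<beta> else 0)"
    by (rule sum.reindex_bij_betw[OF bij_betw_box3_enum])
  also have "\<dots> = \<phi> \<alpha>" using \<alpha> by simp
  finally show "\<phi> \<alpha> = ?\<psi> \<alpha>" ..
qed

lemma factor_mat_mult:
  fixes \<phi> :: "('v::finite \<Rightarrow> nat) \<Rightarrow> complex"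
  assumes "recurrent p \<phi>"
  shows "factor_mat p L *\<^sub>v restrict_vec \<phi> = restrict_vec (factor_op L \<phi>)"
proof (rule eq_vecI)
  let ?n = "card (box3 :: ('v \<Rightarrow> nat) set)"
  let ?E = "\<lambda>j. extend p (\<lambda>\<alpha>. if \<alpha> = box3_enum j then 1 else 0)"
  fix i assume "i < dim_vec (restrict_vec (factor_op L \<phi>))"
  then have i: "i < ?n" by (simp add: restrict_vec_def)
  have "vec_index (factor_mat p L *\<^sub>v restrict_vec \<phi>) i
      = (\<Sum>j\<in>{0..<?n}. \<phi> (box3_enum j) * factor_op L (?E j) (box3_enum i))"
    using i by (simp add: factor_mat_def restrict_vec_def scalar_prod_def mult.commute)
  also have "\<dots> = factor_op L \<phi> (box3_enum i)"
    by (subst (2) recurrent_expand[OF assms]) (simp only: factor_op_sum)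
  finally show "vec_index (factor_mat p L *\<^sub>v restrict_vec \<phi>) i = vec_index (restrict_vec (factor_op L \<phi>)) i"
    using i by (simp add: restrict_vec_def)
qed (simp add: restrict_vec_def factor_mat_def)

text \<open>Restriction to \<open>box3\<close> is an isomorphism from recurrent functionals to
  vectors, with inverse \<open>extend p\<close>, and it carries \<open>factor_op L\<close> to the
  matrix.\<close>

lemma eigenvalue_factor_mat_iff:
  fixes p :: "'v::finite \<Rightarrow> ('v \<Rightarrow> nat) \<Rightarrow> complex"
  shows "eigenvalue (factor_mat p L) c \<longleftrightarrow>
    (\<exists>\<phi>. recurrent p \<phi> \<and> \<phi> \<noteq> (\<lambda>_. 0) \<and> factor_op L \<phi> = (\<lambda>\<alpha>. c * \<phi> \<alpha>))"
proof
  let ?n = "card (box3 :: ('v \<Rightarrow> nat) set)"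
  let ?h = "box3_enum :: nat \<Rightarrow> 'v \<Rightarrow> nat"
  assume "eigenvalue (factor_mat p L) c"
  then obtain w where w: "w \<in> carrier_vec ?n" "w \<noteq> 0\<^sub>v ?n" "factor_mat p L *\<^sub>v w = c \<cdot>\<^sub>v w"
    by (auto simp: eigenvalue_def eigenvector_def factor_mat_def)
  define \<phi> where "\<phi> = extend p (\<lambda>\<alpha>. vec_index w (inv_into {0..<?n} ?h \<alpha>))"
  have rec: "recurrent p \<phi>" unfolding \<phi>_def by (rule recurrent_extend)
  have w\<phi>: "restrict_vec \<phi> = w"
  proof (rule eq_vecI)
    fix i assume "i < dim_vec w"
    then have i: "i < ?n" using w(1) by simp
    then have "?h i \<in> box3" using bij_betw_apply[OF bij_betw_box3_enum] by simp
    moreover have "inv_into {0..<?n} ?h (?h i) = i"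
      using i by (intro inv_into_f_f bij_betw_imp_inj_on[OF bij_betw_box3_enum]) simp
    ultimately show "vec_index (restrict_vec \<phi>) i = vec_index w i"
      using i by (simp add: restrict_vec_def \<phi>_def extend_box3)
  qed (use w(1) in \<open>simp add: restrict_vec_def\<close>)
  have "restrict_vec (factor_op L \<phi>) = c \<cdot>\<^sub>v restrict_vec \<phi>"
    using factor_mat_mult[OF rec, of L] w(3) by (simp add: w\<phi>)
  also have "\<dots> = restrict_vec (\<lambda>\<alpha>. c * \<phi> \<alpha>)"
    by (rule eq_vecI) (auto simp: restrict_vec_def)
  finally have "factor_op L \<phi> = (\<lambda>\<alpha>. c * \<phi> \<alpha>)"
    using restrict_vec_eq_iff[OF recurrent_factor_op[OF rec], of "\<lambda>\<alpha>. c * \<phi> \<alpha>" L]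
      recurrent_lincomb[OF rec recurrent_zero, of c 0] by simp
  moreover have "\<phi> \<noteq> (\<lambda>_. 0)"
    using w(2) w\<phi> by (auto simp: restrict_vec_zero)
  ultimately show "\<exists>\<phi>. recurrent p \<phi> \<and> \<phi> \<noteq> (\<lambda>_. 0) \<and> factor_op L \<phi> = (\<lambda>\<alpha>. c * \<phi> \<alpha>)"
    using rec by blast
next
  assume "\<exists>\<phi>. recurrent p \<phi> \<and> \<phi> \<noteq> (\<lambda>_. 0) \<and> factor_op L \<phi> = (\<lambda>\<alpha>. c * \<phi> \<alpha>)"
  then obtain \<phi> where \<phi>: "recurrent p \<phi>" "\<phi> \<noteq> (\<lambda>_. 0)" "factor_op L \<phi> = (\<lambda>\<alpha>. c * \<phi> \<alpha>)" by blast
  have "restrict_vec \<phi> \<noteq> restrict_vec (\<lambda>_ :: 'v \<Rightarrow> nat. 0)"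
    using \<phi>(2) restrict_vec_eq_iff[OF \<phi>(1) recurrent_zero] by simp
  moreover have "restrict_vec (\<lambda>\<alpha>. c * \<phi> \<alpha>) = c \<cdot>\<^sub>v restrict_vec \<phi>"
    by (rule eq_vecI) (auto simp: restrict_vec_def)
  ultimately show "eigenvalue (factor_mat p L) c"
    using factor_mat_mult[OF \<phi>(1), of L] \<phi>(3)
    by (auto simp: eigenvalue_def eigenvector_def factor_mat_def restrict_vec_zero intro!: exI[of _ "restrict_vec \<phi>"])
qed

section \<open>Joint eigenvectors of the shifts\<close>

definition poly_in_shift :: "'v \<Rightarrow> complex poly \<Rightarrow> (('v \<Rightarrow> nat) \<Rightarrow> complex) \<Rightarrow> ('v \<Rightarrow> nat) \<Rightarrow> complex" where
  "poly_in_shift v q \<phi> = (\<lambda>\<alpha>. \<Sum>k\<le>degree q. coeff q k * \<phi> (\<alpha>(v := \<alpha> v + k)))"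

lemma poly_in_shift_eq:
  "degree q \<le> N \<Longrightarrow> poly_in_shift v q \<phi> = (\<lambda>\<alpha>. \<Sum>k\<le>N. coeff q k * \<phi> (\<alpha>(v := \<alpha> v + k)))"
  unfolding poly_in_shift_def by (intro ext sum.mono_neutral_left) (auto simp: coeff_eq_0)

lemma poly_in_shift_linear_factor:
  "poly_in_shift v ([:- c, 1:] * q) \<phi> = (\<lambda>\<alpha>. shift v (poly_in_shift v q \<phi>) \<alpha> - c * poly_in_shift v q \<phi> \<alpha>)"
proof
  fix \<alpha>
  let ?N = "degree q"
  have eq: "[:- c, 1:] * q = pCons 0 q - Polynomial.smult c q" by simp
  have "degree ([:- c, 1:] * q) \<le> Suc ?N"
    unfolding eq by (intro degree_diff_le degree_pCons_le) (auto intro: le_SucI)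
  then have "poly_in_shift v ([:- c, 1:] * q) \<phi> \<alpha>
      = (\<Sum>k\<le>Suc ?N. coeff (pCons 0 q - Polynomial.smult c q) k * \<phi> (\<alpha>(v := \<alpha> v + k)))"
    by (subst poly_in_shift_eq) (auto simp: eq)
  also have "\<dots> = (\<Sum>k\<le>Suc ?N. coeff (pCons 0 q) k * \<phi> (\<alpha>(v := \<alpha> v + k)))
      - c * (\<Sum>k\<le>Suc ?N. coeff q k * \<phi> (\<alpha>(v := \<alpha> v + k)))"
    by (simp only: coeff_diff coeff_smult left_diff_distrib sum_subtractf sum_distrib_left mult.assoc)
  also have "(\<Sum>k\<le>Suc ?N. coeff (pCons 0 q) k * \<phi> (\<alpha>(v := \<alpha> v + k))) = shift v (poly_in_shift v q \<phi>) \<alpha>"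
    by (simp add: sum.atMost_Suc_shift shift_def poly_in_shift_def del: sum.atMost_Suc)
  also have "(\<Sum>k\<le>Suc ?N. coeff q k * \<phi> (\<alpha>(v := \<alpha> v + k))) = poly_in_shift v q \<phi> \<alpha>"
    by (subst poly_in_shift_eq[of q "Suc ?N"]) auto
  finally show "poly_in_shift v ([:- c, 1:] * q) \<phi> \<alpha> = shift v (poly_in_shift v q \<phi>) \<alpha> - c * poly_in_shift v q \<phi> \<alpha>" .
qed

lemma shift_funpow: "(shift v ^^ k) \<phi> = (\<lambda>\<alpha>. \<phi> (\<alpha>(v := \<alpha> v + k)))"
  by (induction k arbitrary: \<phi>) (auto simp: shift_def)

lemma recurrent_poly_in_shift:
  assumes "recurrent p \<phi>"
  shows "recurrent p (poly_in_shift v q \<phi>)"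
proof -
  have "recurrent p (\<lambda>\<alpha>. \<phi> (\<alpha>(v := \<alpha> v + k)))" for k
    unfolding shift_funpow[symmetric] by (induction k) (auto intro: recurrent_shift assms)
  then show ?thesis unfolding poly_in_shift_def by (intro recurrent_sum)
qed

lemma shift_poly_in_shift: "shift w (poly_in_shift v q \<phi>) = poly_in_shift v q (shift w \<phi>)"
  by (cases "v = w") (auto simp: shift_def poly_in_shift_def fun_upd_twist)

lemma factor_op_poly_in_shift: "factor_op L (poly_in_shift v q \<phi>) = poly_in_shift v q (factor_op L \<phi>)"
proof -
  have "factor_op L (\<lambda>\<alpha>. \<phi> (\<alpha>(v := \<alpha> v + k))) = (\<lambda>\<alpha>. factor_op L \<phi> (\<alpha>(v := \<alpha> v + k)))" for k
    unfolding shift_funpow[symmetric] by (induction k) (auto simp: shift_factor_op[symmetric])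
  then show ?thesis by (simp add: poly_in_shift_def factor_op_sum)
qed

lemma poly_in_shift_scale: "poly_in_shift v q (\<lambda>\<alpha>. c * \<phi> \<alpha>) = (\<lambda>\<alpha>. c * poly_in_shift v q \<phi> \<alpha>)"
  by (simp add: poly_in_shift_def sum_distrib_left mult_ac)

text \<open>The \<open>n + 1\<close> iterated shifts of \<phi> live in a space of dimension
  \<open>n = card box3\<close>, so they are linearly dependent. A zero row makes the matrix of their
  values square and singular, and a kernel vector supplies the coefficients.\<close>

lemma exists_annihilating_poly:
  fixes \<phi> :: "('v::finite \<Rightarrow> nat) \<Rightarrow> complex"
  assumes rec: "recurrent p \<phi>"
  obtains q where "q \<noteq> 0" "poly_in_shift v q \<phi> = (\<lambda>_. 0)"
proof -
  define n where "n = card (box3 :: ('v \<Rightarrow> nat) set)"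
  define M where "M = mat (Suc n) (Suc n) (\<lambda>(i, k). if i < n
    then \<phi> ((box3_enum i)(v := box3_enum i v + k)) else 0)"
  have M: "M \<in> carrier_mat (Suc n) (Suc n)" by (simp add: M_def)
  have "Determinant.det M = 0"
    unfolding det_def'[OF M]
  proof (intro sum.neutral ballI)
    fix \<sigma> assume "\<sigma> \<in> {\<sigma>. \<sigma> permutes {0..<Suc n}}"
    then have "\<sigma> n < Suc n" using permutes_in_image[of \<sigma> "{0..<Suc n}" n] by simp
    then have "M $$ (n, \<sigma> n) = 0" by (simp add: M_def)
    then show "of_int (sign \<sigma>) * (\<Prod>i = 0..<Suc n. M $$ (i, \<sigma> i)) = 0"
      by (simp add: prod_zero_iff)
  qed
  then obtain w where w: "w \<in> carrier_vec (Suc n)" "w \<noteq> 0\<^sub>v (Suc n)" "M *\<^sub>v w = 0\<^sub>v (Suc n)"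
    using det_0_iff_vec_prod_zero[OF M] by blast
  define q where "q = (\<Sum>k\<le>n. monom (vec_index w k) k)"
  have coeff_q: "coeff q k = (if k \<le> n then vec_index w k else 0)" for k
    by (simp add: q_def coeff_sum if_distrib cong: if_cong)
  have deg: "degree q \<le> n" by (rule degree_le) (simp add: coeff_q)
  show thesis
  proof
    obtain k where "k < Suc n" "vec_index w k \<noteq> 0"
      using w(1,2) by (metis carrier_vecD eq_vecI index_zero_vec)
    then have "coeff q k \<noteq> 0" by (simp add: coeff_q)
    then show "q \<noteq> 0" by auto
    have rz: "restrict_vec (poly_in_shift v q \<phi>) = restrict_vec (\<lambda>_ :: 'v \<Rightarrow> nat. 0)"
    proof (rule eq_vecI)
      fix i assume "i < dim_vec (restrict_vec (\<lambda>_ :: 'v \<Rightarrow> nat. 0))"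
      then have i: "i < n" by (simp add: restrict_vec_def n_def)
      have "0 = vec_index (M *\<^sub>v w) i" unfolding w(3) using i by simp
      also have "\<dots> = (\<Sum>k\<in>{0..<Suc n}. \<phi> ((box3_enum i)(v := box3_enum i v + k)) * vec_index w k)"
        using i w(1) by (simp add: scalar_prod_def M_def del: sum.op_ivl_Suc)
      also have "\<dots> = poly_in_shift v q \<phi> (box3_enum i)"
        unfolding poly_in_shift_eq[OF deg]
        by (intro sum.cong) (auto simp: coeff_q mult.commute)
      finally show "vec_index (restrict_vec (poly_in_shift v q \<phi>)) i = vec_index (restrict_vec (\<lambda>_ :: 'v \<Rightarrow> nat. 0)) i"
        using i by (simp add: restrict_vec_def n_def)
    qed (simp add: restrict_vec_def)
    show "poly_in_shift v q \<phi> = (\<lambda>_. 0)"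
      using restrict_vec_eq_iff[OF recurrent_poly_in_shift[OF rec] recurrent_zero] rz by blast
  qed
qed

text \<open>Split a root \<open>c\<close> off an annihilating polynomial of least degree: the
  cofactor does not annihilate \<phi>, and what it produces is an eigenvector for
  \<open>c\<close>.\<close>

lemma exists_shift_eigenvector:
  assumes rec: "recurrent p \<phi>" and nz: "\<phi> \<noteq> (\<lambda>_. 0)"
  obtains q c where "poly_in_shift v q \<phi> \<noteq> (\<lambda>_. 0)"
    and "shift v (poly_in_shift v q \<phi>) = (\<lambda>\<alpha>. c * poly_in_shift v q \<phi> \<alpha>)"
proof -
  define good where "good q \<longleftrightarrow> q \<noteq> 0 \<and> poly_in_shift v q \<phi> = (\<lambda>_. 0)" for q
  obtain q0 where "good q0" using exists_annihilating_poly[OF rec] good_def by metis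
  then obtain q where q: "good q" and least: "\<And>r. good r \<Longrightarrow> degree q \<le> degree r"
    using exists_least_lemma[of "\<lambda>d. \<exists>q. good q \<and> degree q = d"] by (metis (no_types) arg_min_nat_lemma)
  have "degree q \<noteq> 0"
  proof
    assume "degree q = 0"
    then obtain a where a: "q = [:a:]" by (rule degree_eq_zeroE)
    with q nz show False by (auto simp: good_def poly_in_shift_def fun_eq_iff)
  qed
  then obtain c where "poly q c = 0"
    using fundamental_theorem_of_algebra[of q] constant_degree[of q] by auto
  then obtain r where r: "q = [:- c, 1:] * r" by (auto simp: poly_eq_0_iff_dvd dvd_def)
  have "r \<noteq> 0" using q r by (auto simp: good_def)
  then have "degree r < degree q" unfolding r by (subst degree_mult_eq) auto
  then have "\<not> good r" using least[of r] by auto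
  with \<open>r \<noteq> 0\<close> have "poly_in_shift v r \<phi> \<noteq> (\<lambda>_. 0)" by (simp add: good_def)
  moreover have "shift v (poly_in_shift v r \<phi>) = (\<lambda>\<alpha>. c * poly_in_shift v r \<phi> \<alpha>)"
    using q poly_in_shift_linear_factor[of v c r \<phi>, folded r] by (simp add: good_def fun_eq_iff)
  ultimately show thesis by (rule that)
qed

text \<open>Applying a polynomial in one more shift keeps all eigenvector relations obtained so far,
  because the operators commute.\<close>

lemma exists_joint_eigenvector:
  assumes "finite V" and "recurrent p \<phi>" and "\<phi> \<noteq> (\<lambda>_. 0)" and "factor_op L \<phi> = (\<lambda>\<alpha>. c * \<phi> \<alpha>)"
  shows "\<exists>\<psi>. recurrent p \<psi> \<and> \<psi> \<noteq> (\<lambda>_. 0) \<and> factor_op L \<psi> = (\<lambda>\<alpha>. c * \<psi> \<alpha>) \<and>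
    (\<forall>v\<in>V. \<exists>d. shift v \<psi> = (\<lambda>\<alpha>. d * \<psi> \<alpha>))"
  using assms(1)
proof (induction V)
  case empty
  with assms show ?case by blast
next
  case (insert v V)
  then obtain \<psi> where \<psi>: "recurrent p \<psi>" "\<psi> \<noteq> (\<lambda>_. 0)" "factor_op L \<psi> = (\<lambda>\<alpha>. c * \<psi> \<alpha>)"
      "\<And>w. w \<in> V \<Longrightarrow> \<exists>d. shift w \<psi> = (\<lambda>\<alpha>. d * \<psi> \<alpha>)" by blast
  obtain q d where q: "poly_in_shift v q \<psi> \<noteq> (\<lambda>_. 0)"
      "shift v (poly_in_shift v q \<psi>) = (\<lambda>\<alpha>. d * poly_in_shift v q \<psi> \<alpha>)"
    using exists_shift_eigenvector[OF \<psi>(1,2)] by blast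
  have "\<exists>d. shift w (poly_in_shift v q \<psi>) = (\<lambda>\<alpha>. d * poly_in_shift v q \<psi> \<alpha>)" if "w \<in> V" for w
    using \<psi>(4)[OF that] by (auto simp: shift_poly_in_shift poly_in_shift_scale)
  moreover have "factor_op L (poly_in_shift v q \<psi>) = (\<lambda>\<alpha>. c * poly_in_shift v q \<psi> \<alpha>)"
    by (simp add: factor_op_poly_in_shift \<psi>(3) poly_in_shift_scale)
  ultimately show ?case using q recurrent_poly_in_shift[OF \<psi>(1)] by blast
qed

text \<open>Each unit of an exponent contributes one eigenvalue, so the eigenvalues are the
  coordinates of a point at which the functional evaluates.\<close>

lemma joint_eigenvector_eq_mmon:
  fixes \<psi> :: "('v::finite \<Rightarrow> nat) \<Rightarrow> complex"
  assumes "\<And>v. shift v \<psi> = (\<lambda>\<alpha>. x $ v * \<psi> \<alpha>)"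
  shows "\<psi> = (\<lambda>\<alpha>. \<psi> (\<lambda>_. 0) * mmon x \<alpha>)"
proof
  show "\<psi> \<alpha> = \<psi> (\<lambda>_. 0) * mmon x \<alpha>" for \<alpha>
  proof (induction "mdeg \<alpha>" arbitrary: \<alpha>)
    case 0
    then have "\<alpha> = (\<lambda>_. 0)" by (auto simp: mdeg_def)
    then show ?case by simp
  next
    case (Suc n)
    then have "\<exists>v. \<alpha> v \<noteq> 0" by (auto simp: mdeg_def intro: ccontr)
    then obtain v where v: "\<alpha> v \<noteq> 0" by blast
    define \<gamma> where "\<gamma> = \<alpha>(v := \<alpha> v - 1)"
    have \<alpha>: "\<alpha> = \<gamma>(v := \<gamma> v + 1)" using v by (auto simp: \<gamma>_def)
    have "mdeg \<alpha> = mdeg \<gamma> + 1" by (subst \<alpha>) (rule mdeg_upd_add)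
    then have "n = mdeg \<gamma>" using Suc(2) by simp
    then have "\<psi> \<gamma> = \<psi> (\<lambda>_. 0) * mmon x \<gamma>" by (rule Suc)
    moreover have "\<psi> \<alpha> = x $ v * \<psi> \<gamma>"
      using fun_cong[OF assms[of v], of \<gamma>] by (subst \<alpha>) (simp add: shift_def)
    moreover have "mmon x \<alpha> = x $ v * mmon x \<gamma>"
      using mmon_upd_add[of x \<gamma> v 1] by (subst \<alpha>) simp
    ultimately show ?case by simp
  qed
qed

text \<open>The eigenvalue theorem for zero-dimensional systems: starting from an eigenvector for
  \<open>c\<close>, the commuting shifts yield a joint eigenvector with the same \<open>c\<close>,
  and this is a multiple of the evaluation at a zero.\<close>

lemma eigenvalue_factor_mat:
  "eigenvalue (factor_mat p L) c \<longleftrightarrow> (\<exists>x. cubic_zero p x \<and> factor_val L x = c)"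
proof
  assume "eigenvalue (factor_mat p L) c"
  then obtain \<phi> where "recurrent p \<phi>" "\<phi> \<noteq> (\<lambda>_. 0)" "factor_op L \<phi> = (\<lambda>\<alpha>. c * \<phi> \<alpha>)"
    by (auto simp: eigenvalue_factor_mat_iff)
  from exists_joint_eigenvector[OF finite_class.finite_UNIV this]
  obtain \<psi> where \<psi>: "recurrent p \<psi>" "\<psi> \<noteq> (\<lambda>_. 0)" "factor_op L \<psi> = (\<lambda>\<alpha>. c * \<psi> \<alpha>)"
      "\<And>v. \<exists>d. shift v \<psi> = (\<lambda>\<alpha>. d * \<psi> \<alpha>)" by auto
  from \<psi>(4) obtain f where f: "\<And>v. shift v \<psi> = (\<lambda>\<alpha>. f v * \<psi> \<alpha>)" by metis
  define x where "x = (\<chi> v. f v)"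
  define k where "k = \<psi> (\<lambda>_. 0)"
  have eq: "\<psi> = (\<lambda>\<alpha>. k * mmon x \<alpha>)"
    unfolding k_def by (rule joint_eigenvector_eq_mmon) (simp add: f x_def)
  then have k: "k \<noteq> 0" using \<psi>(2) by auto
  have "cubic_zero p x" using \<psi>(1) recurrent_mmon_iff[OF k, of p x] by (simp add: eq)
  moreover have "factor_val L x * (k * mmon x (\<lambda>_. 0)) = c * (k * mmon x (\<lambda>_. 0))"
    using fun_cong[OF \<psi>(3), of "\<lambda>_. 0"] by (simp only: eq factor_op_mmon)
  ultimately show "\<exists>x. cubic_zero p x \<and> factor_val L x = c" using k by auto
next
  assume "\<exists>x. cubic_zero p x \<and> factor_val L x = c"
  then obtain x where x: "cubic_zero p x" "factor_val L x = c" by blast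
  have "(\<lambda>\<alpha>. 1 * mmon x \<alpha>) \<noteq> (\<lambda>_. 0)"
    by (metis mmon_zero mult_1 zero_neq_one)
  then show "eigenvalue (factor_mat p L) c"
    unfolding eigenvalue_factor_mat_iff using recurrent_mmon_iff[of 1 p x] factor_op_mmon[of L 1 x] x
    by (intro exI[of _ "\<lambda>\<alpha>. 1 * mmon x \<alpha>"]) auto
qed

section \<open>Continuous dependence of the zeros on the coefficients\<close>

lemma tendsto_extend:
  fixes P :: "nat \<Rightarrow> 'v::finite \<Rightarrow> ('v \<Rightarrow> nat) \<Rightarrow> complex"
  assumes "\<And>v \<beta>. \<beta> \<in> mindices2 \<Longrightarrow> (\<lambda>j. P j v \<beta>) \<longlonglongrightarrow> p v \<beta>"
  shows "(\<lambda>j. extend (P j) b \<alpha>) \<longlonglongrightarrow> extend p b \<alpha>"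
proof (induction "mdeg \<alpha>" arbitrary: \<alpha> rule: less_induct)
  case less
  show ?case
  proof (cases "\<alpha> \<in> box3")
    case False
    then obtain v where v: "3 \<le> \<alpha> v" and red: "\<And>p b. extend p b \<alpha> =
        (\<Sum>\<beta>\<in>mindices2. p v \<beta> * extend p b (\<lambda>u. (\<alpha>(v := \<alpha> v - 3)) u + \<beta> u))"
      by (rule extend_reduce) blast
    show ?thesis
      unfolding red using less mdeg_reduce[of \<alpha> v, OF v]
      by (intro tendsto_sum tendsto_mult assms) auto
  qed (simp add: extend_box3)
qed

lemma tendsto_factor_op:
  assumes "\<And>\<alpha>. (\<lambda>j. \<Phi> j \<alpha>) \<longlonglongrightarrow> \<phi> \<alpha>"
  shows "(\<lambda>j. factor_op L (\<Phi> j) \<alpha>) \<longlonglongrightarrow> factor_op L \<phi> \<alpha>"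
proof (induction L arbitrary: \<alpha>)
  case (Cons t L)
  obtain v c k where t: "t = (v, c, k)" by (cases t)
  show ?case
    unfolding t factor_op.simps shift_def by (intro tendsto_intros Cons)
qed (simp add: assms)

lemma tendsto_det:
  fixes A :: "nat \<Rightarrow> complex mat"
  assumes "\<And>j. A j \<in> carrier_mat n n" "B \<in> carrier_mat n n"
    and "\<And>i k. i < n \<Longrightarrow> k < n \<Longrightarrow> (\<lambda>j. A j $$ (i, k)) \<longlonglongrightarrow> B $$ (i, k)"
  shows "(\<lambda>j. Determinant.det (A j)) \<longlonglongrightarrow> Determinant.det B"
  unfolding det_def'[OF assms(1)] det_def'[OF assms(2)]
proof (intro tendsto_sum tendsto_mult tendsto_const tendsto_prod assms(3))
  fix \<sigma> i assume "\<sigma> \<in> {\<sigma>. \<sigma> permutes {0..<n}}" "i \<in> {0..<n}"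
  then show "i < n" "\<sigma> i < n" using permutes_in_image[of \<sigma> "{0..<n}" i] by auto
qed

lemma tendsto_char_poly:
  fixes A :: "nat \<Rightarrow> complex mat"
  assumes A: "\<And>j. A j \<in> carrier_mat n n" and B: "B \<in> carrier_mat n n"
    and lim: "\<And>i k. i < n \<Longrightarrow> k < n \<Longrightarrow> (\<lambda>j. A j $$ (i, k)) \<longlonglongrightarrow> B $$ (i, k)"
  shows "(\<lambda>j. poly (char_poly (A j)) c) \<longlonglongrightarrow> poly (char_poly B) c"
  unfolding char_poly_matrix[OF A] char_poly_matrix[OF B]
proof (rule tendsto_det[of _ n])
  fix i k assume ik: "i < n" "k < n"
  have "(- char_matrix M c) $$ (i, k) = c * (if i = k then 1 else 0) - M $$ (i, k)"
    if "M \<in> carrier_mat n n" for M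
    using that ik by (auto simp: char_matrix_def)
  with A B lim[OF ik] show "(\<lambda>j. (- char_matrix (A j) c) $$ (i, k)) \<longlonglongrightarrow> (- char_matrix B c) $$ (i, k)"
    by (auto intro!: tendsto_intros)
qed (use char_matrix_closed[OF A] char_matrix_closed[OF B] in simp_all)

text \<open>At 1 every linear factor of the characteristic polynomial has modulus at least
  1/2.\<close>

lemma norm_char_poly_ge:
  fixes A :: "complex mat"
  assumes A: "A \<in> carrier_mat n n" and small: "\<And>c. eigenvalue A c \<Longrightarrow> cmod c \<le> 1 / 2"
  shows "(1 / 2) ^ n \<le> cmod (poly (char_poly A) 1)"
proof -
  obtain as where as: "char_poly A = (\<Prod>a\<leftarrow>as. [:- a, 1:])" "length as = n"
    using char_poly_factorized[OF A] by blast
  have val: "poly (char_poly A) c = (\<Prod>a\<leftarrow>as. c - a)" for c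
    unfolding as(1) by (induction as) (auto simp: algebra_simps)
  have "cmod a \<le> 1 / 2" if "a \<in> set as" for a
    using that by (intro small) (auto simp: eigenvalue_root_char_poly[OF A] val prod_list_zero_iff)
  then have "(1 / 2) ^ length as \<le> cmod (\<Prod>a\<leftarrow>as. 1 - a)"
  proof (induction as)
    case (Cons a as)
    have "1 / 2 \<le> cmod (1 - a)"
      using Cons.prems norm_triangle_ineq2[of 1 a] by force
    then have "1 / 2 * (1 / 2) ^ length as \<le> cmod (1 - a) * cmod (\<Prod>a\<leftarrow>as. 1 - a)"
      using Cons by (intro mult_mono) auto
    then show ?case by (simp add: norm_mult)
  qed simp
  then show ?thesis by (simp add: val as(2))
qed

lemma finite_eigenvalues:
  fixes A :: "complex mat"
  assumes A: "A \<in> carrier_mat n n"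
  shows "finite {c. eigenvalue A c}"
proof -
  have "char_poly A \<noteq> 0" using degree_monic_char_poly[OF A] by auto
  then show ?thesis by (simp add: eigenvalue_root_char_poly[OF A] poly_roots_finite)
qed

text \<open>The triple \<open>(v, 0, 1)\<close> encodes the polynomial \<open>x_v\<close>, so each
  coordinate of a zero is an eigenvalue of a fixed matrix.\<close>

lemma finite_cubic_zeros: "finite {x :: complex^'v::finite. cubic_zero p x}"
proof -
  let ?S = "\<lambda>v. {c. eigenvalue (factor_mat p [(v, 0, 1)]) c}"
  have "{x. cubic_zero p x} \<subseteq> vec_lambda ` (UNIV \<rightarrow>\<^sub>E (\<Union>v. ?S v))"
  proof
    fix x :: "complex^'v" assume "x \<in> {x. cubic_zero p x}"
    then have "x $ v \<in> ?S v" for v by (auto simp: eigenvalue_factor_mat)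
    then show "x \<in> vec_lambda ` (UNIV \<rightarrow>\<^sub>E (\<Union>v. ?S v))"
      by (intro image_eqI[of _ _ "\<lambda>v. x $ v"]) auto
  qed
  moreover have "finite (\<Union>v. ?S v)"
    by (intro finite_UN_I finite finite_eigenvalues[OF factor_mat_carrier])
  ultimately show ?thesis
    by (meson finite_PiE finite finite_imageI finite_subset)
qed

lemma factor_val_eq_0: "(v, c, k) \<in> set L \<Longrightarrow> x $ v = c \<Longrightarrow> factor_val L x = 0"
  by (induction L x rule: factor_val.induct) auto

lemma factor_val_eq_1:
  "(\<And>v c k. (v, c, k) \<in> set L \<Longrightarrow> k * (x $ v - c) = 1) \<Longrightarrow> factor_val L x = 1"
  by (induction L x rule: factor_val.induct) auto

text \<open>Take the product of \<open>(x_v - c) / (\<xi>_v - c)\<close> over all values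
  \<open>c \<noteq> \<xi>_v\<close> of the coordinate \<open>v\<close> on \<open>Z\<close>: each
  point of \<open>Z\<close> differs from \<xi> somewhere and kills a factor.\<close>

lemma separating_factors:
  fixes \<xi> :: "complex^'v::finite"
  assumes "finite Z" "\<xi> \<notin> Z"
  obtains L where "factor_val L \<xi> = 1" "\<And>x. x \<in> Z \<Longrightarrow> factor_val L x = 0"
proof -
  let ?T = "{(v, c, k). c \<in> (\<lambda>x. x $ v) ` Z \<and> c \<noteq> \<xi> $ v \<and> k = 1 / (\<xi> $ v - c)}"
  have "?T \<subseteq> (\<lambda>(v, x). (v, x $ v, 1 / (\<xi> $ v - x $ v))) ` (UNIV \<times> Z)" by force
  then have "finite ?T" using assms(1) by (elim finite_subset) auto
  then obtain L where L: "set L = ?T" using finite_list by blast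
  show thesis
  proof
    show "factor_val L \<xi> = 1" by (rule factor_val_eq_1) (auto simp: L)
    fix x assume x: "x \<in> Z"
    with assms(2) have "x \<noteq> \<xi>" by auto
    then obtain v where "x $ v \<noteq> \<xi> $ v" by (auto simp: Finite_Cartesian_Product.vec_eq_iff)
    with x show "factor_val L x = 0"
      by (intro factor_val_eq_0[of v "x $ v" "1 / (\<xi> $ v - x $ v)"]) (auto simp: L)
  qed
qed

lemma continuous_factor_val: "continuous_on UNIV (factor_val L)"
proof (induction L)
  case Nil
  then show ?case by (simp add: fun_eq_iff[symmetric] factor_val.simps(1)[abs_def])
next
  case (Cons t L)
  obtain v c k where "t = (v, c, k)" by (cases t)
  then have "factor_val (t # L) = (\<lambda>x. k * (x $ v - c) * factor_val L x)" by auto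
  with Cons show ?case by (auto intro!: continuous_intros)
qed

lemma tendsto_mmon:
  "X \<longlonglongrightarrow> x \<Longrightarrow> (\<lambda>j. mmon (X j) \<alpha>) \<longlonglongrightarrow> mmon x \<alpha>"
  unfolding mmon_def by (intro tendsto_intros)

lemma tendsto_quad_eval:
  assumes "\<And>v \<beta>. \<beta> \<in> mindices2 \<Longrightarrow> (\<lambda>j. P j v \<beta>) \<longlonglongrightarrow> p v \<beta>" "X \<longlonglongrightarrow> x"
  shows "(\<lambda>j. quad_eval (P j) v (X j)) \<longlonglongrightarrow> quad_eval p v x"
  unfolding quad_eval_def by (intro tendsto_intros assms tendsto_mmon)

lemma cubic_zero_limit:
  assumes lim: "\<And>v \<beta>. \<beta> \<in> mindices2 \<Longrightarrow> (\<lambda>j. P j v \<beta>) \<longlonglongrightarrow> p v \<beta>" "X \<longlonglongrightarrow> x"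
    and zero: "\<And>j. cubic_zero (P j) (X j)"
  shows "cubic_zero p x"
  unfolding cubic_zero_def
proof
  fix v
  have "(\<lambda>j. quad_eval (P j) v (X j)) \<longlonglongrightarrow> quad_eval p v x"
    by (rule tendsto_quad_eval[OF lim])
  moreover have "(\<lambda>j. quad_eval (P j) v (X j)) = (\<lambda>j. X j $ v ^ 3)"
    using zero by (simp add: cubic_zero_def)
  moreover have "(\<lambda>j. X j $ v ^ 3) \<longlonglongrightarrow> x $ v ^ 3" by (intro tendsto_intros lim)
  ultimately show "x $ v ^ 3 = quad_eval p v x"
    by (simp add: LIMSEQ_unique)
qed

lemma norm_mmon_le:
  assumes "\<And>v. cmod (x $ v) \<le> R" "1 \<le> R" "\<beta> \<in> mindices2"
  shows "cmod (mmon x \<beta>) \<le> R ^ 2"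
proof -
  have "cmod (mmon x \<beta>) \<le> (\<Prod>v\<in>UNIV. R ^ \<beta> v)"
    unfolding mmon_def prod_norm[symmetric]
    by (intro prod_mono) (auto simp: norm_power intro!: power_mono assms(1))
  also have "\<dots> = R ^ mdeg \<beta>" by (simp add: power_sum mdeg_def)
  also have "\<dots> \<le> R ^ 2" using assms by (intro power_increasing) (auto simp: mindices2_def)
  finally show ?thesis .
qed

text \<open>At a coordinate of maximal modulus \<open>R > 1\<close>, the cube \<open>R^3\<close> is
  at most \<open>card mindices2 * B * R^2\<close>, since the right-hand sides have degree at most 2.
  This keeps zeros from escaping to infinity.\<close>

lemma cubic_zero_bound:
  fixes x :: "complex^'v::finite" and B :: real
  assumes "cubic_zero p x" and B: "\<And>v \<beta>. \<beta> \<in> mindices2 \<Longrightarrow> cmod (p v \<beta>) \<le> B" "0 \<le> B"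
  shows "cmod (x $ v) \<le> max 1 (card (mindices2 :: ('v \<Rightarrow> nat) set) * B)"
proof -
  define R where "R = Max (range (\<lambda>v. cmod (x $ v)))"
  have le: "cmod (x $ v) \<le> R" for v unfolding R_def by (intro Max_ge) auto
  have "R \<in> range (\<lambda>v. cmod (x $ v))" unfolding R_def by (intro Max_in) auto
  then obtain w where w: "R = cmod (x $ w)" by auto
  have "R \<le> card (mindices2 :: ('v \<Rightarrow> nat) set) * B" if R: "1 < R"
  proof -
    have "R ^ 3 = cmod (quad_eval p w x)"
      using assms(1) by (simp add: w cubic_zero_def norm_power[symmetric])
    also have "\<dots> \<le> (\<Sum>\<beta>\<in>(mindices2 :: ('v \<Rightarrow> nat) set). B * R ^ 2)"
      unfolding quad_eval_def
      by (intro sum_norm_le) (use R in \<open>auto simp: norm_mult intro!: mult_mono B norm_mmon_le le\<close>)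
    also have "\<dots> = card (mindices2 :: ('v \<Rightarrow> nat) set) * B * R ^ 2" by simp
    finally show ?thesis using R by (simp add: power2_eq_square power3_eq_cube)
  qed
  with le[of v] show ?thesis by (cases "1 < R") auto
qed

lemma cubic_zero_sequence:
  fixes P :: "nat \<Rightarrow> 'v::finite \<Rightarrow> ('v \<Rightarrow> nat) \<Rightarrow> complex"
  assumes lim: "\<And>v \<beta>. \<beta> \<in> mindices2 \<Longrightarrow> (\<lambda>j. P j v \<beta>) \<longlonglongrightarrow> p v \<beta>"
    and zero: "\<And>j. cubic_zero (P j) (X j)"
  obtains r x where "strict_mono r" "(X \<circ> r) \<longlonglongrightarrow> x" "cubic_zero p x"
proof -
  have "\<exists>B. \<beta> \<in> mindices2 \<longrightarrow> (\<forall>j. cmod (P j v \<beta>) \<le> B)" for v \<beta>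
    using convergent_imp_Bseq[OF convergentI[OF lim[of \<beta> v]]] by (auto simp: Bseq_def)
  note ex = this
  define B where "B v \<beta> = (SOME b. \<beta> \<in> mindices2 \<longrightarrow> (\<forall>j. cmod (P j v \<beta>) \<le> b))" for v \<beta>
  have B: "cmod (P j v \<beta>) \<le> B v \<beta>" if "\<beta> \<in> mindices2" for v \<beta> j
    using someI_ex[OF ex[of \<beta> v]] that unfolding B_def by blast
  define C where "C = (\<Sum>v\<in>UNIV. \<Sum>\<beta>\<in>mindices2. \<bar>B v \<beta>\<bar>)"
  have C: "cmod (P j v \<beta>) \<le> C" if "\<beta> \<in> mindices2" for j v \<beta>
  proof -
    have "cmod (P j v \<beta>) \<le> \<bar>B v \<beta>\<bar>" using B[OF that, of j v] by simp
    also have "\<dots> \<le> (\<Sum>\<beta>\<in>mindices2. \<bar>B v \<beta>\<bar>)" using that by (intro member_le_sum) auto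
    also have "\<dots> \<le> C" unfolding C_def by (rule member_le_sum) (auto intro: sum_nonneg)
    finally show ?thesis .
  qed
  have C0: "0 \<le> C" unfolding C_def by (intro sum_nonneg) auto
  have "cmod (X j $ v) \<le> max 1 (card (mindices2 :: ('v \<Rightarrow> nat) set) * C)" for j v
    by (rule cubic_zero_bound[OF zero C C0])
  then have "norm (X j) \<le> (\<Sum>v\<in>(UNIV :: 'v set). max 1 (card (mindices2 :: ('v \<Rightarrow> nat) set) * C))" for j
    unfolding norm_vec_def by (intro order_trans[OF L2_set_le_sum] sum_mono) auto
  then have "bounded (range X)" unfolding bounded_iff by blast
  then obtain r x where r: "strict_mono r" "(X \<circ> r) \<longlonglongrightarrow> x"
    using bounded_imp_convergent_subsequence by blast
  have "cubic_zero p x"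
  proof (rule cubic_zero_limit)
    show "(\<lambda>j. P (r j) v \<beta>) \<longlonglongrightarrow> p v \<beta>" if "\<beta> \<in> mindices2" for v \<beta>
      using LIMSEQ_subseq_LIMSEQ[OF lim[OF that] r(1)] by (simp add: o_def)
  qed (use r(2) zero in auto)
  with r show thesis by (rule that)
qed

text \<open>If no zero of the nearby systems came close to \<open>\<xi>\<close>, then the multiplication operator of a
  polynomial taking the value 1 at \<open>\<xi>\<close> and 0 at the other zeros would have small eigenvalues only,
  whereas its characteristic polynomial tends to one that vanishes at 1.\<close>

lemma cubic_zero_persists:
  fixes P :: "nat \<Rightarrow> 'v::finite \<Rightarrow> ('v \<Rightarrow> nat) \<Rightarrow> complex"
  assumes lim: "\<And>v \<beta>. \<beta> \<in> mindices2 \<Longrightarrow> (\<lambda>j. P j v \<beta>) \<longlonglongrightarrow> p v \<beta>"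
    and zero: "cubic_zero p \<xi>" and r: "0 < r"
  shows "\<exists>j x. cubic_zero (P j) x \<and> dist x \<xi> < r"
proof (rule ccontr)
  assume "\<not> ?thesis"
  then have far: "r \<le> dist x \<xi>" if "cubic_zero (P j) x" for j x using that not_less by blast
  define n where "n = card (box3 :: ('v \<Rightarrow> nat) set)"
  obtain L where L: "factor_val L \<xi> = 1" "\<And>x. cubic_zero p x \<Longrightarrow> x \<noteq> \<xi> \<Longrightarrow> factor_val L x = 0"
  proof (rule separating_factors[of "{x. cubic_zero p x} - {\<xi>}" \<xi>])
    show "finite ({x. cubic_zero p x} - {\<xi>})" using finite_cubic_zeros by blast
  qed auto
  have "\<forall>\<^sub>F j in sequentially. \<forall>x. cubic_zero (P j) x \<longrightarrow> cmod (factor_val L x) \<le> 1 / 2"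
  \<comment> \<open>Otherwise zeros with \<open>factor_val\<close> of modulus above 1/2 accumulate,
    by boundedness, at a zero at distance at least \<open>r\<close> from \<xi>, where
    \<open>factor_val L\<close> vanishes.\<close>
  proof (rule ccontr)
    assume "\<not> ?thesis"
    then have "\<exists>\<^sub>F j in sequentially. \<exists>x. cubic_zero (P j) x \<and> 1 / 2 < cmod (factor_val L x)"
      by (simp add: not_eventually not_le)
    then have "infinite {j. \<exists>x. cubic_zero (P j) x \<and> 1 / 2 < cmod (factor_val L x)}"
      by (simp add: frequently_sequentially infinite_nat_iff_unbounded_le)
    from infinite_enumerate[OF this] obtain s :: "nat \<Rightarrow> nat" where s: "strict_mono s"
        "\<forall>j. s j \<in> {j. \<exists>x. cubic_zero (P j) x \<and> 1 / 2 < cmod (factor_val L x)}" by blast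
    then have "\<forall>j. \<exists>x. cubic_zero (P (s j)) x \<and> 1 / 2 < cmod (factor_val L x)" by simp
    then obtain X where X: "\<And>j. cubic_zero (P (s j)) (X j)" "\<And>j. 1 / 2 < cmod (factor_val L (X j))"
      by metis
    have lim': "(\<lambda>j. P (s j) v \<beta>) \<longlonglongrightarrow> p v \<beta>" if "\<beta> \<in> mindices2" for v \<beta>
      using LIMSEQ_subseq_LIMSEQ[OF lim[OF that] s(1)] by (simp add: o_def)
    obtain q x where q: "(X \<circ> q) \<longlonglongrightarrow> x" "cubic_zero p x"
      by (rule cubic_zero_sequence[of "\<lambda>j. P (s j)" p X, OF lim' X(1)])
    have "r \<le> dist x \<xi>"
      by (rule tendsto_lowerbound[OF tendsto_dist[OF q(1) tendsto_const]]) (auto intro!: always_eventually far[OF X(1)])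
    then have "factor_val L x = 0" using r by (intro L(2) q(2)) auto
    moreover have "(\<lambda>j. factor_val L (X (q j))) \<longlonglongrightarrow> factor_val L x"
      using continuous_on_tendsto_compose[OF continuous_factor_val q(1)] by simp
    then have "1 / 2 \<le> cmod (factor_val L x)"
      by (intro tendsto_lowerbound[OF tendsto_norm]) (use X(2) in \<open>auto intro!: always_eventually less_imp_le\<close>)
    ultimately show False by simp
  qed
  then have "\<forall>\<^sub>F j in sequentially. (1 / 2) ^ n \<le> cmod (poly (char_poly (factor_mat (P j) L)) 1)"
    unfolding n_def by eventually_elim (intro norm_char_poly_ge[OF factor_mat_carrier], auto simp: eigenvalue_factor_mat)
  moreover have "(\<lambda>j. poly (char_poly (factor_mat (P j) L)) 1) \<longlonglongrightarrow> poly (char_poly (factor_mat p L)) 1"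
    by (rule tendsto_char_poly[OF factor_mat_carrier factor_mat_carrier])
      (auto simp: factor_mat_def intro!: tendsto_factor_op tendsto_extend lim)
  ultimately have "(1 / 2) ^ n \<le> cmod (poly (char_poly (factor_mat p L)) 1)"
    by (intro tendsto_lowerbound[OF tendsto_norm]) auto
  moreover have "poly (char_poly (factor_mat p L)) 1 = 0"
    using zero L(1) eigenvalue_factor_mat[of p L 1] eigenvalue_root_char_poly[OF factor_mat_carrier, of p L 1]
    by blast
  moreover have "0 < (1 / 2 :: real) ^ n" by simp
  ultimately show False by simp
qed

lemma continuous_quad_eval: "continuous_on S (quad_eval p v)"
  unfolding quad_eval_def[abs_def] mmon_def by (intro continuous_intros)

lemma one_mem_of_relatively_clopen:
  assumes "closed T" "closed ({0..1} - T)" "0 \<in> T"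
  shows "(1 :: real) \<in> T"
proof (rule ccontr)
  assume "1 \<notin> T"
  then have "0 \<in> T \<inter> {0..1}" "1 \<in> ({0..1} - T) \<inter> {0..1}" using assms(3) by auto
  then have "\<not> connected {0..1 :: real}"
    using assms(1,2) unfolding connected_closed not_not
    by (intro exI[of _ T] exI[of _ "{0..1} - T"]) blast
  then show False by simp
qed

text \<open>The perturbation \<open>s (x\<^sub>v\<^sup>3 - \<gamma>\<^sub>v\<^sup>3)\<close> keeps the zero \<open>\<gamma>\<close> and, having higher degree than the system,
  makes the quotient algebra free on the monomials of \<open>box3\<close>. Zeros then persist along a segment of
  perturbations as long as none crosses the sphere around \<open>\<gamma>\<close>, and finally \<open>s\<close> tends to 0.\<close>

lemma isolated_zero_persists:
  fixes f g :: "'v::finite \<Rightarrow> ('v \<Rightarrow> nat) \<Rightarrow> complex"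
  assumes r: "0 < r" and zero: "\<And>v. quad_eval f v \<gamma> = 0"
    and iso: "\<And>x. dist x \<gamma> \<le> r \<Longrightarrow> (\<And>v. quad_eval f v x = 0) \<Longrightarrow> x = \<gamma>"
  obtains \<rho> where "0 < \<rho>"
    and "\<And>\<epsilon>. cmod \<epsilon> < \<rho> \<Longrightarrow> \<exists>x. dist x \<gamma> \<le> r \<and> (\<forall>v. quad_eval f v x + \<epsilon> * quad_eval g v x = 0)"
proof -
  define K where "K v x = x $ v ^ 3 - \<gamma> $ v ^ 3" for v and x :: "complex^'v"
  define \<Phi> where "\<Phi> x = (\<Sum>v\<in>UNIV. cmod (quad_eval f v x))" for x
  define \<Gamma> where "\<Gamma> x = (\<Sum>v\<in>UNIV. cmod (quad_eval g v x))" for x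
  define \<Theta> where "\<Theta> x = (\<Sum>v\<in>UNIV. cmod (K v x))" for x
  have contK: "continuous_on S (K v)" for S v
    unfolding K_def by (intro continuous_intros)
  have cont: "continuous_on S \<Phi>" "continuous_on S \<Gamma>" "continuous_on S \<Theta>" for S
    unfolding \<Phi>_def \<Gamma>_def \<Theta>_def
    by (intro continuous_intros continuous_quad_eval contK)+
  have "0 \<notin> \<Phi> ` sphere \<gamma> r"
  proof
    assume "0 \<in> \<Phi> ` sphere \<gamma> r"
    then obtain x where "x \<in> sphere \<gamma> r" "\<Phi> x = 0" by auto
    then have x: "dist x \<gamma> = r" "\<Phi> x = 0" by (simp_all add: dist_commute)
    then have "quad_eval f v x = 0" for v by (simp add: \<Phi>_def sum_nonneg_eq_0_iff)
    with iso x(1) r show False by force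
  qed
  moreover have "closed (\<Phi> ` sphere \<gamma> r)"
    by (intro compact_imp_closed compact_continuous_image cont compact_sphere)
  ultimately obtain \<delta> where \<delta>: "0 < \<delta>" "\<And>x. dist x \<gamma> = r \<Longrightarrow> \<delta> \<le> \<bar>\<Phi> x\<bar>"
    using separate_point_closed[of "\<Phi> ` sphere \<gamma> r" 0] by (auto simp: dist_commute)
  have "bounded (\<Gamma> ` sphere \<gamma> r)" "bounded (\<Theta> ` sphere \<gamma> r)"
    by (intro compact_imp_bounded compact_continuous_image cont compact_sphere)+
  then obtain B1 B2 where B: "0 < B1" "\<And>x. dist x \<gamma> = r \<Longrightarrow> \<bar>\<Gamma> x\<bar> \<le> B1"
      "0 < B2" "\<And>x. dist x \<gamma> = r \<Longrightarrow> \<bar>\<Theta> x\<bar> \<le> B2"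
    unfolding bounded_pos by (auto simp: dist_commute)
  \<comment> \<open>For \<epsilon> and \<open>s\<close> of modulus below this value, the two
    perturbing terms together stay below the lower bound \<delta> of \<open>\<Phi>\<close> on the
    sphere. It depends on neither \<epsilon> nor \<open>s\<close>, so \<open>s\<close> can tend to 0
    while \<epsilon> is fixed.\<close>
  define \<rho> where "\<rho> = \<delta> / (B1 + B2)"
  have \<rho>: "0 < \<rho>" using \<delta> B by (simp add: \<rho>_def)
  have sphere: "dist x \<gamma> \<noteq> r"
    if "cmod \<epsilon> < \<rho>" "cmod s < \<rho>" "\<And>v. quad_eval f v x + \<epsilon> * quad_eval g v x + s * K v x = 0" for \<epsilon> s x
  proof
    assume x: "dist x \<gamma> = r"
    have "cmod (quad_eval f v x) \<le> cmod \<epsilon> * cmod (quad_eval g v x) + cmod s * cmod (K v x)" for v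
    proof -
      have "quad_eval f v x = - (\<epsilon> * quad_eval g v x + s * K v x)"
        using that(3)[of v] by (simp only: eq_neg_iff_add_eq_0 add.assoc)
      then show ?thesis by (metis norm_minus_cancel norm_mult norm_triangle_ineq)
    qed
    then have "\<Phi> x \<le> cmod \<epsilon> * \<Gamma> x + cmod s * \<Theta> x"
      unfolding \<Phi>_def \<Gamma>_def \<Theta>_def sum_distrib_left sum.distrib[symmetric] by (intro sum_mono)
    moreover have "cmod \<epsilon> * \<Gamma> x \<le> cmod \<epsilon> * B1" "cmod s * \<Theta> x \<le> cmod s * B2"
      using B(2,4)[OF x] by (auto intro!: mult_left_mono)
    moreover have "cmod \<epsilon> * B1 < \<rho> * B1" "cmod s * B2 < \<rho> * B2"
      using that(1,2) B(1,3) by simp_all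
    moreover have "B1 + B2 \<noteq> 0" using B(1,3) by linarith
    then have "\<rho> * B1 + \<rho> * B2 = \<delta>" by (simp add: \<rho>_def add_divide_distrib[symmetric] distrib_left[symmetric])
    moreover have "0 \<le> \<Phi> x" unfolding \<Phi>_def by (intro sum_nonneg) auto
    ultimately show False using \<delta>(2)[OF x] by linarith
  qed
  have cubic: "\<exists>x. dist x \<gamma> \<le> r \<and> (\<forall>v. quad_eval f v x + \<epsilon> * quad_eval g v x + of_real s * K v x = 0)"
    if \<epsilon>: "cmod \<epsilon> < \<rho>" and s: "0 < s" "s < \<rho>" for \<epsilon> s
  proof -
    define H where "H t v x = quad_eval f v x + of_real t * \<epsilon> * quad_eval g v x + of_real s * K v x"
      for t :: real and v x
    \<comment> \<open>Solving \<open>H t v x = 0\<close> for \<open>x_v^3\<close> gives the cubic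
      normal form. This divides by \<open>s\<close>, which is why \<open>s\<close> stays positive
      until the final limit.\<close>
    define P where "P t v \<beta> = (if \<beta> = (\<lambda>_. 0) then \<gamma> $ v ^ 3 else 0)
      - (f v \<beta> + of_real t * \<epsilon> * g v \<beta>) / of_real s" for t :: real and v \<beta>
    define T where "T = {t \<in> {0..1}. \<exists>x \<in> cball \<gamma> r. \<forall>v. H t v x = 0}"
    have zero_in: "(\<lambda>_. 0) \<in> (mindices2 :: ('v \<Rightarrow> nat) set)" by (simp add: mindices2_def mdeg_def)
    have P_eval: "of_real s * (x $ v ^ 3 - quad_eval (P t) v x) = H t v x" for t v x
    proof -
      have "quad_eval (P t) v x = (\<Sum>\<beta>\<in>mindices2. if \<beta> = (\<lambda>_. 0) then \<gamma> $ v ^ 3 * mmon x \<beta> else 0)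
          - (\<Sum>\<beta>\<in>mindices2. (f v \<beta> + of_real t * \<epsilon> * g v \<beta>) / of_real s * mmon x \<beta>)"
        unfolding quad_eval_def P_def sum_subtractf[symmetric]
        by (intro sum.cong) (auto simp: left_diff_distrib)
      also have "\<dots> = \<gamma> $ v ^ 3 - (quad_eval f v x + of_real t * \<epsilon> * quad_eval g v x) / of_real s"
        using zero_in
        by (simp add: quad_eval_def sum_distrib_left sum.distrib[symmetric] sum_divide_distrib algebra_simps)
      finally show ?thesis using s by (simp add: H_def K_def field_simps)
    qed
    have P_zero: "cubic_zero (P t) x \<longleftrightarrow> (\<forall>v. H t v x = 0)" for t x
      using s by (auto simp: cubic_zero_def P_eval[symmetric])
    have P_lim: "(\<lambda>j. P (X j) v \<beta>) \<longlonglongrightarrow> P t v \<beta>" if "X \<longlonglongrightarrow> t" for X t v \<beta>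
      unfolding P_def using that s by (intro tendsto_intros) auto
    have inside: "dist x \<gamma> < r" if "t \<in> {0..1}" "dist x \<gamma> \<le> r" "\<And>v. H t v x = 0" for t x
    proof -
      have "cmod (of_real t * \<epsilon>) \<le> 1 * cmod \<epsilon>"
        using that(1) unfolding norm_mult by (intro mult_right_mono) auto
      then have "dist x \<gamma> \<noteq> r"
        using \<epsilon> s that(3) by (intro sphere[of "of_real t * \<epsilon>" "of_real s"]) (auto simp: H_def)
      with that(2) show ?thesis by simp
    qed
    have "closed T"
      unfolding closed_sequential_limits
    proof (intro allI impI, elim conjE)
      fix X t assume X: "\<forall>j. X j \<in> T" "X \<longlonglongrightarrow> t"
      then have "\<forall>j. \<exists>x. x \<in> cball \<gamma> r \<and> (\<forall>v. H (X j) v x = 0)"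
        unfolding T_def by blast
      then obtain Y where Y: "\<And>j. Y j \<in> cball \<gamma> r" "\<And>j v. H (X j) v (Y j) = 0" by metis
      obtain q x where q: "(Y \<circ> q) \<longlonglongrightarrow> x" "cubic_zero (P t) x"
      proof (rule cubic_zero_sequence[of "\<lambda>j. P (X j)" "P t" Y])
        show "cubic_zero (P (X j)) (Y j)" for j using Y(2) by (simp add: P_zero)
      qed (use P_lim[OF X(2)] in auto)
      have "x \<in> cball \<gamma> r" by (rule closed_sequentially[OF closed_cball _ q(1)]) (use Y(1) in \<open>simp del: mem_cball\<close>)
      moreover have "t \<in> {0..1}"
        by (rule closed_sequentially[OF _ _ X(2)]) (use X(1) in \<open>auto simp: T_def\<close>)
      ultimately show "t \<in> T" using q(2) by (auto simp: T_def P_zero)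
    qed
    \<comment> \<open>If the limit \<open>t\<close> were in \<open>T\<close>, its zero would lie
      strictly inside the ball by \<open>inside\<close>, and by \<open>cubic_zero_persists\<close>
      some system \<open>P (X j)\<close> would have a zero in the ball as well.\<close>
    moreover have "closed ({0..1} - T)"
      unfolding closed_sequential_limits
    proof (intro allI impI, elim conjE)
      fix X t assume X: "\<forall>j. X j \<in> {0..1} - T" "X \<longlonglongrightarrow> t"
      have t: "t \<in> {0..1}"
        by (rule closed_sequentially[OF _ _ X(2)]) (use X(1) in auto)
      have "t \<notin> T"
      proof
        assume "t \<in> T"
        then obtain x where "x \<in> cball \<gamma> r" "\<forall>v. H t v x = 0" unfolding T_def by blast
        then have x: "dist x \<gamma> \<le> r" "\<And>v. H t v x = 0" by (simp_all add: dist_commute)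
        then have less: "dist x \<gamma> < r" by (intro inside[OF t])
        have "\<exists>j y. cubic_zero (P (X j)) y \<and> dist y x < r - dist x \<gamma>"
          by (rule cubic_zero_persists[of "\<lambda>j. P (X j)" "P t"])
            (use P_lim[OF X(2)] x(2) less in \<open>auto simp: P_zero\<close>)
        then obtain j y where y: "cubic_zero (P (X j)) y" "dist y x < r - dist x \<gamma>" by blast
        then have "dist y \<gamma> \<le> r" using dist_triangle[of y \<gamma> x] by linarith
        then have "X j \<in> T" using y(1) X(1) by (auto simp: T_def P_zero dist_commute)
        with X(1) show False by auto
      qed
      with t show "t \<in> {0..1} - T" by simp
    qed
    moreover have "0 \<in> T"
      using r zero by (auto simp: T_def H_def K_def intro!: bexI[of _ \<gamma>])
    ultimately have "1 \<in> T" by (rule one_mem_of_relatively_clopen)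
    then obtain x where "x \<in> cball \<gamma> r" "\<forall>v. H 1 v x = 0" unfolding T_def by blast
    then show ?thesis by (intro exI[of _ x]) (simp add: H_def dist_commute)
  qed
  show thesis
  proof (rule that[OF \<rho>])
    fix \<epsilon> assume \<epsilon>: "cmod \<epsilon> < \<rho>"
    \<comment> \<open>The index \<open>j + 1\<close> makes the factor at most 1/2, so
      \<open>s j < \<rho>\<close> holds already for \<open>j = 0\<close>.\<close>
    define s where "s j = \<rho> * inverse (real (Suc (j + 1)))" for j
    have "inverse (real (Suc (j + 1))) < 1" for j
      using one_less_inverse_iff[of "real (Suc (j + 1))"] by (simp add: inverse_less_1_iff)
    then have s: "0 < s j" "s j < \<rho>" for j using \<rho> by (auto simp: s_def)
    have "(\<lambda>j. inverse (real (Suc (j + 1)))) \<longlonglongrightarrow> 0"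
      by (rule LIMSEQ_ignore_initial_segment[OF LIMSEQ_inverse_real_of_nat])
    from tendsto_mult[OF tendsto_const[of \<rho>] this] have "s \<longlonglongrightarrow> 0" by (simp add: s_def[abs_def])
    have "\<forall>j. \<exists>x. x \<in> cball \<gamma> r \<and>
        (\<forall>v. quad_eval f v x + \<epsilon> * quad_eval g v x + of_real (s j) * K v x = 0)"
      using cubic[OF \<epsilon> s] by (auto simp: dist_commute)
    then obtain Y where Y: "\<And>j. Y j \<in> cball \<gamma> r"
        "\<And>j v. quad_eval f v (Y j) + \<epsilon> * quad_eval g v (Y j) + of_real (s j) * K v (Y j) = 0" by metis
    obtain x q where q: "x \<in> cball \<gamma> r" "strict_mono q" "(Y \<circ> q) \<longlonglongrightarrow> x"
      using compact_cball[of \<gamma> r] Y(1) unfolding compact_def by metis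
    have "quad_eval f v x + \<epsilon> * quad_eval g v x = 0" for v
    proof -
      have ev: "(\<lambda>j. h (Y (q j))) \<longlonglongrightarrow> h x" if "continuous_on UNIV h" for h :: "complex^'v \<Rightarrow> complex"
        using continuous_on_tendsto_compose[OF that q(3)] by simp
      have "(\<lambda>j. s (q j)) \<longlonglongrightarrow> 0" using LIMSEQ_subseq_LIMSEQ[OF \<open>s \<longlonglongrightarrow> 0\<close> q(2)] by (simp add: o_def)
      then have "(\<lambda>j. quad_eval f v (Y (q j)) + \<epsilon> * quad_eval g v (Y (q j)) + of_real (s (q j)) * K v (Y (q j)))
          \<longlonglongrightarrow> quad_eval f v x + \<epsilon> * quad_eval g v x + of_real 0 * K v x"
        by (intro tendsto_intros ev continuous_quad_eval contK)
      then show ?thesis unfolding Y(2) using LIMSEQ_unique[OF tendsto_const] by fastforce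
    qed
    then show "\<exists>x. dist x \<gamma> \<le> r \<and> (\<forall>v. quad_eval f v x + \<epsilon> * quad_eval g v x = 0)"
      using q(1) by (auto simp: dist_commute)
  qed
qed

section \<open>Isolated zeros of bilinear integer systems\<close>

text \<open>\<open>None\<close> is the homogenising coordinate with value 1; it turns a bilinear
  polynomial with affine terms into a bilinear form.\<close>

definition aff :: "complex^'v::finite \<Rightarrow> 'v option \<Rightarrow> complex" where
  "aff x i = (case i of None \<Rightarrow> 1 | Some v \<Rightarrow> x $ v)"

lemma aff_simps [simp]: "aff x None = 1" "aff x (Some v) = x $ v"
  by (simp_all add: aff_def)

definition bilinear_eval ::
  "'v set \<Rightarrow> 'v set \<Rightarrow> ('v option \<Rightarrow> 'v option \<Rightarrow> complex) \<Rightarrow> complex^'v::finite \<Rightarrow> complex" where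
  "bilinear_eval I J d x =
    (\<Sum>i\<in>insert None (Some ` I). \<Sum>j\<in>insert None (Some ` J). d i j * (aff x i * aff x j))"

lemma bilinear_eval_eq_quad_eval:
  fixes d :: "'v::finite \<Rightarrow> 'v option \<Rightarrow> 'v option \<Rightarrow> complex"
  obtains f where "\<And>v x. quad_eval f v x = bilinear_eval I J (d v) x"
proof
  define idx :: "'v option \<Rightarrow> 'v option \<Rightarrow> 'v \<Rightarrow> nat" where
    "idx i j = (\<lambda>u. (if i = Some u then 1 else 0) + (if j = Some u then 1 else 0))" for i j
  define T where "T = insert None (Some ` I) \<times> insert None (Some ` J)"
  \<comment> \<open>Different pairs \<open>(i, j)\<close> may have the same monomial, so the
    coefficient at \<beta> collects all of them.\<close>
  let ?f = "\<lambda>v \<beta>. \<Sum>(i, j)\<in>T. if idx i j = \<beta> then d v i j else 0"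
  have mon: "mmon x (idx i j) = aff x i * aff x j" for x i j
    unfolding idx_def mmon_add
    by (cases i; cases j) (auto simp: mmon_def aff_def if_distrib[of "\<lambda>n. _ ^ n"] cong: if_cong)
  have deg: "idx i j \<in> mindices2" for i j
    unfolding idx_def mindices2_def mem_Collect_eq mdeg_add
    by (cases i; cases j) (auto simp: mdeg_def)
  fix v x
  have "quad_eval ?f v x = (\<Sum>\<beta>\<in>mindices2. \<Sum>(i, j)\<in>T. if idx i j = \<beta> then d v i j * mmon x \<beta> else 0)"
    unfolding quad_eval_def sum_distrib_right by (intro sum.cong refl) (auto split: prod.split)
  also have "\<dots> = (\<Sum>(i, j)\<in>T. \<Sum>\<beta>\<in>mindices2. if idx i j = \<beta> then d v i j * mmon x \<beta> else 0)"
    by (subst sum.swap) (simp add: case_prod_unfold)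
  also have "\<dots> = (\<Sum>(i, j)\<in>T. d v i j * (aff x i * aff x j))"
    using deg by (intro sum.cong) (auto simp: mon)
  also have "\<dots> = bilinear_eval I J (d v) x"
    unfolding bilinear_eval_def T_def by (rule sum.cartesian_product[symmetric])
  finally show "quad_eval ?f v x = bilinear_eval I J (d v) x" .
qed

text \<open>Integrality enters through nonzero coefficients having modulus at least 1, which
  replaces division by the leading coefficient.\<close>

lemma cauchy_root_bound:
  fixes q :: "complex poly"
  assumes "q \<noteq> 0" "poly q z = 0" and H: "\<And>i. cmod (coeff q i) \<le> H" "1 \<le> H"
    and int: "\<And>i. coeff q i \<noteq> 0 \<Longrightarrow> 1 \<le> cmod (coeff q i)"
  shows "cmod z \<le> 2 * H"
proof (cases "cmod z \<le> 1")
  case False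
  then have z: "1 < cmod z" by simp
  define n where "n = degree q"
  have "coeff q n * z ^ n = - (\<Sum>i<n. coeff q i * z ^ i)"
    using assms(2) unfolding poly_altdef n_def[symmetric]
    by (simp add: lessThan_Suc_atMost[symmetric] eq_neg_iff_add_eq_0 add.commute)
  moreover have "1 \<le> cmod (coeff q n)" using assms(1) by (intro int) (simp add: n_def)
  then have "cmod z ^ n \<le> cmod (coeff q n * z ^ n)"
    by (simp add: norm_mult norm_power mult_le_cancel_right1)
  ultimately have "cmod z ^ n \<le> cmod (\<Sum>i<n. coeff q i * z ^ i)" by simp
  also have "\<dots> \<le> (\<Sum>i<n. H * cmod z ^ i)"
    by (intro sum_norm_le) (auto simp: norm_mult norm_power intro!: mult_right_mono H)
  also have "\<dots> = H * ((cmod z ^ n - 1) / (cmod z - 1))"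
    using z by (simp add: sum_distrib_left[symmetric] geometric_sum)
  finally have "cmod z ^ n * (cmod z - 1) \<le> H * (cmod z ^ n - 1)"
    using z by (simp add: field_simps)
  also have "\<dots> \<le> H * cmod z ^ n" using H(2) by simp
  finally have "(cmod z - 1) * cmod z ^ n \<le> H * cmod z ^ n" by (simp add: mult.commute)
  moreover have "0 < cmod z ^ n" using z by (intro zero_less_power) linarith
  ultimately have "cmod z - 1 \<le> H" by (simp add: mult_le_cancel_right)
  then show ?thesis using H(2) by simp
qed (use H(2) in simp)

text \<open>The lower bound is the upper bound for the reflected polynomial: it has the root
  \<open>1/z\<close>, and its coefficients occur among those of \<open>p\<close>.\<close>

lemma integer_poly_root_bounds:
  fixes p :: "int poly" and H :: real
  assumes "p \<noteq> 0" and root: "poly (map_poly of_int p) (z::complex) = 0" and "z \<noteq> 0"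
    and H: "\<And>i. \<bar>real_of_int (coeff p i)\<bar> \<le> H"
  shows "cmod z \<le> 2 * H" "inverse (2 * H) \<le> cmod z"
proof -
  define q where "q = map_poly (of_int :: int \<Rightarrow> complex) p"
  have cq: "coeff q i = of_int (coeff p i)" for i by (simp add: q_def)
  have q0: "q \<noteq> 0" using assms(1) by (simp add: q_def)
  have int: "1 \<le> cmod (coeff q i)" if "coeff q i \<noteq> 0" for i
    using that by (simp add: cq norm_of_int)
  have up: "cmod (coeff q i) \<le> H" for i using H[of i] by (simp add: cq)
  obtain i where "coeff q i \<noteq> 0" using q0 by (metis leading_coeff_0_iff)
  then have H1: "1 \<le> H" using int up order_trans by blast
  show "cmod z \<le> 2 * H"
    using root by (intro cauchy_root_bound[OF q0 _ up H1 int]) (simp add: q_def)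
  have "cmod (inverse z) \<le> 2 * H"
  proof (rule cauchy_root_bound[of "reflect_poly q"])
    show "poly (reflect_poly q) (inverse z) = 0"
      using root assms(3) by (simp add: poly_reflect_poly_nz q_def)
    show "cmod (coeff (reflect_poly q) i) \<le> H" for i
      using up[of "degree q - i"] H1 by (auto simp: coeff_reflect_poly)
    show "1 \<le> cmod (coeff (reflect_poly q) i)" if "coeff (reflect_poly q) i \<noteq> 0" for i
      using that int by (auto simp: coeff_reflect_poly split: if_splits)
  qed (use q0 H1 in auto)
  then have "inverse (2 * H) \<le> inverse (cmod (inverse z))"
    using assms(3) by (intro le_imp_inverse_le) auto
  then show "inverse (2 * H) \<le> cmod z" by (simp add: norm_inverse)
qed

lemma eval_bipoly_altdef:
  "eval_bipoly R \<epsilon> t = (\<Sum>i\<le>degree R. poly (map_poly of_int (coeff R i)) t * \<epsilon> ^ i)"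
proof -
  define q where "q = map_poly (\<lambda>p. poly (map_poly of_int p) t) R"
  have "degree q \<le> degree R" unfolding q_def by (rule degree_map_poly_le)
  then have "eval_bipoly R \<epsilon> t = (\<Sum>i\<le>degree R. coeff q i * \<epsilon> ^ i)"
    unfolding eval_bipoly_def q_def[symmetric] poly_altdef[of q]
    by (intro sum.mono_neutral_left) (auto simp: coeff_eq_0)
  then show ?thesis by (simp add: q_def coeff_map_poly)
qed

text \<open>As \<open>E l\<close> is nonzero, the power of \<epsilon> dividing \<open>R\<close> can
  be cancelled before the limit is taken; the quotient at \<open>\<epsilon> = 0\<close> is the
  lowest nonzero coefficient of \<open>R\<close>.\<close>

lemma eval_bipoly_lowest_coeff:
  assumes R: "R \<noteq> 0" and \<epsilon>: "E \<longlonglongrightarrow> 0" "\<And>l. E l \<noteq> 0" and t: "X \<longlonglongrightarrow> t"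
    and zero: "\<And>l. eval_bipoly R (E l) (X l) = 0"
  obtains i where "coeff R i \<noteq> 0" "poly (map_poly of_int (coeff R i)) t = 0"
proof -
  obtain q where q: "R = [:- 0, 1:] ^ order 0 R * q" "\<not> [:- 0, 1:] dvd q"
    using order_decomp[OF R] by blast
  define n where "n = order 0 R"
  have Rq: "R = monom 1 n * q" using q(1) by (simp add: n_def monom_altdef)
  have "coeff q 0 \<noteq> 0" using q(2) by (simp add: dvd_iff_poly_eq_0 poly_0_coeff_0)
  moreover have "coeff R n = coeff q 0" unfolding Rq by (simp add: coeff_monom_mult)
  ultimately have ne: "coeff R n \<noteq> 0" by simp
  have "eval_bipoly q (E l) (X l) = 0" for l
  proof -
    interpret h: comm_ring_hom "\<lambda>R. eval_bipoly R (E l) (X l)" by (rule comm_ring_hom_eval_bipoly)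
    have "eval_bipoly R (E l) (X l) = E l ^ n * eval_bipoly q (E l) (X l)"
      by (simp add: q(1)[folded n_def] h.hom_mult h.hom_power eval_bipoly_X)
    with zero[of l] \<epsilon>(2)[of l] show ?thesis by simp
  qed
  moreover have "(\<lambda>l. eval_bipoly q (E l) (X l)) \<longlonglongrightarrow> eval_bipoly q 0 t"
    unfolding eval_bipoly_altdef by (intro tendsto_intros \<epsilon>(1) t)
  ultimately have "eval_bipoly q 0 t = 0" by (simp add: LIMSEQ_const_iff)
  moreover have "eval_bipoly q 0 t = poly (map_poly of_int (coeff q 0)) t"
    unfolding eval_bipoly_altdef
    by (subst sum.mono_neutral_right[of _ "{0}"]) auto
  ultimately have "poly (map_poly of_int (coeff R n)) t = 0"
    using \<open>coeff R n = coeff q 0\<close> by simp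
  with ne show thesis by (rule that)
qed


lemma isolated_zero_sequence:
  fixes f g :: "'v::finite \<Rightarrow> ('v \<Rightarrow> nat) \<Rightarrow> complex"
  assumes "\<gamma> isolated_in {x. \<forall>v. quad_eval f v x = 0}"
  obtains X E where "X \<longlonglongrightarrow> \<gamma>" "E \<longlonglongrightarrow> 0" "\<And>l::nat. E l \<noteq> 0"
    "\<And>l v. quad_eval f v (X l) + E l * quad_eval g v (X l) = 0"
proof -
  let ?Z = "{x. \<forall>v. quad_eval f v x = 0}"
  obtain T where T: "open T" "T \<inter> ?Z = {\<gamma>}" and \<gamma>: "\<gamma> \<in> ?Z"
    using assms unfolding isolated_in_def by blast
  have "\<gamma> \<in> T" using T(2) by blast
  then obtain r where r: "0 < r" "ball \<gamma> r \<subseteq> T" using T(1) openE by blast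
  have iso: "x = \<gamma>" if "dist x \<gamma> < r" "\<And>v. quad_eval f v x = 0" for x
    using that r(2) T(2) by (auto simp: dist_commute subset_iff)
  have "\<exists>x \<epsilon>. dist x \<gamma> \<le> d \<and> \<epsilon> \<noteq> 0 \<and> cmod \<epsilon> \<le> d \<and> (\<forall>v. quad_eval f v x + \<epsilon> * quad_eval g v x = 0)"
    if d: "0 < d" "d < r" for d
  proof -
    obtain \<rho> where \<rho>: "0 < \<rho>" "\<And>\<epsilon>. cmod \<epsilon> < \<rho> \<Longrightarrow>
        \<exists>x. dist x \<gamma> \<le> d \<and> (\<forall>v. quad_eval f v x + \<epsilon> * quad_eval g v x = 0)"
      by (rule isolated_zero_persists[of d f \<gamma> g]) (use d \<gamma> iso in auto)
    \<comment> \<open>Bounded by \<open>d\<close>, so that \<epsilon> tends to 0 together with the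
      radius, and positive, so that powers of \<epsilon> can be cancelled later.\<close>
    define \<epsilon> where "\<epsilon> = min d (\<rho> / 2)"
    have \<epsilon>: "0 < \<epsilon>" "\<epsilon> \<le> d" "\<epsilon> < \<rho>" using d \<rho>(1) by (auto simp: \<epsilon>_def min_def)
    then obtain x where "dist x \<gamma> \<le> d" "\<forall>v. quad_eval f v x + of_real \<epsilon> * quad_eval g v x = 0"
      using \<rho>(2)[of "of_real \<epsilon>"] by auto
    with \<epsilon> show ?thesis by (intro exI[of _ x] exI[of _ "of_real \<epsilon>"]) auto
  qed
  then have ex: "0 < d \<Longrightarrow> d < r \<Longrightarrow> \<exists>x \<epsilon>. dist x \<gamma> \<le> d \<and> \<epsilon> \<noteq> 0 \<and> cmod \<epsilon> \<le> d \<and>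
      (\<forall>v. quad_eval f v x + \<epsilon> * quad_eval g v x = 0)" for d .
  define s where "s l = r * inverse (real (Suc (l + 1)))" for l
  have "inverse (real (Suc (l + 1))) < 1" for l by (simp add: inverse_less_1_iff)
  then have s: "0 < s l" "s l < r" for l using r(1) by (auto simp: s_def)
  have "(\<lambda>l. inverse (real (Suc (l + 1)))) \<longlonglongrightarrow> 0"
    by (rule LIMSEQ_ignore_initial_segment[OF LIMSEQ_inverse_real_of_nat])
  from tendsto_mult[OF tendsto_const[of r] this] have s0: "s \<longlonglongrightarrow> 0" by (simp add: s_def[abs_def])
  have "\<forall>l. \<exists>p. dist (fst p) \<gamma> \<le> s l \<and> snd p \<noteq> 0 \<and> cmod (snd p) \<le> s l \<and>
      (\<forall>v. quad_eval f v (fst p) + snd p * quad_eval g v (fst p) = 0)"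
    using ex[OF s] by simp
  then obtain p where p: "\<And>l. dist (fst (p l)) \<gamma> \<le> s l" "\<And>l. snd (p l) \<noteq> 0" "\<And>l. cmod (snd (p l)) \<le> s l"
      "\<And>l v. quad_eval f v (fst (p l)) + snd (p l) * quad_eval g v (fst (p l)) = 0" by metis
  show thesis
  proof (rule that[of "\<lambda>l. fst (p l)" "\<lambda>l. snd (p l)"])
    show "(\<lambda>l. fst (p l)) \<longlonglongrightarrow> \<gamma>"
      by (rule metric_tendsto_imp_tendsto[OF s0]) (use p(1) s in \<open>auto simp: less_imp_le\<close>)
    show "(\<lambda>l. snd (p l)) \<longlonglongrightarrow> 0"
      by (rule metric_tendsto_imp_tendsto[OF s0]) (use p(3) s in \<open>auto simp: less_imp_le\<close>)
  qed (use p in auto)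
qed

lemma poly_of_int_linear:
  "poly (map_poly of_int [:a, b:]) (t::complex) = of_int a + t * of_int b"
  by (simp add: of_int_hom.map_poly_pCons_hom)

lemma sum_reindex_bij_betw2:
  assumes "bij_betw p A K" "bij_betw u B J"
  shows "(\<Sum>j\<in>A. \<Sum>r\<in>B. h (p j) (u r)) = (\<Sum>i\<in>K. \<Sum>j\<in>J. h i j)"
  using sum.reindex_bij_betw[OF assms(1), of "\<lambda>i. \<Sum>j\<in>J. h i j"]
  by (simp add: sum.reindex_bij_betw[OF assms(2)])

text \<open>Fixing the unknown \<open>k\<close> merges the coordinate \<open>Some k\<close> into the
  homogenising one, so \<open>K\<close> has \<open>card I\<close> elements, as the square matrix
  requires. The constant \<Lambda> allows \<open>B\<close> for each of the
  \<open>(card I + 1) * (card J + 1)\<close> coefficients and 1 for a perturbation at each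
  place.\<close>

lemma bilinear_isolated_zero_bounds:
  fixes c :: "'v::finite \<Rightarrow> 'v option \<Rightarrow> 'v option \<Rightarrow> int" and B :: real
  assumes disj: "I \<inter> J = {}" and cover: "I \<union> J = UNIV" and k: "k \<in> I"
    and B: "\<And>v i j. \<bar>real_of_int (c v i j)\<bar> \<le> B"
    and iso: "\<gamma> isolated_in {x. \<forall>v. bilinear_eval I J (\<lambda>i j. of_int (c v i j)) x = 0}"
    and nz: "\<gamma> $ k \<noteq> 0"
  defines "\<Lambda> \<equiv> (real (card I) + 1) * (real (card J) + 1) * (B + 1)"
  shows "cmod (\<gamma> $ k) \<le> 2 * \<Lambda> ^ sylvester_size (card I) (card J)"
    and "inverse (2 * \<Lambda> ^ sylvester_size (card I) (card J)) \<le> cmod (\<gamma> $ k)"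
proof -
  define a b where "a = card I" and "b = card J"
  define I0 J0 K where "I0 = insert None (Some ` I)" and "J0 = insert None (Some ` J)"
    and "K = I0 - {Some k}"
  have fin: "finite I0" "finite J0" "finite K" by (auto simp: I0_def J0_def K_def)
  have cI0: "card I0 = Suc a" "card J0 = Suc b"
    by (auto simp: I0_def J0_def a_def b_def card_image)
  have kI0: "Some k \<in> I0" using k by (simp add: I0_def)
  have cK: "card K = a" unfolding K_def using kI0 cI0 fin by simp
  have cV: "CARD('v) = a + b"
    using card_Un_disjoint[of I J] disj cover by (simp add: a_def b_def)
  obtain p where p: "bij_betw p {..<a} K"
    using ex_bij_betw_nat_finite[OF fin(3)] by (auto simp: cK atLeast0LessThan)
  obtain u where u: "bij_betw u {..b} J0"
    using ex_bij_betw_nat_finite[OF fin(2)] by (auto simp: cI0 atLeast0LessThan lessThan_Suc_atMost)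
  obtain \<eta> where \<eta>: "bij_betw \<eta> {..<a + b} (UNIV :: 'v set)"
    using ex_bij_betw_nat_finite[OF finite_class.finite_UNIV[where 'a = 'v]]
    by (auto simp: cV atLeast0LessThan)
  define pi ui \<eta>i where "pi = inv_into {..<a} p" and "ui = inv_into {..b} u"
    and "\<eta>i = inv_into {..<a + b} \<eta>"
  have pi: "pi (p j) = j" if "j < a" for j
    unfolding pi_def using p that by (intro inv_into_f_f) (auto simp: bij_betw_def)
  have ui: "ui (u r) = r" if "r \<le> b" for r
    unfolding ui_def using u that by (intro inv_into_f_f) (auto simp: bij_betw_def)
  have \<eta>i: "\<eta>i (\<eta> e) = e" if "e < a + b" for e
    unfolding \<eta>i_def using \<eta> that by (intro inv_into_f_f) (auto simp: bij_betw_def)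
  have NoneK: "None \<in> K" by (simp add: K_def I0_def)
  have NoneJ0: "None \<in> J0" by (simp add: J0_def)
  note sumI0 = sum.remove[OF fin(1) kI0, folded K_def]
  note sumNone = sum.delta[OF fin(3), where a = None, unfolded if_P[OF NoneK]]

  \<comment> \<open>The forms \<open>G_e\<close> transported to the original unknowns along the
    enumerations; \<open>Some k\<close> is left out because it has become part of the
    coefficients.\<close>
  define d :: "'v \<Rightarrow> 'v option \<Rightarrow> 'v option \<Rightarrow> complex" where
    "d v i j = (if i \<noteq> Some k \<and> pi i + ui j = \<eta>i v then 1 else 0)" for v i j
  obtain f where f: "\<And>v x. quad_eval f v x = bilinear_eval I J (\<lambda>i j. of_int (c v i j)) x"
    using bilinear_eval_eq_quad_eval[of I J "\<lambda>v i j. of_int (c v i j)"] by blast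
  obtain g where g: "\<And>v x. quad_eval g v x = bilinear_eval I J (d v) x"
    using bilinear_eval_eq_quad_eval[of I J d] by blast
  obtain X E where XE: "X \<longlonglongrightarrow> \<gamma>" "E \<longlonglongrightarrow> 0" "\<And>l::nat. E l \<noteq> 0"
      "\<And>l v. quad_eval f v (X l) + E l * quad_eval g v (X l) = 0"
    using isolated_zero_sequence[of \<gamma> f g] iso unfolding f by blast

  \<comment> \<open>Coefficients as polynomials in t: the coordinate \<open>Some k\<close>
    contributes t times its coefficient to that of \<open>None\<close>.\<close>
  define C where "C e j r = [:c (\<eta> e) (p j) (u r), if p j = None then c (\<eta> e) (Some k) (u r) else 0:]" for e j r
  let ?nrm = "poly_norm (\<lambda>x::int. \<bar>real_of_int x\<bar>)"
  have bound: "(\<Sum>j<a. \<Sum>r\<le>b. ?nrm (C e j r) + (if j + r = e then 1 else 0)) \<le> \<Lambda>" for e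
  proof -
    have nrm: "?nrm (C e j r) \<le> \<bar>real_of_int (c (\<eta> e) (p j) (u r))\<bar>
        + (if p j = None then \<bar>real_of_int (c (\<eta> e) (Some k) (u r))\<bar> else 0)" for j r
      by (auto simp: C_def poly_norm_def)
    have "(\<Sum>j<a. \<Sum>r\<le>b. ?nrm (C e j r) + (if j + r = e then 1 else 0))
        \<le> (\<Sum>j<a. \<Sum>r\<le>b. (\<bar>real_of_int (c (\<eta> e) (p j) (u r))\<bar>
          + (if p j = None then \<bar>real_of_int (c (\<eta> e) (Some k) (u r))\<bar> else 0)) + 1)"
      by (intro sum_mono add_mono nrm) auto
    also have "\<dots> = (\<Sum>i\<in>K. \<Sum>j\<in>J0. (\<bar>real_of_int (c (\<eta> e) i j)\<bar>
          + (if i = None then \<bar>real_of_int (c (\<eta> e) (Some k) j)\<bar> else 0)) + 1)"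
      by (rule sum_reindex_bij_betw2[OF p u, of "\<lambda>i j. (\<bar>real_of_int (c (\<eta> e) i j)\<bar>
          + (if i = None then \<bar>real_of_int (c (\<eta> e) (Some k) j)\<bar> else 0)) + 1"])
    also have "\<dots> = (\<Sum>i\<in>K. \<Sum>j\<in>J0. \<bar>real_of_int (c (\<eta> e) i j)\<bar>)
          + (\<Sum>i\<in>K. if i = None then (\<Sum>j\<in>J0. \<bar>real_of_int (c (\<eta> e) (Some k) j)\<bar>) else 0) + real a * (real b + 1)"
    proof -
      have "(\<Sum>i\<in>K. \<Sum>j\<in>J0. if i = None then \<bar>real_of_int (c (\<eta> e) (Some k) j)\<bar> else 0)
          = (\<Sum>i\<in>K. if i = None then (\<Sum>j\<in>J0. \<bar>real_of_int (c (\<eta> e) (Some k) j)\<bar>) else 0)"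
        by (intro sum.cong) auto
      then show ?thesis by (simp only: sum.distrib) (simp add: cK cI0)
    qed
    also have "\<dots> = (\<Sum>i\<in>I0. \<Sum>j\<in>J0. \<bar>real_of_int (c (\<eta> e) i j)\<bar>) + real a * (real b + 1)"
      unfolding sumNone sumI0 by simp
    also have "\<dots> \<le> (\<Sum>i\<in>I0. \<Sum>j\<in>J0. B) + (real a + 1) * (real b + 1)"
      by (intro add_mono sum_mono B mult_right_mono) auto
    also have "\<dots> = \<Lambda>" by (simp add: cI0 \<Lambda>_def a_def b_def algebra_simps)
    finally show ?thesis .
  qed
  obtain R :: "int poly poly" where R: "R \<noteq> 0"
      "\<And>i k. \<bar>real_of_int (coeff (coeff R i) k)\<bar> \<le> \<Lambda> ^ sylvester_size a b"
      "\<forall>\<epsilon> t x u. (\<exists>j<a. x j \<noteq> 0) \<longrightarrow> (\<exists>r\<le>b. u r \<noteq> 0) \<longrightarrow>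
      (\<forall>e<a + b. (\<Sum>j<a. \<Sum>r\<le>b.
          (poly (map_poly of_int (C e j r)) t + (if j + r = e then \<epsilon> else 0)) * (x j * u r)) = 0) \<longrightarrow>
      eval_bipoly R \<epsilon> t = 0"
    by (rule hidden_variable_resultant[OF bound]) (rule that)
  have "eval_bipoly R \<epsilon> (x $ k) = 0"
    if zero: "\<And>v. quad_eval f v x + \<epsilon> * quad_eval g v x = 0" for \<epsilon> x
  proof (rule R(3)[rule_format, of "\<lambda>j. aff x (p j)" "\<lambda>r. aff x (u r)"])
    \<comment> \<open>The homogenising coordinates have value 1, so neither group of homogeneous
      variables vanishes.\<close>
    have "None \<in> p ` {..<a}" "None \<in> u ` {..b}"
      using bij_betw_imp_surj_on[OF p] bij_betw_imp_surj_on[OF u] NoneK NoneJ0 by auto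
    then obtain j r where "j < a" "None = p j" "r \<le> b" "None = u r" by auto
    then show "\<exists>j<a. aff x (p j) \<noteq> 0" "\<exists>r\<le>b. aff x (u r) \<noteq> 0"
      by (metis aff_simps(1) zero_neq_one)+
  next
    fix e assume e: "e < a + b"
    let ?c = "\<lambda>i j. of_int (c (\<eta> e) i j) :: complex"
    have "(\<Sum>j<a. \<Sum>r\<le>b. (poly (map_poly of_int (C e j r)) (x $ k) + (if j + r = e then \<epsilon> else 0))
          * (aff x (p j) * aff x (u r)))
        = (\<Sum>j<a. \<Sum>r\<le>b. (?c (p j) (u r) + (if p j = None then x $ k * ?c (Some k) (u r) else 0)
            + \<epsilon> * d (\<eta> e) (p j) (u r)) * (aff x (p j) * aff x (u r)))"
    proof (intro sum.cong refl arg_cong2[of _ _ _ _ "(*)"])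
      fix j r assume j: "j \<in> {..<a}" and r: "r \<in> {..b}"
      then have "p j \<in> K" using bij_betw_apply[OF p] by blast
      then have "p j \<noteq> Some k" by (simp add: K_def)
      then have "d (\<eta> e) (p j) (u r) = (if j + r = e then 1 else 0)"
        using j r e by (simp add: d_def pi ui \<eta>i)
      then show "poly (map_poly of_int (C e j r)) (x $ k) + (if j + r = e then \<epsilon> else 0)
          = ?c (p j) (u r) + (if p j = None then x $ k * ?c (Some k) (u r) else 0) + \<epsilon> * d (\<eta> e) (p j) (u r)"
        unfolding C_def poly_of_int_linear by simp
    qed
    also have "\<dots> = (\<Sum>i\<in>K. \<Sum>j\<in>J0. (?c i j + (if i = None then x $ k * ?c (Some k) j else 0)
            + \<epsilon> * d (\<eta> e) i j) * (aff x i * aff x j))"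
      by (rule sum_reindex_bij_betw2[OF p u, of "\<lambda>i j. (?c i j + (if i = None then x $ k * ?c (Some k) j else 0)
            + \<epsilon> * d (\<eta> e) i j) * (aff x i * aff x j)"])
    also have "\<dots> = (\<Sum>i\<in>K. \<Sum>j\<in>J0. ?c i j * (aff x i * aff x j))
        + (\<Sum>i\<in>K. if i = None then (\<Sum>j\<in>J0. ?c (Some k) j * (x $ k * aff x j)) else 0)
        + \<epsilon> * (\<Sum>i\<in>K. \<Sum>j\<in>J0. d (\<eta> e) i j * (aff x i * aff x j))"
      unfolding sum_distrib_left sum.distrib[symmetric]
      by (intro sum.cong refl) (auto simp: sum.distrib[symmetric] algebra_simps intro!: sum.cong)
    also have "\<dots> = (\<Sum>i\<in>I0. \<Sum>j\<in>J0. ?c i j * (aff x i * aff x j))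
        + \<epsilon> * (\<Sum>i\<in>I0. \<Sum>j\<in>J0. d (\<eta> e) i j * (aff x i * aff x j))"
      unfolding sumNone sumI0 by (simp add: d_def)
    also have "\<dots> = 0"
      using zero[of "\<eta> e"] unfolding f g bilinear_eval_def I0_def[symmetric] J0_def[symmetric] .
    finally show "(\<Sum>j<a. \<Sum>r\<le>b. (poly (map_poly of_int (C e j r)) (x $ k) + (if j + r = e then \<epsilon> else 0))
          * (aff x (p j) * aff x (u r))) = 0" .
  qed
  then have "eval_bipoly R (E l) (X l $ k) = 0" for l using XE(4) by blast
  moreover have "(\<lambda>l. X l $ k) \<longlonglongrightarrow> \<gamma> $ k" using XE(1) by (intro tendsto_intros)
  ultimately obtain i where i: "coeff R i \<noteq> 0" "poly (map_poly of_int (coeff R i)) (\<gamma> $ k) = 0"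
    using eval_bipoly_lowest_coeff[OF R(1) XE(2,3)] by metis
  show "cmod (\<gamma> $ k) \<le> 2 * \<Lambda> ^ sylvester_size (card I) (card J)"
    "inverse (2 * \<Lambda> ^ sylvester_size (card I) (card J)) \<le> cmod (\<gamma> $ k)"
    using integer_poly_root_bounds[OF i nz, of "\<Lambda> ^ sylvester_size a b"] R(2)
    by (simp_all add: a_def b_def)
qed

section \<open>From polynomials to arrays of bilinear coefficients\<close>

lemma eval_poly_superset:
  assumes "finite A" "Poly_Mapping.keys f \<subseteq> A"
  shows "eval_poly f x =
    (\<Sum>t\<in>A. Poly_Mapping.lookup f t * (\<Prod>v\<in>UNIV. x $ v ^ Poly_Mapping.lookup t v))"
  unfolding Defs.eval_poly_def using assms
  by (intro sum.mono_neutral_left) (auto simp: in_keys_iff)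

lemma eval_poly_zero [simp]: "eval_poly 0 x = 0"
  by (simp add: Defs.eval_poly_def)

lemma eval_poly_add: "eval_poly (f + g) x = eval_poly f x + eval_poly g x"
  and eval_poly_diff: "eval_poly (f - g) x = eval_poly f x - eval_poly g x"
proof -
  let ?A = "Poly_Mapping.keys f \<union> Poly_Mapping.keys g"
  have "eval_poly f x = (\<Sum>t\<in>?A. Poly_Mapping.lookup f t * (\<Prod>v\<in>UNIV. x $ v ^ Poly_Mapping.lookup t v))"
    "eval_poly g x = (\<Sum>t\<in>?A. Poly_Mapping.lookup g t * (\<Prod>v\<in>UNIV. x $ v ^ Poly_Mapping.lookup t v))"
    by (rule eval_poly_superset; simp)+
  moreover have "eval_poly (f + g) x = (\<Sum>t\<in>?A. Poly_Mapping.lookup (f + g) t * (\<Prod>v\<in>UNIV. x $ v ^ Poly_Mapping.lookup t v))"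
    by (rule eval_poly_superset) (use Poly_Mapping.keys_add[of f g] in auto)
  moreover have "eval_poly (f - g) x = (\<Sum>t\<in>?A. Poly_Mapping.lookup (f - g) t * (\<Prod>v\<in>UNIV. x $ v ^ Poly_Mapping.lookup t v))"
    by (rule eval_poly_superset) (use keys_diff[of f g] in auto)
  ultimately show "eval_poly (f + g) x = eval_poly f x + eval_poly g x"
    "eval_poly (f - g) x = eval_poly f x - eval_poly g x"
    by (simp_all add: lookup_add lookup_minus distrib_right left_diff_distrib sum.distrib sum_subtractf)
qed

lemma eval_poly_of_int_mult: "eval_poly (of_int c * f) x = of_int c * eval_poly f x"
proof (induction c rule: int_induct[where k = 0])
  case (step1 i)
  then show ?case by (simp add: distrib_right eval_poly_add)
next
  case (step2 i)
  then show ?case by (simp add: left_diff_distrib eval_poly_diff)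
qed simp

lemma eval_poly_sum: "eval_poly (sum f A) x = (\<Sum>a\<in>A. eval_poly (f a) x)"
  by (induction A rule: infinite_finite_induct) (auto simp: eval_poly_add)

lemma eval_poly_var: "eval_poly (var_poly v) x = x $ v"
  by (simp add: Defs.eval_poly_def var_poly_def lookup_single when_def if_distrib[of "\<lambda>n. _ ^ n"] cong: if_cong)

lemma eval_poly_const: "eval_poly (const_poly c) x = c"
  by (simp add: Defs.eval_poly_def const_poly_def)

definition omon :: "'v option \<Rightarrow> 'v \<Rightarrow>\<^sub>0 nat" where
  "omon i = (case i of None \<Rightarrow> 0 | Some v \<Rightarrow> Poly_Mapping.single v 1)"

definition bimons :: "'v set \<Rightarrow> 'v set \<Rightarrow> ('v \<Rightarrow>\<^sub>0 nat) set" where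
  "bimons I J = (\<lambda>(i, j). omon i + omon j) ` (insert None (Some ` I) \<times> insert None (Some ` J))"

lemma lookup_omon: "Poly_Mapping.lookup (omon i) v = (if i = Some v then 1 else 0)"
  by (cases i) (auto simp: omon_def lookup_single when_def)

text \<open>With disjoint groups a monomial shows which factor comes from which group, so each
  bilinear coefficient can be read off the polynomial.\<close>

lemma inj_on_omon_add:
  assumes "I \<inter> J = {}"
  shows "inj_on (\<lambda>(i, j). omon i + omon j) (insert None (Some ` I) \<times> insert None (Some ` J))"
proof (rule inj_onI, clarify)
  fix i j i' j'
  assume I: "i \<in> insert None (Some ` I)" "i' \<in> insert None (Some ` I)"
    and J: "j \<in> insert None (Some ` J)" "j' \<in> insert None (Some ` J)"
    and "omon i + omon j = omon i' + omon j'"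
  then have eq: "Poly_Mapping.lookup (omon i + omon j) v = Poly_Mapping.lookup (omon i' + omon j') v" for v
    by simp
  have iff: "i = Some v \<longleftrightarrow> i' = Some v" "j = Some v \<longleftrightarrow> j' = Some v" for v
    using eq[of v] I J assms by (auto simp: lookup_add lookup_omon split: if_splits)
  show "i = i' \<and> j = j'"
  proof
    show "i = i'"
      using iff(1)[of "the i"] iff(1)[of "the i'"] by (cases i; cases i') simp_all
    show "j = j'"
      using iff(2)[of "the j"] iff(2)[of "the j'"] by (cases j; cases j') simp_all
  qed
qed

lemma eval_poly_bilinear:
  fixes f :: "'v::finite cpoly"
  assumes "I \<inter> J = {}" "Poly_Mapping.keys f \<subseteq> bimons I J"
  shows "eval_poly f x = bilinear_eval I J (\<lambda>i j. Poly_Mapping.lookup f (omon i + omon j)) x"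
proof -
  have mon: "(\<Prod>v\<in>UNIV. x $ v ^ Poly_Mapping.lookup (omon i + omon j) v) = aff x i * aff x j" for i j
    unfolding lookup_add power_add prod.distrib lookup_omon
    by (cases i; cases j) (auto simp: if_distrib[of "\<lambda>n. _ ^ n"] cong: if_cong)
  have "eval_poly f x = (\<Sum>t\<in>bimons I J. Poly_Mapping.lookup f t * (\<Prod>v\<in>UNIV. x $ v ^ Poly_Mapping.lookup t v))"
    by (rule eval_poly_superset[OF _ assms(2)]) (simp add: bimons_def)
  also have "\<dots> = (\<Sum>(i, j)\<in>insert None (Some ` I) \<times> insert None (Some ` J).
      Poly_Mapping.lookup f (omon i + omon j) * (aff x i * aff x j))"
    unfolding bimons_def
    by (subst sum.reindex[OF inj_on_omon_add[OF assms(1)]]) (simp only: o_def case_prod_unfold mon)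
  also have "\<dots> = bilinear_eval I J (\<lambda>i j. Poly_Mapping.lookup f (omon i + omon j)) x"
    unfolding bilinear_eval_def by (rule sum.cartesian_product[symmetric])
  finally show ?thesis .
qed

lemma bilinear_eval_swap: "bilinear_eval I J d x = bilinear_eval J I (\<lambda>j i. d i j) x"
  unfolding bilinear_eval_def by (subst sum.swap) (intro sum.cong refl, simp only: mult_ac)

definition bipoly :: "'v set \<Rightarrow> 'v set \<Rightarrow> 'v cpoly \<Rightarrow> bool" where
  "bipoly I J f \<longleftrightarrow> Poly_Mapping.keys f \<subseteq> bimons I J"

lemma bipoly_0 [intro]: "bipoly I J 0"
  by (simp add: bipoly_def)

lemma bipoly_add [intro]: "bipoly I J f \<Longrightarrow> bipoly I J g \<Longrightarrow> bipoly I J (f + g)"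
  using Poly_Mapping.keys_add[of f g] by (auto simp: bipoly_def)

lemma bipoly_diff [intro]: "bipoly I J f \<Longrightarrow> bipoly I J g \<Longrightarrow> bipoly I J (f - g)"
  using keys_diff[of f g] by (auto simp: bipoly_def)

lemma bipoly_sum [intro]: "(\<And>a. a \<in> A \<Longrightarrow> bipoly I J (f a)) \<Longrightarrow> bipoly I J (sum f A)"
  by (induction A rule: infinite_finite_induct) auto

lemma bipoly_of_int_mult [intro]:
  assumes "bipoly I J f"
  shows "bipoly I J (of_int c * f)"
proof (induction c rule: int_induct[where k = 0])
  case (step1 i)
  with assms show ?case by (simp add: distrib_right bipoly_add)
next
  case (step2 i)
  with assms show ?case by (simp add: left_diff_distrib bipoly_diff)
qed auto

lemma omon_add_in_bimons:
  "i \<in> insert None (Some ` I) \<Longrightarrow> j \<in> insert None (Some ` J) \<Longrightarrow> omon i + omon j \<in> bimons I J"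
  unfolding bimons_def by (rule image_eqI[of _ _ "(i, j)"]) (simp, (rule SigmaI; assumption))

lemma bipoly_const: "bipoly I J (const_poly c)"
  using omon_add_in_bimons[of None I None J]
  by (simp add: bipoly_def const_poly_def omon_def)

lemma bipoly_const_mult:
  assumes "bipoly I J f"
  shows "bipoly I J (const_poly c * f)"
proof -
  have "Poly_Mapping.keys (const_poly c * f) \<subseteq> Poly_Mapping.keys f"
    using Poly_Mapping.keys_mult[of "const_poly c" f] by (auto simp: const_poly_def split: if_splits)
  with assms show ?thesis by (auto simp: bipoly_def)
qed

lemma bipoly_var: "v \<in> I \<union> J \<Longrightarrow> bipoly I J (var_poly v)"
  using omon_add_in_bimons[of "Some v" I None J] omon_add_in_bimons[of None I "Some v" J]
  by (auto simp: bipoly_def var_poly_def omon_def)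

lemma bipoly_var_mult: "v \<in> I \<Longrightarrow> w \<in> J \<Longrightarrow> bipoly I J (var_poly v * var_poly w)"
  using omon_add_in_bimons[of "Some v" I "Some w" J]
  by (simp add: bipoly_def var_poly_def mult_single omon_def)

text \<open>Primal equations involve \<open>X\<close> alone and dual ones \<open>S\<close> and
  \<open>y\<close> alone, both affinely; complementarity pairs one entry of \<open>X\<close> with
  one of \<open>S\<close>.\<close>

lemma bipoly_kkt_poly:
  "bipoly (range Var_X) (range Var_S \<union> range Var_y) (kkt_poly \<A> \<beta> \<C> e)"
proof (cases e)
  case (Primal_eq j)
  then show ?thesis
    by (auto simp: inner_mat_def trace_def matrix_matrix_mult_def map_matrix_def poly_X_def real_poly_def
        intro!: bipoly_diff bipoly_sum bipoly_const bipoly_const_mult bipoly_var)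
next
  case (Dual_eq u)
  \<comment> \<open>Whichever orientation \<open>SOME\<close> picks, the entry is a variable of the
    second group.\<close>
  obtain p q where "sym_entry poly_S u = (poly_S :: (('a, 'b) kkt_var cpoly)^'a^'a) $ p $ q"
    unfolding sym_entry_def by (cases "SOME (p, q). u = Upair p q") auto
  then have "bipoly (range Var_X) (range Var_S \<union> range Var_y) (sym_entry poly_S u :: ('a, 'b) kkt_var cpoly)"
    by (simp add: poly_S_def bipoly_var)
  moreover have "bipoly (range Var_X) (range Var_S \<union> range Var_y) (var_poly (Var_y j) * real_poly a)" for j a
    by (subst mult.commute) (auto simp: real_poly_def intro!: bipoly_const_mult bipoly_var)
  ultimately show ?thesis
    by (auto simp: Dual_eq real_poly_def intro!: bipoly_diff bipoly_add bipoly_sum bipoly_const)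
next
  case (Compl_eq p q)
  then show ?thesis
    by (auto simp: matrix_matrix_mult_def poly_X_def poly_S_def intro!: bipoly_sum bipoly_var_mult)
qed

text \<open>The estimate \<open>k + 1 \<le> 2^k\<close> turns the two dimension factors into
  \<open>2^N\<close>, and \<open>2^\<tau> + 1 \<le> 2^(\<tau> + 1)\<close>. The power then has
  exponent at most \<open>(\<tau> + N + 1) * N * 2^(N-1)\<close>, and the leading factor 2 is
  absorbed by the summand \<open>2^N\<close> of the target.\<close>

lemma resultant_bound_le_powr:
  fixes a b N :: nat and \<tau> :: real
  assumes "a + b = N" "0 \<le> \<tau>"
  shows "2 * ((real a + 1) * (real b + 1) * (2 powr \<tau> + 1)) ^ sylvester_size a b
    \<le> 2 powr (((real N)\<^sup>2 - real N) / 2 + 2 ^ N + real N * (\<tau> + real N + 2) * 2 ^ (N - 1))"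
proof -
  let ?\<Lambda> = "(real a + 1) * (real b + 1) * (2 powr \<tau> + 1)"
  have pow: "real k + 1 \<le> 2 powr real k" for k
  proof -
    have "k + 1 \<le> 2 ^ k" using less_exp[of k] by (simp add: Suc_le_eq)
    then have "real (k + 1) \<le> real (2 ^ k)" by (rule of_nat_mono)
    then show ?thesis by (simp add: powr_realpow)
  qed
  have one: "1 \<le> 2 powr \<tau>" using assms(2) by (simp add: ge_one_powr_ge_zero)
  have "?\<Lambda> \<le> 2 powr real a * 2 powr real b * (2 powr \<tau> * 2)"
    by (intro mult_mono pow) (use one in auto)
  also have "\<dots> = 2 powr (\<tau> + real N + 1)"
  proof -
    have "real N = real a + real b" using assms(1) by auto
    then show ?thesis by (simp add: powr_add)
  qed
  finally have le: "?\<Lambda> \<le> 2 powr (\<tau> + real N + 1)" .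
  have "?\<Lambda> ^ sylvester_size a b \<le> (2 powr (\<tau> + real N + 1)) ^ sylvester_size a b"
    by (intro power_mono le) auto
  also have "\<dots> = 2 powr ((\<tau> + real N + 1) * real (sylvester_size a b))"
    by (simp add: powr_powr[symmetric] powr_realpow)
  also have "\<dots> \<le> 2 powr ((\<tau> + real N + 1) * real (N * 2 ^ (N - 1)))"
    using sylvester_size_le[of a b] assms
    by (intro powr_mono mult_left_mono of_nat_mono) auto
  finally have "2 * ?\<Lambda> ^ sylvester_size a b \<le> 2 powr (1 + (\<tau> + real N + 1) * (real N * 2 ^ (N - 1)))"
    by (simp add: powr_add)
  also have "\<dots> \<le> 2 powr (((real N)\<^sup>2 - real N) / 2 + 2 ^ N + real N * (\<tau> + real N + 2) * 2 ^ (N - 1))"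
  proof (rule powr_mono)
    have "real N \<le> (real N)\<^sup>2" by (cases N) (auto simp: power2_eq_square)
    moreover have "(1::real) \<le> 2 ^ N" by simp
    moreover have "(\<tau> + real N + 1) * (real N * 2 ^ (N - 1)) \<le> real N * (\<tau> + real N + 2) * 2 ^ (N - 1)"
      by (simp add: algebra_simps)
    ultimately show "1 + (\<tau> + real N + 1) * (real N * 2 ^ (N - 1))
        \<le> ((real N)\<^sup>2 - real N) / 2 + 2 ^ N + real N * (\<tau> + real N + 2) * 2 ^ (N - 1)" by argo
  qed simp
  finally show ?thesis .
qed

lemma bipoly_system_isolated_zero_bounds:
  fixes F :: "'v::finite \<Rightarrow> 'v cpoly" and \<tau> :: real
  assumes disj: "I \<inter> J = {}" and cover: "I \<union> J = UNIV" and bi: "\<And>v. bipoly I J (F v)"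
    and int: "\<And>v t. Poly_Mapping.lookup (F v) t \<in> \<int>"
    and le: "\<And>v t. cmod (Poly_Mapping.lookup (F v) t) \<le> 2 powr \<tau>" and \<tau>: "0 \<le> \<tau>"
    and iso: "\<gamma> isolated_in zeros (range F)" and nz: "\<gamma> $ k \<noteq> 0"
  defines "\<eta> \<equiv> ((real CARD('v))\<^sup>2 - real CARD('v)) / 2 + 2 ^ CARD('v)
      + real CARD('v) * (\<tau> + real CARD('v) + 2) * 2 ^ (CARD('v) - 1)"
  shows "2 powr (- \<eta>) \<le> cmod (\<gamma> $ k)" "cmod (\<gamma> $ k) \<le> 2 powr \<eta>"
proof -
  define c where "c v i j = \<lfloor>Re (Poly_Mapping.lookup (F v) (omon i + omon j))\<rfloor>" for v i j
  have c: "of_int (c v i j) = Poly_Mapping.lookup (F v) (omon i + omon j)" for v i j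
    using int[of v "omon i + omon j"] by (auto simp: c_def elim!: Ints_cases)
  have B: "\<bar>real_of_int (c v i j)\<bar> \<le> 2 powr \<tau>" for v i j
    using le[of v "omon i + omon j"] by (simp add: c[symmetric])
  have ev: "eval_poly (F v) x = bilinear_eval I J (\<lambda>i j. of_int (c v i j)) x" for v x
    unfolding c using bi[of v] by (intro eval_poly_bilinear disj) (simp add: bipoly_def)
  have Z: "zeros (range F) = {x. \<forall>v. bilinear_eval I J (\<lambda>i j. of_int (c v i j)) x = 0}"
    "zeros (range F) = {x. \<forall>v. bilinear_eval J I (\<lambda>i j. of_int (c v j i)) x = 0}"
    by (auto simp: zeros_def ev bilinear_eval_swap[of J I])
  have card: "card I + card J = CARD('v)"
    using card_Un_disjoint[of I J] disj cover by simp
  obtain a b where ab: "a + b = CARD('v)" and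
    "cmod (\<gamma> $ k) \<le> 2 * ((real a + 1) * (real b + 1) * (2 powr \<tau> + 1)) ^ sylvester_size a b"
    "inverse (2 * ((real a + 1) * (real b + 1) * (2 powr \<tau> + 1)) ^ sylvester_size a b) \<le> cmod (\<gamma> $ k)"
  proof (cases "k \<in> I")
    case True
    show thesis
      by (rule that[OF card]) (rule bilinear_isolated_zero_bounds[OF disj cover True B iso[unfolded Z(1)] nz])+
  next
    \<comment> \<open>The fixed unknown must belong to the first group, so for \<open>k\<close> in
      \<open>J\<close> the groups trade places; the final estimate depends on their sizes only
      through the sum.\<close>
    case False
    then have "k \<in> J" using cover by auto
    have disj': "J \<inter> I = {}" and cover': "J \<union> I = UNIV" and card': "card J + card I = CARD('v)"
      using disj cover card by auto
    show thesis
      by (rule that[OF card'])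
        (rule bilinear_isolated_zero_bounds[OF disj' cover' \<open>k \<in> J\<close> B iso[unfolded Z(2)] nz])+
  qed
  moreover note bd = resultant_bound_le_powr[OF ab \<tau>, folded \<eta>_def]
  moreover have "2 powr (- \<eta>) \<le> inverse (2 * ((real a + 1) * (real b + 1) * (2 powr \<tau> + 1)) ^ sylvester_size a b)"
    unfolding powr_minus
    by (rule le_imp_inverse_le[OF bd]) (intro mult_pos_pos zero_less_power add_nonneg_pos; simp)
  ultimately show "2 powr (- \<eta>) \<le> cmod (\<gamma> $ k)" "cmod (\<gamma> $ k) \<le> 2 powr \<eta>" by linarith+
qed

section \<open>Irreducible components and square systems\<close>

lemma zariski_closed_Int: "zariski_closed V \<Longrightarrow> zariski_closed W \<Longrightarrow> zariski_closed (V \<inter> W)"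
  unfolding zariski_closed_def
proof (elim exE)
  fix F G assume "V = zeros F" "W = zeros G"
  then show "\<exists>H. V \<inter> W = zeros H"
    by (intro exI[of _ "F \<union> G"]) (auto simp: zeros_def)
qed

lemma irreducible_variety_singleton: "irreducible_variety {x}"
proof -
  have "{x} = zeros (range (\<lambda>v. var_poly v - const_poly (x $ v)))"
    by (auto simp: zeros_def eval_poly_diff eval_poly_var eval_poly_const Finite_Cartesian_Product.vec_eq_iff)
  then have "zariski_closed {x}" by (auto simp: zariski_closed_def)
  then show ?thesis by (auto simp: irreducible_variety_def singleton_Un_iff)
qed

lemma irreducible_variety_subset_Un:
  assumes "irreducible_variety W" "zariski_closed V1" "zariski_closed V2" "W \<subseteq> V1 \<union> V2"
  shows "W \<subseteq> V1 \<or> W \<subseteq> V2"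
proof -
  have split: "\<And>A B. zariski_closed A \<Longrightarrow> zariski_closed B \<Longrightarrow> W = A \<union> B \<Longrightarrow> W = A \<or> W = B"
    and closed: "zariski_closed W"
    using assms(1) by (simp_all add: irreducible_variety_def)
  have "W = (W \<inter> V1) \<union> (W \<inter> V2)" using assms(4) by blast
  from split[OF zariski_closed_Int[OF closed assms(2)] zariski_closed_Int[OF closed assms(3)] this]
  show ?thesis by blast
qed

text \<open>Zorn's lemma for the irreducible closed subsets through \<open>x\<close>. A chain is
  bounded by the Zariski closure of its union; this is irreducible, since two members escaping
  different halves of a splitting would be comparable, and the larger would escape both.\<close>

lemma exists_irreducible_component:
  assumes "x \<in> zeros F"
  obtains W where "irreducible_component W (zeros F)" "x \<in> W"
proof -
  let ?A = "{W. irreducible_variety W \<and> x \<in> W \<and> W \<subseteq> zeros F}"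
  have "\<exists>M\<in>?A. \<forall>X\<in>?A. M \<subseteq> X \<longrightarrow> X = M"
  proof (rule subset_Zorn)
    fix C assume chain: "subset.chain ?A C"
    show "\<exists>U\<in>?A. \<forall>X\<in>C. X \<subseteq> U"
    proof (cases "C = {}")
      case True
      have "{x} \<in> ?A" using assms irreducible_variety_singleton by auto
      with True show ?thesis by blast
    next
      case False
      have C: "irreducible_variety W" "x \<in> W" "W \<subseteq> zeros F" if "W \<in> C" for W
        using chain that by (auto simp: subset_chain_def)
      define Z where "Z = zeros {f. \<forall>y\<in>\<Union>C. eval_poly f y = 0}"
      have CZ: "W \<subseteq> Z" if "W \<in> C" for W using that by (auto simp: Z_def zeros_def)
      have minimal: "Z \<subseteq> V" if V: "zariski_closed V" "\<Union>C \<subseteq> V" for V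
      proof -
        obtain G where "V = zeros G" using V(1) by (auto simp: zariski_closed_def)
        moreover from this have "G \<subseteq> {f. \<forall>y\<in>\<Union>C. eval_poly f y = 0}"
          using V(2) by (auto simp: zeros_def)
        ultimately show ?thesis by (auto simp: Z_def zeros_def)
      qed
      have "Z \<subseteq> zeros F" using C(3) by (intro minimal) (auto simp: zariski_closed_def)
      moreover have "x \<in> Z" using False CZ C(2) by blast
      moreover have "irreducible_variety Z"
        unfolding irreducible_variety_def
      proof (intro conjI allI impI, goal_cases)
        case 1
        show ?case by (auto simp: Z_def zariski_closed_def)
      next
        case 2
        show ?case using \<open>x \<in> Z\<close> by blast
      next
        case (3 V1 V2)
        then have V: "zariski_closed V1" "zariski_closed V2" "Z = V1 \<union> V2" by auto
        have sub: "W \<subseteq> V1 \<or> W \<subseteq> V2" if "W \<in> C" for W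
          using irreducible_variety_subset_Un[OF C(1)[OF that] V(1,2)] CZ[OF that] V(3) by simp
        have "\<Union>C \<subseteq> V1 \<or> \<Union>C \<subseteq> V2"
        proof (rule ccontr)
          assume "\<not> ?thesis"
          then obtain W1 W2 where "W1 \<in> C" "\<not> W1 \<subseteq> V1" "W2 \<in> C" "\<not> W2 \<subseteq> V2" by blast
          moreover from this have "W1 \<subseteq> W2 \<or> W2 \<subseteq> W1"
            using chain by (auto simp: subset_chain_def)
          ultimately show False using sub[of W1] sub[of W2] by blast
        qed
        then have "Z \<subseteq> V1 \<or> Z \<subseteq> V2" using minimal V(1,2) by blast
        with V(3) show ?case by blast
      qed
      ultimately show ?thesis using CZ by blast
    qed
  qed
  then obtain M where M: "M \<in> ?A" and max: "\<forall>X\<in>?A. M \<subseteq> X \<longrightarrow> X = M" by (rule bexE)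
  have "W = M" if "irreducible_variety W" "M \<subseteq> W" "W \<subseteq> zeros F" for W
  proof -
    have "W \<in> ?A" using M that by auto
    with max that(2) show ?thesis by simp
  qed
  with M have "irreducible_component M (zeros F)" "x \<in> M"
    unfolding irreducible_component_def by simp_all
  then show thesis by (rule that)
qed

lemma squared_up_zeros_subset:
  assumes "squared_up g \<tau> F"
  shows "zeros (range g) \<subseteq> zeros (range F)"
proof -
  obtain c :: "'b \<Rightarrow> 'a \<Rightarrow> int" where c: "\<And>v. F v = (\<Sum>e\<in>UNIV. of_int (c v e) * g e)"
    using assms unfolding squared_up_def by blast
  show ?thesis
    by (auto simp: zeros_def c eval_poly_sum eval_poly_of_int_mult)
qed

text \<open>An isolated zero \<open>\<gamma>\<close> of the original system need not be isolated for the square one a priori;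
  but zeros of the square system near \<open>\<gamma>\<close> lie on isolated components, so bounds pass to the limit.\<close>

lemma squared_up_isolated_zero_bound:
  assumes sq: "squared_up g \<tau> F" and iso: "\<gamma> isolated_in zeros (range g)"
    and bound: "\<And>x. x isolated_in zeros (range F) \<Longrightarrow> cmod (x $ k) \<le> B"
  shows "cmod (\<gamma> $ k) \<le> B"
proof (cases "\<gamma> isolated_in zeros (range F)")
  case False
  obtain T where T: "open T" "T \<inter> zeros (range g) = {\<gamma>}"
    using iso unfolding isolated_in_def by blast
  then have "\<gamma> \<in> T" by blast
  have \<gamma>: "\<gamma> \<in> zeros (range F)"
    using squared_up_zeros_subset[OF sq] T(2) by blast
  show ?thesis
  proof (rule field_le_epsilon)
    fix e :: real assume e: "0 < e"
    have "open (T \<inter> ball \<gamma> e)" using T(1) by auto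
    moreover have "\<gamma> \<in> T \<inter> ball \<gamma> e" using \<open>\<gamma> \<in> T\<close> e by simp
    ultimately obtain x where x: "x \<in> T \<inter> ball \<gamma> e" "x \<in> zeros (range F)" "x \<noteq> \<gamma>"
      using False \<gamma> unfolding isolated_in_def by blast
    then have xg: "x \<notin> zeros (range g)" using T(2) by blast
    obtain W where W: "irreducible_component W (zeros (range F))" "x \<in> W"
      by (rule exists_irreducible_component[OF x(2)])
    \<comment> \<open>As \<open>x\<close> is not a zero of \<open>g\<close>, its component must be
      of the other kind allowed by \<open>squared_up\<close>: an isolated point.\<close>
    have "\<not> irreducible_component W (zeros (range g))"
      using W(2) xg unfolding irreducible_component_def by blast
    then have "\<exists>y. W = {y} \<and> y isolated_in zeros (range F)"
      using sq W(1) unfolding squared_up_def by blast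
    then have "x isolated_in zeros (range F)" using W(2) by blast
    then have "cmod (x $ k) \<le> B" by (rule bound)
    moreover have "cmod ((\<gamma> - x) $ k) < e"
      using x(1) Finite_Cartesian_Product.norm_nth_le[of "\<gamma> - x" k] by (simp add: dist_norm)
    moreover have "cmod (\<gamma> $ k) \<le> cmod (x $ k) + cmod ((\<gamma> - x) $ k)"
      using norm_triangle_ineq[of "x $ k" "(\<gamma> - x) $ k"] by simp
    ultimately show "cmod (\<gamma> $ k) \<le> B + e" by linarith
  qed
qed (rule bound)

section \<open>The size of the bound\<close>

lemma Nbar_pos: "1 \<le> Nbar n m"
  by (simp add: Nbar_def mbar_def)

lemma pbar_pos: "1 \<le> pbar n m"
  by (simp add: pbar_def mbar_def)

lemma le_tau1: "\<tau> + real (Nbar n m) \<le> tau1 n m \<tau>"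
  using pbar_pos[of n m] by (simp add: tau1_def)

lemma mbar_le: "mbar n m \<le> (n + m + 1)\<^sup>2"
proof -
  have "n * (n + 1) div 2 \<le> n * (n + 1)" by simp
  then show ?thesis by (simp add: mbar_def power2_eq_square algebra_simps)
qed

lemma quadratic_le: "1 \<le> s \<Longrightarrow> 2 * s * (2 * s + 1) \<le> 6 * s\<^sup>2" for s :: nat
  using mult_le_mono1[of 1 s s] by (simp add: power2_eq_square algebra_simps)

lemma Nbar_le: "Nbar n m \<le> 7 * (n + m + 1)\<^sup>2"
proof -
  let ?s = "n + m + 1"
  have "nbar n m = 2 * ?s" by (simp add: nbar_def)
  then have "nbar n m * (nbar n m + 1) \<le> 6 * ?s\<^sup>2"
    using quadratic_le[of ?s] by simp
  then show ?thesis using mbar_le[of n m] unfolding Nbar_def by simp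
qed

lemma pbar_le: "pbar n m \<le> 11 * (n + m + 1)\<^sup>2"
proof -
  let ?s = "n + m + 1"
  have nb: "nbar n m = 2 * ?s" by (simp add: nbar_def)
  have "nbar n m * (nbar n m + 1) div 2 \<le> nbar n m * (nbar n m + 1)" by simp
  also have "\<dots> \<le> 6 * ?s\<^sup>2" using quadratic_le[of ?s] by (simp add: nb)
  finally have "nbar n m * (nbar n m + 1) div 2 \<le> 6 * ?s\<^sup>2" .
  moreover have "(nbar n m)\<^sup>2 = 4 * ?s\<^sup>2" by (simp only: nb power_mult_distrib) simp
  ultimately show ?thesis using mbar_le[of n m] unfolding pbar_def by linarith
qed

text \<open>The crude \<open>p \<le> 2^p\<close> is enough: the target exponent is linear in
  \<open>(n + m + 1)^2\<close> anyway.\<close>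

lemma log_pbar_le: "log 2 (real (pbar n m)) \<le> 11 * real ((n + m + 1)\<^sup>2)"
proof -
  have "pbar n m \<le> 2 ^ pbar n m" using less_exp[of "pbar n m"] by (rule less_imp_le)
  then have "real (pbar n m) \<le> real (2 ^ pbar n m)" by (rule of_nat_mono)
  then have "real (pbar n m) \<le> 2 powr real (pbar n m)" by (simp add: powr_realpow)
  then have "log 2 (real (pbar n m)) \<le> real (pbar n m)"
    using pbar_pos[of n m] by (subst log_le_iff) auto
  also have "\<dots> \<le> real (11 * (n + m + 1)\<^sup>2)" by (intro of_nat_mono pbar_le)
  finally show ?thesis by simp
qed

text \<open>Makes the logarithm of \<open>eta1 n m \<tau> / \<tau>\<close> nonnegative, so that an
  upper bound controls its absolute value.\<close>

lemma le_eta1: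
  assumes "1 \<le> \<tau>"
  shows "\<tau> \<le> eta1 n m \<tau>"
proof -
  define N where "N = Nbar n m"
  have N: "1 \<le> N" unfolding N_def by (rule Nbar_pos)
  have "\<tau> \<le> tau1 n m \<tau> + real N + 2" using le_tau1[of \<tau> n m] by (simp add: N_def)
  also have "\<dots> \<le> (tau1 n m \<tau> + real N + 2) * (real N * 2 ^ (N - 1))"
  proof -
    have "1 * 1 \<le> real N * 2 ^ (N - 1)" using N by (intro mult_mono) auto
    moreover have "0 \<le> tau1 n m \<tau> + real N + 2" using le_tau1[of \<tau> n m] assms by linarith
    ultimately show ?thesis by (simp add: mult_le_cancel_left1)
  qed
  also have "\<dots> \<le> eta1 n m \<tau>"
  proof -
    have "real N \<le> (real N)\<^sup>2" using N by (simp add: power2_eq_square)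
    then show ?thesis by (simp add: eta1_def N_def[symmetric] Let_def algebra_simps)
  qed
  finally show ?thesis .
qed

lemma eta1_le:
  assumes "1 \<le> \<tau>"
  shows "eta1 n m \<tau> \<le> \<tau> * 2 powr (17 * real ((n + m + 1)\<^sup>2))"
proof -
  define N S where "N = Nbar n m" and "S = (n + m + 1)\<^sup>2"
  define s where "s = real S"
  have s1: "1 \<le> s" by (simp add: s_def S_def)
  have NS: "N \<le> 7 * S" unfolding N_def S_def by (rule Nbar_le)
  then have "real N \<le> real (7 * S)" by (rule of_nat_mono)
  then have Ns: "real N \<le> 7 * s" by (simp add: s_def)
  \<comment> \<open>18 is 7 for \<open>N\<close> plus 11 for the logarithm; another 7 for
    \<open>N\<close> and 2 for the summand 2 give 27 below.\<close>
  have "tau1 n m \<tau> \<le> \<tau> + 18 * s"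
    using Ns log_pbar_le[of n m] by (simp add: tau1_def N_def s_def S_def)
  then have "tau1 n m \<tau> + real N + 2 \<le> \<tau> + 27 * s" using Ns s1 by linarith
  also have "\<dots> \<le> 28 * (\<tau> * s)"
  proof -
    have "\<tau> \<le> \<tau> * s" "s \<le> \<tau> * s" using assms s1 by (simp_all add: mult_le_cancel_left1 mult_le_cancel_right1)
    then show ?thesis by linarith
  qed
  finally have T: "tau1 n m \<tau> + real N + 2 \<le> 28 * (\<tau> * s)" .
  have ss: "1 \<le> \<tau> * s\<^sup>2"
    using mult_mono[of 1 \<tau> 1 "s\<^sup>2"] assms s1 by (simp add: one_le_power)
  have "((real N)\<^sup>2 - real N) / 2 \<le> (real N)\<^sup>2"
    using order_trans[of "(real N)\<^sup>2 - real N" "(real N)\<^sup>2" "(real N)\<^sup>2 * 2"]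
    by (simp add: divide_le_eq)
  also have "\<dots> \<le> (7 * s)\<^sup>2" by (intro power_mono Ns) simp
  also have "\<dots> \<le> \<tau> * (7 * s)\<^sup>2" using assms by (simp add: mult_le_cancel_right1)
  also have "\<dots> \<le> \<tau> * (7 * s)\<^sup>2 * 2 ^ N"
    using mult_left_mono[of 1 "2 ^ N" "\<tau> * (7 * s)\<^sup>2"] assms by simp
  finally have 1: "((real N)\<^sup>2 - real N) / 2 \<le> 49 * (\<tau> * s\<^sup>2) * 2 ^ N" by (simp add: power_mult_distrib)
  have 2: "2 ^ N \<le> (\<tau> * s\<^sup>2) * 2 ^ N" using ss by (simp add: mult_le_cancel_right1)
  have "real N * (tau1 n m \<tau> + real N + 2) * 2 ^ (N - 1) \<le> 7 * s * (28 * (\<tau> * s)) * 2 ^ N"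
    using assms s1 Ns T le_tau1[of \<tau> n m] by (intro mult_mono power_increasing) auto
  then have 3: "real N * (tau1 n m \<tau> + real N + 2) * 2 ^ (N - 1) \<le> 196 * (\<tau> * s\<^sup>2) * 2 ^ N"
    by (simp add: power2_eq_square mult_ac)
  \<comment> \<open>246 = 49 + 1 + 196, from the three summands.\<close>
  have "eta1 n m \<tau> \<le> 246 * (\<tau> * s\<^sup>2) * 2 ^ N"
    unfolding eta1_def Let_def N_def[symmetric] using 1 2 3 by (simp only: distrib_right[symmetric])
  \<comment> \<open>Here \<open>246 \<le> 2^8\<close>, \<open>s \<le> 2^S\<close> and
    \<open>N \<le> 7 S\<close>; the exponent \<open>8 + 2 S + 7 S\<close> is at most
    \<open>17 S\<close> because \<open>S \<ge> 1\<close>.\<close>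
  also have "\<dots> \<le> 2 ^ 8 * (\<tau> * (2 ^ S)\<^sup>2) * 2 ^ (7 * S)"
  proof (intro mult_mono power_increasing NS)
    have "real S \<le> real (2 ^ S)" using less_exp[of S] by (intro of_nat_mono less_imp_le)
    then show "s\<^sup>2 \<le> (2 ^ S)\<^sup>2" by (intro power_mono) (simp_all add: s_def)
  qed (use assms in auto)
  also have "\<dots> = \<tau> * 2 ^ (8 + 9 * S)"
  proof -
    have "(2::real) ^ (9 * S) = (2 ^ S)\<^sup>2 * 2 ^ (7 * S)"
      by (simp add: power_add[symmetric] power_mult[symmetric])
    then show ?thesis by (simp add: power_add)
  qed
  also have "\<dots> \<le> \<tau> * 2 ^ (17 * S)"
    using assms s1 by (intro mult_left_mono power_increasing) (simp_all add: s_def)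
  also have "\<dots> = \<tau> * 2 powr (17 * real S)"
    using powr_realpow[of 2 "17 * S"] by simp
  finally show ?thesis by (simp add: S_def)
qed

text \<open>The equation forces \<open>h\<close>. Its growth is at most quadratic without a
  logarithm, so the power 0 of the logarithmic factor serves; 68 is \<open>17 * 2^2\<close>, from
  \<open>n + m + 1 \<le> 2 (n + m)\<close>.\<close>

lemma eta1_soft_O:
  "\<exists>h \<in> soft_O size_filter (\<lambda>(n, m, \<tau>0). (real n + real m)\<^sup>2).
    \<forall>n m \<tau>0. 1 \<le> n \<and> 1 \<le> m \<and> 1 \<le> \<tau>0 \<longrightarrow> eta1 n m \<tau>0 = \<tau>0 * 2 powr h (n, m, \<tau>0)"
proof
  define h :: "nat \<times> nat \<times> real \<Rightarrow> real" where "h = (\<lambda>(n, m, \<tau>). log 2 (eta1 n m \<tau> / \<tau>))"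
  show "\<forall>n m \<tau>0. 1 \<le> n \<and> 1 \<le> m \<and> 1 \<le> \<tau>0 \<longrightarrow> eta1 n m \<tau>0 = \<tau>0 * 2 powr h (n, m, \<tau>0)"
  proof (intro allI impI, elim conjE)
    fix n m :: nat and \<tau>0 :: real assume "1 \<le> \<tau>0"
    moreover from this have "\<tau>0 \<le> eta1 n m \<tau>0" by (rule le_eta1)
    ultimately show "eta1 n m \<tau>0 = \<tau>0 * 2 powr h (n, m, \<tau>0)" by (simp add: h_def)
  qed
  have bound: "\<bar>h (n, m, \<tau>)\<bar> \<le> 68 * (real n + real m)\<^sup>2" if "1 \<le> n" "1 \<le> \<tau>" for n m \<tau>
  proof -
    have lower: "1 \<le> eta1 n m \<tau> / \<tau>" using le_eta1[OF that(2), of n m] that(2) by simp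
    have "eta1 n m \<tau> / \<tau> \<le> 2 powr (17 * real ((n + m + 1)\<^sup>2))"
      using eta1_le[OF that(2), of n m] that(2) by (simp add: field_simps)
    then have "h (n, m, \<tau>) \<le> 17 * real ((n + m + 1)\<^sup>2)"
      using lower by (simp add: h_def log_le_iff)
    also have "\<dots> \<le> 17 * (2 * (real n + real m))\<^sup>2"
      unfolding of_nat_power using that(1) by (intro mult_left_mono power_mono) auto
    finally have "h (n, m, \<tau>) \<le> 68 * (real n + real m)\<^sup>2" by (simp only: power_mult_distrib) simp
    moreover have "0 \<le> h (n, m, \<tau>)" using lower by (simp add: h_def zero_le_log_cancel_iff)
    ultimately show ?thesis by simp
  qed
  have "h \<in> O[size_filter](\<lambda>x. (case x of (n, m, \<tau>0) \<Rightarrow> (real n + real m)\<^sup>2) *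
      ln (case x of (n, m, \<tau>0) \<Rightarrow> (real n + real m)\<^sup>2) ^ 0)"
  proof (rule bigoI)
    have "\<forall>\<^sub>F x in principal {(n, m, \<tau>0). 1 \<le> n \<and> 1 \<le> m \<and> 1 \<le> \<tau>0}.
        norm (h x) \<le> 68 * norm ((case x of (n, m, \<tau>0) \<Rightarrow> (real n + real m)\<^sup>2) *
          ln (case x of (n, m, \<tau>0) \<Rightarrow> (real n + real m)\<^sup>2) ^ 0)"
      unfolding eventually_principal using bound by auto
    then show "\<forall>\<^sub>F x in size_filter. norm (h x) \<le> 68 * norm ((case x of (n, m, \<tau>0) \<Rightarrow> (real n + real m)\<^sup>2) *
          ln (case x of (n, m, \<tau>0) \<Rightarrow> (real n + real m)\<^sup>2) ^ 0)"
      unfolding size_filter_def by (rule filter_leD[OF inf_le2])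
  qed
  then show "h \<in> soft_O size_filter (\<lambda>(n, m, \<tau>0). (real n + real m)\<^sup>2)"
    unfolding soft_O_def by blast
qed

lemma data_bitsize_ge_1: "1 \<le> data_bitsize A C b"
  unfolding data_bitsize_def by (simp add: Max_ge)

theorem corollary4p2:
  fixes A :: "'m::finite \<Rightarrow> int^'n::finite^'n" and C :: "int^'n^'n" and b :: "int^'m"
    and \<tau>0 :: real
    and \<A> :: "('n, 'm) aux_con \<Rightarrow> real^('n, 'm) blk^('n, 'm) blk"
    and \<beta> :: "('n, 'm) aux_con \<Rightarrow> real"
    and F :: "(('n, 'm) blk, ('n, 'm) aux_con) kkt_var \<Rightarrow>
      (('n, 'm) blk, ('n, 'm) aux_con) kkt_var cpoly"
    and n m :: nat and \<eta>1 :: real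
  assumes n: "n = CARD('n)" and m: "m = CARD('m)"
    and A_sym: "\<And>i. transpose (A i) = A i" and C_sym: "transpose C = C"
    and bitsize: "data_bitsize A C b \<le> \<tau>0"
    and standard_form: "encodes_aux A C b \<A> \<beta>"
    and square: "squared_up (kkt_poly \<A> \<beta> aux_objective) (tau1 n m \<tau>0) F"
    and eta: "\<eta>1 = eta1 n m \<tau>0"
  shows "(\<forall>\<gamma>. \<gamma> isolated_in zeros (range F) \<longrightarrow>
        (\<forall>k. \<gamma> $ k \<noteq> 0 \<longrightarrow> 2 powr (- \<eta>1) \<le> cmod (\<gamma> $ k) \<and> cmod (\<gamma> $ k) \<le> 2 powr \<eta>1)) \<and>
    (\<exists>h \<in> soft_O size_filter (\<lambda>(n, m, \<tau>0). (real n + real m)\<^sup>2).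
        \<forall>n m \<tau>0. 1 \<le> n \<and> 1 \<le> m \<and> 1 \<le> \<tau>0 \<longrightarrow> eta1 n m \<tau>0 = \<tau>0 * 2 powr h (n, m, \<tau>0)) \<and>
    (\<forall>\<gamma>. \<gamma> isolated_in zeros (range (kkt_poly \<A> \<beta> aux_objective)) \<longrightarrow>
        (\<forall>z. z \<noteq> 0 \<and>
          ((\<exists>p q. z = block_X (X_of \<gamma>) $ p $ q) \<or> (\<exists>p q. z = block_Z (X_of \<gamma>) $ p $ q) \<or>
           (\<exists>i. z = block_y (X_of \<gamma>) $ i) \<or> (\<exists>i. z = block_s (X_of \<gamma>) $ i) \<or>
           z = block_w (X_of \<gamma>) \<or> z = block_r (X_of \<gamma>))
          \<longrightarrow> cmod z \<le> 2 powr \<eta>1))"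
proof -
  let ?g = "kkt_poly \<A> \<beta> aux_objective"
  let ?I = "range Var_X :: (('n, 'm) blk, ('n, 'm) aux_con) kkt_var set"
  let ?J = "range Var_S \<union> range Var_y :: (('n, 'm) blk, ('n, 'm) aux_con) kkt_var set"
  define \<tau> where "\<tau> = tau1 n m \<tau>0"
  have card: "CARD((('n, 'm) blk, ('n, 'm) aux_con) kkt_var) = Nbar n m"
    by (simp add: card_kkt_var n m)
  \<comment> \<open>The 0 inserted in \<open>data_bitsize\<close> gives the value 1 even for zero
    data, whence the bitsize bound \<tau> of the square system is nonnegative.\<close>
  have "1 \<le> \<tau>0" using data_bitsize_ge_1 bitsize by (rule order_trans)
  then have \<tau>: "0 \<le> \<tau>" using le_tau1[of \<tau>0 n m] by (simp add: \<tau>_def)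
  obtain c :: "(('n, 'm) blk, ('n, 'm) aux_con) kkt_var \<Rightarrow> (('n, 'm) blk, ('n, 'm) aux_con) kkt_eq \<Rightarrow> int"
    where c: "\<And>v. F v = (\<Sum>e\<in>UNIV. of_int (c v e) * ?g e)"
    using square unfolding squared_up_def by blast
  have bi: "bipoly ?I ?J (F v)" for v
    unfolding c by (intro bipoly_sum bipoly_of_int_mult bipoly_kkt_poly)
  have int: "Poly_Mapping.lookup (F v) t \<in> \<int>" for v t
    using square unfolding squared_up_def by blast
  have le: "cmod (Poly_Mapping.lookup (F v) t) \<le> 2 powr \<tau>" for v t
  proof (cases "Poly_Mapping.lookup (F v) t = 0")
    case False
    then have "log 2 (cmod (Poly_Mapping.lookup (F v) t)) \<le> \<tau>"
      using square unfolding squared_up_def \<tau>_def by blast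
    with False show ?thesis by (simp add: log_le_iff)
  qed simp
  have cover: "?I \<union> ?J = UNIV" by (simp add: UNIV_kkt_var)
  have disj: "?I \<inter> ?J = {}" by auto
  have \<eta>: "\<eta>1 = ((real (Nbar n m))\<^sup>2 - real (Nbar n m)) / 2 + 2 ^ Nbar n m
      + real (Nbar n m) * (\<tau> + real (Nbar n m) + 2) * 2 ^ (Nbar n m - 1)"
    by (simp add: eta eta1_def Let_def \<tau>_def)
  note bounds = bipoly_system_isolated_zero_bounds[where F = F, OF disj cover bi int le \<tau>, unfolded card, folded \<eta>]
  \<comment> \<open>The transfer asks for the upper bound at every isolated zero of
    \<open>F\<close>, including those whose coordinate \<open>k\<close> is 0.\<close>
  have "cmod (\<gamma> $ k) \<le> 2 powr \<eta>1" if "\<gamma> isolated_in zeros (range ?g)" for \<gamma> k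
  proof (rule squared_up_isolated_zero_bound[OF square that])
    fix x assume "x isolated_in zeros (range F)"
    then show "cmod (x $ k) \<le> 2 powr \<eta>1" by (cases "x $ k = 0") (auto intro: bounds(2))
  qed
  \<comment> \<open>All six blocks consist of entries of the one matrix unknown, hence of
    coordinates of \<gamma>.\<close>
  then have "cmod z \<le> 2 powr \<eta>1"
    if "\<gamma> isolated_in zeros (range ?g)"
      "(\<exists>p q. z = block_X (X_of \<gamma>) $ p $ q) \<or> (\<exists>p q. z = block_Z (X_of \<gamma>) $ p $ q) \<or>
       (\<exists>i. z = block_y (X_of \<gamma>) $ i) \<or> (\<exists>i. z = block_s (X_of \<gamma>) $ i) \<or>
       z = block_w (X_of \<gamma>) \<or> z = block_r (X_of \<gamma>)" for \<gamma> z
    using that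
    by (auto simp: block_X_def block_Z_def block_y_def block_s_def block_w_def block_r_def X_of_def)
  then show ?thesis using bounds eta1_soft_O by blast
qed

end
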